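(* Let $H>0$ and let $w=w(t,y,z)$ and $T=T(t,y,z)$, $z\in[0,H]$, be periodic in $y$ (period $\Lambda$ in each horizontal direction) and satisfy $$\Delta^2w=-\Delta_yT\quad\text{in }z\in(0,H),\qquad w=\partial_zw=0\ \text{ for }z\in\{0,H\}.$$ Then for any $0<\delta\ll H$ and $\alpha>1$ it holds $$\int_0^{\delta}\frac{\langle|\nabla_y^{-1}w|^2\rangle}{z^{5-\alpha}}\,dz+\int_0^{\delta}\frac{\langle|\nabla_y^{-1}\partial_zw|^2\rangle}{z^{3-\alpha}}\,dz\;\lesssim\;\frac{\delta^{\alpha}}{\alpha-1}\ln^2\left(\frac H\delta\right)\int_0^H\frac{\langle Tw\rangle}{z}\,dz$$ and $$\int_{\delta}^H\frac{\langle|\nabla_y^{-1}w|^2\rangle}{z^5}\,dz+\int_{\delta}^H\frac{\langle|\nabla_y^{-1}\partial_zw|^2\rangle}{z^3}\,dz\;\lesssim\;\ln^2\left(\frac H\delta\right)\int_0^H\frac{\langle Tw\rangle}{z}\,dz .$$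
   Context: Let $d\ge2$, $\Lambda>0$. Space points are $x=(y,z)\in\mathbb{R}^{d-1}\times[0,H]$; $\Delta$ is the Laplacian in $x$ and $\Delta_y$ the Laplacian in the horizontal variables $y$. Functions may depend on time $t\ge0$, which enters the equation only as a parameter, and are assumed sufficiently smooth. For a function $f(t,y)$ the horizontal space and time average is $$\langle f\rangle:=\limsup_{t_0\uparrow\infty}\frac1{t_0}\int_0^{t_0}\frac1{\Lambda^{d-1}}\int_{[0,\Lambda)^{d-1}}f(t,y)\,dy\,dt,$$ applied at each fixed $z$ for functions of $(t,y,z)$. For a $\Lambda$-periodic function $f(y)$ put $$\mathcal{F}f(k):=\frac1{\Lambda^{d-1}}\int_{[0,\Lambda)^{d-1}}e^{ik\cdot y}f(y)\,dy,\qquad \frac1{\Lambda^{d-1}}\int_{[0,\Lambda)^{d-1}}|\nabla_y^{-1}f|^2\,dy:=\sum_{k\in\frac{2\pi}{\Lambda}\mathbb{Z}^{d-1}}|k|^{-2}|\mathcal{F}f(k)|^2 ,$$ which defines $\langle|\nabla_y^{-1}f|^2\rangle$ after time averaging; it is applied to functions with zero horizontal mean, so the $k=0$ term is omitted (the equation and boundary conditions force the horizontal mean of $w$ to vanish). $\ln^2 s=(\ln s)^2$. $\delta\ll H$ means $\delta\le cH$ for a sufficiently small constant $c$. $A\lesssim B$ means $A\le CB$ with a universal constant $C$, independent of $H,\Lambda,\delta,\alpha,T,w$.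
   Formalization: The formal version additionally assumes that T is bounded uniformly in time and space; without this the claim fails, since for T unbounded in time the positive part of ⟨Tw⟩ can escape to z=0 and the right side can become negative. *)

theory Defs
  imports "HOL-Analysis.Analysis"
begin

text \<open>
  Functions of time, horizontal position and height are curried as \<open>f t y z\<close> with
  \<open>t \<ge> 0\<close>, \<open>y :: real^'n\<close> and \<open>0 \<le> z \<le> H\<close>; the space dimension is \<open>d = CARD('n) + 1 \<ge> 2\<close>.
\<close>

type_synonym 'n field_fun = "real \<Rightarrow> real^'n \<Rightarrow> real \<Rightarrow> real"

definition dy :: "'n::finite \<Rightarrow> 'n field_fun \<Rightarrow> 'n field_fun" where
  "dy i f = (\<lambda>t y z. deriv (\<lambda>s. f t (y + s *\<^sub>R axis i 1) z) 0)"

text \<open>One-sided at \<open>z = 0\<close> and \<open>z = H\<close>; for \<open>0 < z < H\<close> the usual derivative.\<close>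

definition dz :: "real \<Rightarrow> 'n::finite field_fun \<Rightarrow> 'n field_fun" where
  "dz H f = (\<lambda>t y z. vector_derivative (f t y) (at z within {0..H}))"

definition laplace_y :: "'n::finite field_fun \<Rightarrow> 'n field_fun" where
  "laplace_y f = (\<lambda>t y z. \<Sum>i\<in>UNIV. dy i (dy i f) t y z)"

definition laplace :: "real \<Rightarrow> 'n::finite field_fun \<Rightarrow> 'n field_fun" where
  "laplace H f = (\<lambda>t y z. laplace_y f t y z + dz H (dz H f) t y z)"

text \<open>
  All space derivatives of order at most \<open>k\<close> exist up to the boundary and are jointly continuous
  in \<open>(t, y, z)\<close>. No differentiability in \<open>t\<close> is required.
\<close>

primrec C_slab :: "nat \<Rightarrow> real \<Rightarrow> 'n::finite field_fun \<Rightarrow> bool" where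
  "C_slab 0 H f \<longleftrightarrow> continuous_on ({0..} \<times> UNIV \<times> {0..H}) (\<lambda>(t, y, z). f t y z)"
| "C_slab (Suc k) H f \<longleftrightarrow>
     continuous_on ({0..} \<times> UNIV \<times> {0..H}) (\<lambda>(t, y, z). f t y z) \<and>
     (\<forall>t\<ge>0. \<forall>y. \<forall>z\<in>{0..H}.
        f t y differentiable (at z within {0..H}) \<and>
        (\<forall>i. (\<lambda>s. f t (y + s *\<^sub>R axis i 1) z) differentiable (at 0))) \<and>
     C_slab k H (dz H f) \<and> (\<forall>i. C_slab k H (dy i f))"

definition periodic_y :: "real \<Rightarrow> real \<Rightarrow> 'n::finite field_fun \<Rightarrow> bool" where
  "periodic_y \<Lambda> H f \<longleftrightarrow>
     (\<forall>t\<ge>0. \<forall>y. \<forall>z\<in>{0..H}. \<forall>i. f t (y + \<Lambda> *\<^sub>R axis i 1) z = f t y z)"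

definition cell :: "real \<Rightarrow> (real^'n::finite) set" where
  "cell \<Lambda> = {y. \<forall>i. 0 \<le> y $ i \<and> y $ i < \<Lambda>}"

definition time_mean :: "(real \<Rightarrow> real) \<Rightarrow> ereal" where
  "time_mean g = Limsup at_top (\<lambda>t0. ereal ((LBINT t:{0..t0}. g t) / t0))"

definition mean :: "real \<Rightarrow> (real \<Rightarrow> real^'n::finite \<Rightarrow> real) \<Rightarrow> ereal" where
  "mean \<Lambda> f = time_mean (\<lambda>t. (LBINT y:cell \<Lambda>. f t y) / \<Lambda> ^ CARD('n))"

definition fourier :: "real \<Rightarrow> (real^'n::finite \<Rightarrow> real) \<Rightarrow> real^'n \<Rightarrow> complex" where
  "fourier \<Lambda> f k =
     (LBINT y:cell \<Lambda>. exp (\<i> * of_real (k \<bullet> y)) * of_real (f y)) / of_real (\<Lambda> ^ CARD('n))"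

definition dual_lattice :: "real \<Rightarrow> (real^'n::finite) set" where
  "dual_lattice \<Lambda> = {k. \<forall>i. \<exists>m::int. k $ i = 2 * pi / \<Lambda> * of_int m}"

text \<open>The horizontal average of \<open>|\<nabla>\<^sub>y\<inverse>f|\<^sup>2\<close>, the mode \<open>k = 0\<close> being omitted.\<close>

definition inv_grad_sq :: "real \<Rightarrow> (real^'n::finite \<Rightarrow> real) \<Rightarrow> real" where
  "inv_grad_sq \<Lambda> f =
     (\<Sum>\<^sub>\<infinity>k\<in>dual_lattice \<Lambda> - {0}. (cmod (fourier \<Lambda> f k))\<^sup>2 / (norm k)\<^sup>2)"

definition mean_inv_grad_sq :: "real \<Rightarrow> (real \<Rightarrow> real^'n::finite \<Rightarrow> real) \<Rightarrow> ereal" where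
  "mean_inv_grad_sq \<Lambda> f = time_mean (\<lambda>t. inv_grad_sq \<Lambda> (f t))"

text \<open>
  The left-hand sides are integrals of nonnegative functions and are taken in \<^typ>\<open>ennreal\<close>.
  The average of \<open>T w\<close> has no sign; it is finite whenever \<open>T\<close> is bounded, and then its
  weighted integral is an ordinary Lebesgue integral.
\<close>

definition weighted_integral ::
    "real set \<Rightarrow> real \<Rightarrow> real \<Rightarrow> 'n::finite field_fun \<Rightarrow> ennreal" where
  "weighted_integral A p \<Lambda> f =
     (\<integral>\<^sup>+ z\<in>A. e2ennreal (mean_inv_grad_sq \<Lambda> (\<lambda>t y. f t y z)) / ennreal (z powr p) \<partial>lborel)"

definition flux_integral ::
    "real \<Rightarrow> real \<Rightarrow> 'n::finite field_fun \<Rightarrow> 'n field_fun \<Rightarrow> real" where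
  "flux_integral H \<Lambda> T w =
     (LBINT z:{0<..<H}. real_of_ereal (mean \<Lambda> (\<lambda>t y. T t y z * w t y z)) / z)"

end

theory Submission
  imports Defs
begin

text \<open>
The estimate rests on a change of variables. Let \<open>w\<^sub>k\<close> and \<open>T\<^sub>k\<close> be the Fourier coefficients of \<open>w\<close> and \<open>T\<close> in
the horizontal variables, so that \<open>w\<^sub>k'''' - 2 |k|\<^sup>2 w\<^sub>k'' + |k|^4 w\<^sub>k = |k|\<^sup>2 T\<^sub>k\<close>. In the variables \<open>s = ln z\<close> and
\<open>v = w\<^sub>k / z\<^sup>2\<close> the quadratic form \<open>\<integral> w\<^sub>k w\<^sub>k'''' / z dz\<close> has constant coefficients: it equals
\<open>\<integral> ((\<partial>\<^sub>s v)\<^sup>2 + (\<partial>\<^sub>s\<^sup>2 v)\<^sup>2) ds\<close> plus a nonnegative boundary term at the wall \<open>z = 0\<close>. The lower-order terms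
contribute nonnegatively. Hence \<open>|k|\<^sup>2 \<integral> T\<^sub>k w\<^sub>k / z dz\<close> controls this energy, and because \<open>v\<close> and \<open>\<partial>\<^sub>s v\<close> vanish
at \<open>z = H\<close>, their squares at height \<open>z\<close> are at most \<open>ln (H / z)\<close>, the length of the interval in \<open>s\<close>, times the
energy. Since \<open>w\<^sub>k = z\<^sup>2 v\<close> and \<open>w\<^sub>k' = z (\<partial>\<^sub>s v + 2 v)\<close>, this gives pointwise bounds of \<open>|w\<^sub>k|\<^sup>2\<close> by
\<open>z^4 ln (H / z)\<close> and of \<open>|w\<^sub>k'|\<^sup>2\<close> by \<open>10 z\<^sup>2 ln (H / z)\<close>, both times \<open>|k|\<^sup>2 \<integral> T\<^sub>k w\<^sub>k / z dz\<close>
(\<open>weighted_bound\<close>, applied to the real and the imaginary part separately).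

Divided by \<open>|k|\<^sup>2\<close> and summed over \<open>k\<close>, these bounds control the negative norms at each time and height by the
weighted integral of the horizontal average of \<open>T w\<close> at that time (\<open>inv_grad_sq_bounds\<close>). The summation uses
Parseval's identity on the torus (\<open>parseval\<close>, from the Stone--Weierstrass theorem) and the fact that each mode
contributes a nonnegative amount.

Being pointwise in \<open>z\<close>, the bounds are inherited by the long-time averages on the left-hand side. On the
right-hand side the upper limit in time has to be moved inside the integral over \<open>z\<close>, and for this inequality
(\<open>time_mean_total_flux_le\<close>) one needs a majorant: as \<open>T\<close> is bounded, the energy estimate for each mode bounds
the average of \<open>T w\<close>, divided by \<open>z\<close>, uniformly in time and height (\<open>flux_abs_le\<close>). What remains is to integrate
\<open>ln (H / z)\<close> against powers of \<open>z\<close>, below \<open>\<delta>\<close> (\<open>boundary_layer_estimate\<close>) and above it (\<open>bulk_estimate\<close>).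
\<close>

section \<open>The weighted estimate for one horizontal mode\<close>

text \<open>
The Cauchy--Schwarz inequality for \<open>v y - v x = \<integral> u \<omega>\<close> against the weight \<open>\<omega> = W'\<close>, stated for an
antiderivative \<open>\<Phi>\<close> of a majorant of \<open>u\<^sup>2 \<omega>\<close>. It holds because \<open>\<Phi> - 2 c v + c\<^sup>2 W\<close> is nondecreasing for
every constant \<open>c\<close>, its derivative being at least \<open>(u - c)\<^sup>2 \<omega>\<close>. Working with antiderivatives avoids
all improper integrals: below, \<open>\<Phi>\<close> is a load integral corrected by boundary terms.
\<close>

lemma cauchy_schwarz_by_derivatives:
  fixes v u W \<omega> \<Phi> \<phi> :: "real \<Rightarrow> real"
  assumes "x < y" and W: "W x < W y"
    and cont: "continuous_on {x..y} v" "continuous_on {x..y} W" "continuous_on {x..y} \<Phi>"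
    and v': "\<And>s. x < s \<Longrightarrow> s < y \<Longrightarrow> DERIV v s :> u s * \<omega> s"
    and W': "\<And>s. x < s \<Longrightarrow> s < y \<Longrightarrow> DERIV W s :> \<omega> s"
    and \<Phi>': "\<And>s. x < s \<Longrightarrow> s < y \<Longrightarrow> DERIV \<Phi> s :> \<phi> s"
    and \<omega>: "\<And>s. x < s \<Longrightarrow> s < y \<Longrightarrow> 0 \<le> \<omega> s"
    and dom: "\<And>s. x < s \<Longrightarrow> s < y \<Longrightarrow> (u s)\<^sup>2 * \<omega> s \<le> \<phi> s"
  shows "(v y - v x)\<^sup>2 \<le> (W y - W x) * (\<Phi> y - \<Phi> x)"
proof -
  define S where "S = W y - W x"
  \<comment> \<open>the value of \<open>c\<close> that optimizes the inequality\<close>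
  define c where "c = (v y - v x) / S"
  have S: "S > 0" using W by (simp add: S_def)
  have "\<Phi> x - 2 * c * v x + c\<^sup>2 * W x \<le> \<Phi> y - 2 * c * v y + c\<^sup>2 * W y"
  proof (rule DERIV_nonneg_imp_increasing_open[of x y "\<lambda>s. \<Phi> s - 2 * c * v s + c\<^sup>2 * W s"])
    show "continuous_on {x..y} (\<lambda>s. \<Phi> s - 2 * c * v s + c\<^sup>2 * W s)"
      by (intro continuous_intros cont)
    fix s assume s: "x < s" "s < y"
    have "DERIV (\<lambda>s. \<Phi> s - 2 * c * v s + c\<^sup>2 * W s) s :> \<phi> s - 2 * c * (u s * \<omega> s) + c\<^sup>2 * \<omega> s"
      by (intro derivative_intros DERIV_cmult v'[OF s] W'[OF s] \<Phi>'[OF s])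
    moreover have "0 \<le> (u s - c)\<^sup>2 * \<omega> s" using \<omega>[OF s] by simp
    then have "0 \<le> \<phi> s - 2 * c * (u s * \<omega> s) + c\<^sup>2 * \<omega> s"
      using dom[OF s] by (simp add: power2_eq_square algebra_simps)
    ultimately show "\<exists>d. DERIV (\<lambda>s. \<Phi> s - 2 * c * v s + c\<^sup>2 * W s) s :> d \<and> 0 \<le> d" by blast
  qed (use \<open>x < y\<close> in simp)
  then have "2 * c * (v y - v x) - c\<^sup>2 * S \<le> \<Phi> y - \<Phi> x"
    by (simp add: S_def algebra_simps)
  moreover have "2 * c * (v y - v x) - c\<^sup>2 * S = (v y - v x)\<^sup>2 / S"
    using S by (simp add: c_def power2_eq_square)
  ultimately show ?thesis using S by (simp add: pos_divide_le_eq S_def mult.commute)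
qed

text \<open>
One Fourier mode of the problem: \<open>l\<close> is the squared wave number, \<open>a\<close> a real mode of \<open>w\<close> with its vertical
derivatives \<open>a1\<close> to \<open>a4\<close>, and \<open>\<tau>\<close> the same mode of \<open>T\<close>.
\<close>

locale clamped_mode =
  fixes H l :: real and a a1 a2 a3 a4 \<tau> :: "real \<Rightarrow> real"
  assumes H: "0 < H" and l: "0 \<le> l"
    and d1: "\<And>z. z \<in> {0..H} \<Longrightarrow> (a has_real_derivative a1 z) (at z within {0..H})"
    and d2: "\<And>z. z \<in> {0..H} \<Longrightarrow> (a1 has_real_derivative a2 z) (at z within {0..H})"
    and d3: "\<And>z. z \<in> {0..H} \<Longrightarrow> (a2 has_real_derivative a3 z) (at z within {0..H})"
    and d4: "\<And>z. z \<in> {0..H} \<Longrightarrow> (a3 has_real_derivative a4 z) (at z within {0..H})"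
    and ode: "\<And>z. z \<in> {0<..<H} \<Longrightarrow> a4 z - 2 * l * a2 z + l\<^sup>2 * a z = l * \<tau> z"
    and clamped: "a 0 = 0" "a1 0 = 0" "a H = 0" "a1 H = 0"
    and cont_\<tau>: "continuous_on {0..H} \<tau>"
begin

lemma cont_a: "continuous_on {0..H} a" "continuous_on {0..H} a1"
    "continuous_on {0..H} a2" "continuous_on {0..H} a3"
  using DERIV_continuous_on d1 d2 d3 d4 by metis+

lemma interior_derivatives:
  assumes "0 < z" "z < H"
  shows "DERIV a z :> a1 z" "DERIV a1 z :> a2 z" "DERIV a2 z :> a3 z" "DERIV a3 z :> a4 z"
  using d1[of z] d2[of z] d3[of z] d4[of z] assms by (auto simp: at_within_Icc_at)

text \<open>
Since \<open>a\<close> vanishes to second order at the wall and \<open>x / 0 = 0\<close>, the quotient is continuous up to \<open>z = 0\<close>,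
so that its integral over \<open>{0..H}\<close> is a proper one.
\<close>

lemma cont_quot: "continuous_on {0..H} (\<lambda>z. \<tau> z * a z / z)"
proof -
  have "continuous_on {0..H} (\<lambda>z. a z / z)"
    unfolding continuous_on_def
  proof
    fix z assume z: "z \<in> {0..H}"
    show "((\<lambda>z. a z / z) \<longlongrightarrow> a z / z) (at z within {0..H})"
    proof (cases "z = 0")
      case True
      with d1[OF z] clamped show ?thesis
        by (simp add: has_field_derivative_iff)
    next
      case False
      with cont_a(1) z show ?thesis
        by (auto intro!: tendsto_intros simp: continuous_on_def)
    qed
  qed
  from continuous_on_mult[OF cont_\<tau> this] show ?thesis by simp
qed

lemma curvature_limit:
  "(a2 \<longlongrightarrow> a2 0) (at_right 0)" "(a3 \<longlongrightarrow> a3 0) (at_right 0)"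
  "((\<lambda>z. a1 z / z) \<longlongrightarrow> a2 0) (at_right 0)" "((\<lambda>z. a z / z\<^sup>2) \<longlongrightarrow> a2 0 / 2) (at_right 0)"
proof -
  have within: "at_right 0 = at 0 within {0..H}"
    using H by (simp add: at_within_Icc_at_right)
  show "(a2 \<longlongrightarrow> a2 0) (at_right 0)" "(a3 \<longlongrightarrow> a3 0) (at_right 0)"
    unfolding within using cont_a H by (auto simp: continuous_on_def)
  show *: "((\<lambda>z. a1 z / z) \<longlongrightarrow> a2 0) (at_right 0)"
    unfolding within using d2[of 0] H clamped by (simp add: has_field_derivative_iff)
  have ev: "eventually (\<lambda>z. 0 < z \<and> z < H) (at_right 0)"
    using H eventually_at_right by (auto simp: eventually_at_right_field)
  show "((\<lambda>z. a z / z\<^sup>2) \<longlongrightarrow> a2 0 / 2) (at_right 0)"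
  proof (rule lhopital_right_0[where f'=a1 and g'="\<lambda>z. 2 * z"])
    show "(a \<longlongrightarrow> 0) (at_right 0)"
      unfolding within using cont_a(1) H clamped by (force simp: continuous_on_def)
    show "((\<lambda>z::real. z\<^sup>2) \<longlongrightarrow> 0) (at_right 0)"
      by (auto intro!: tendsto_eq_intros)
    show "\<forall>\<^sub>F z in at_right 0. (a has_real_derivative a1 z) (at z)"
      using ev by eventually_elim (rule interior_derivatives, auto)
    show "((\<lambda>z. a1 z / (2 * z)) \<longlongrightarrow> a2 0 / 2) (at_right 0)"
      using tendsto_divide[OF * tendsto_const[of 2]] by (simp add: field_simps)
  qed (use ev in \<open>auto elim!: eventually_mono intro!: derivative_eq_intros\<close>)
qed

text \<open>
The energy estimate \<open>\<integral> a2\<^sup>2 \<le> \<integral> \<tau>\<^sup>2 / 2\<close>, obtained by testing the equation with \<open>a\<close>, in pointwise form. Its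
constant does not depend on \<open>l\<close>, so that Bessel's inequality for \<open>T\<close> allows it to be summed over the modes.
\<close>

lemma slope_sq_le:
  assumes z: "0 < z" "z < H"
  shows "(a1 z)\<^sup>2 \<le> z * integral {0..H} (\<lambda>s. (\<tau> s)\<^sup>2 / 2)"
proof -
  define J where "J x = integral {0..x} (\<lambda>s. (\<tau> s)\<^sup>2 / 2)" for x
  \<comment> \<open>a majorant of the work of the load minus the boundary terms from integrating \<open>a a4 - 2 l a a2\<close> by parts;
    the boundary terms vanish at both ends\<close>
  define \<Phi> where "\<Phi> x = J x - (a x * a3 x - a1 x * a2 x - 2 * l * a x * a1 x)" for x
  define \<phi> where "\<phi> x = (\<tau> x)\<^sup>2 / 2 - (a x * a4 x - (a2 x)\<^sup>2 - 2 * l * ((a1 x)\<^sup>2 + a x * a2 x))" for x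
  have cont2: "continuous_on {0..H} (\<lambda>s. (\<tau> s)\<^sup>2 / 2)"
    by (intro continuous_intros cont_\<tau>) auto
  have J: "(J has_real_derivative (\<tau> x)\<^sup>2 / 2) (at x within {0..H})" if "x \<in> {0..H}" for x
    unfolding J_def using integral_has_real_derivative[OF cont2 that] by simp
  have contJ: "continuous_on {0..H} J"
    by (rule DERIV_continuous_on[OF J])
  have cont\<Phi>: "continuous_on {0..H} \<Phi>"
    unfolding \<Phi>_def by (intro continuous_intros contJ cont_a)
  have \<Phi>': "DERIV \<Phi> x :> \<phi> x" if "0 < x" "x < H" for x
  proof -
    have "DERIV J x :> (\<tau> x)\<^sup>2 / 2" using J[of x] that by (simp add: at_within_Icc_at)
    then show ?thesis unfolding \<Phi>_def \<phi>_def
      by (auto intro!: derivative_eq_intros interior_derivatives that simp: power2_eq_square algebra_simps)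
  qed
  have dom: "(a2 x)\<^sup>2 \<le> \<phi> x" if "0 < x" "x < H" for x
  proof -
    have "a4 x = l * \<tau> x + 2 * l * a2 x - l\<^sup>2 * a x" using ode[of x] that by simp
    note a4 = this
    have "\<phi> x - (a2 x)\<^sup>2 = (\<tau> x - l * a x)\<^sup>2 / 2 + l\<^sup>2 * (a x)\<^sup>2 / 2 + 2 * l * (a1 x)\<^sup>2"
      unfolding \<phi>_def a4 by (simp add: power2_eq_square field_simps)
    moreover have "0 \<le> \<dots>" using l by simp
    ultimately show ?thesis by linarith
  qed
  have "\<Phi> z \<le> \<Phi> H"
  proof (rule DERIV_nonneg_imp_increasing_open[where f=\<Phi>])
    fix x assume x: "z < x" "x < H"
    then have "0 \<le> \<phi> x" using z dom[of x] zero_le_power2[of "a2 x"] by linarith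
    with \<Phi>'[of x] x z show "\<exists>y. DERIV \<Phi> x :> y \<and> 0 \<le> y" by auto
  qed (use z in \<open>auto intro!: continuous_on_subset[OF cont\<Phi>]\<close>)
  moreover have "(a1 z - a1 0)\<^sup>2 \<le> (z - 0) * (\<Phi> z - \<Phi> 0)"
    by (rule cauchy_schwarz_by_derivatives[where W="\<lambda>x. x" and \<omega>="\<lambda>_. 1" and u=a2 and \<phi>=\<phi>])
       (use z \<Phi>' dom interior_derivatives in \<open>auto intro!: continuous_on_subset[OF cont\<Phi>] continuous_on_subset[OF cont_a(2)] continuous_intros\<close>)
  moreover have "\<Phi> 0 = 0" "\<Phi> H = integral {0..H} (\<lambda>s. (\<tau> s)\<^sup>2 / 2)"
    by (simp_all add: \<Phi>_def J_def clamped)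
  ultimately have "(a1 z)\<^sup>2 \<le> z * \<Phi> z" "z * \<Phi> z \<le> z * \<Phi> H"
    using z clamped by (simp_all add: mult_left_mono)
  then show ?thesis by (simp add: \<open>\<Phi> H = integral {0..H} (\<lambda>s. (\<tau> s)\<^sup>2 / 2)\<close>)
qed

lemma displacement_sq_le:
  assumes z: "0 < z" "z < H"
  shows "(a z)\<^sup>2 \<le> z\<^sup>2 * (H * integral {0..H} (\<lambda>s. (\<tau> s)\<^sup>2 / 2))"
proof -
  define E where "E = integral {0..H} (\<lambda>s. (\<tau> s)\<^sup>2 / 2)"
  have E: "0 \<le> E" unfolding E_def by (rule integral_nonneg)
      (auto intro!: integrable_continuous_interval continuous_intros cont_\<tau>)
  obtain s where s: "0 < s" "s < z" "a z - a 0 = (z - 0) * a1 s"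
  proof (rule mvt[of 0 z a "\<lambda>x h. a1 x * h"])
    show "continuous_on {0..z} a" using z by (intro continuous_on_subset[OF cont_a(1)]) auto
  qed (use z interior_derivatives(1) in \<open>auto simp: has_field_derivative_def intro: that\<close>)
  have "(a z)\<^sup>2 = z\<^sup>2 * (a1 s)\<^sup>2" using s clamped by (simp add: power_mult_distrib)
  also have "\<dots> \<le> z\<^sup>2 * (H * E)"
  proof (rule mult_left_mono)
    have "(a1 s)\<^sup>2 \<le> s * E" using slope_sq_le[of s] s z by (simp add: E_def)
    also have "\<dots> \<le> H * E" using s z E by (intro mult_right_mono) auto
    finally show "(a1 s)\<^sup>2 \<le> H * E" .
  qed simp
  finally show ?thesis by (simp add: E_def)
qed

text \<open>
The heart of the argument. With \<open>s = ln z\<close> and \<open>v = a / z\<^sup>2\<close> one has \<open>a4 = z powr (-2) P(\<partial>\<^sub>s) v\<close> where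
\<open>P(X) = (X + 2) (X + 1) X (X - 1) = X^4 + 2 X^3 - X\<^sup>2 - 2 X\<close>, so that \<open>a a4 / z dz = v P(\<partial>\<^sub>s) v ds\<close> equals
\<open>(\<partial>\<^sub>s\<^sup>2 v)\<^sup>2 + (\<partial>\<^sub>s v)\<^sup>2\<close> up to an exact derivative. The second-order term of the equation is nonnegative
as well: with \<open>u = a / z\<close>, \<open>- a a2 / z\<close> equals \<open>z u'\<^sup>2\<close> up to an exact derivative.

Both \<open>v\<close> and \<open>\<partial>\<^sub>s v\<close> vanish at \<open>z = H\<close>, and the interval from \<open>z\<close> to \<open>H\<close> has length \<open>ln (H / z)\<close> in the
variable \<open>s\<close>; Cauchy--Schwarz then gives the pointwise bounds, since \<open>a = z\<^sup>2 v\<close> and \<open>a1 = z (\<partial>\<^sub>s v + 2 v)\<close>.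
The logarithm enters because a constant \<open>v\<close> costs no energy.
\<close>

lemma weighted_bound:
  fixes I :: real
  assumes z: "0 < z" "z < H"
  defines "I \<equiv> integral {0..H} (\<lambda>s. \<tau> s * a s / s)"
  shows "(a z)\<^sup>2 \<le> z ^ 4 * ln (H / z) * (l * I)"
    and "(a1 z)\<^sup>2 \<le> 10 * z\<^sup>2 * ln (H / z) * (l * I)"
proof -
  define v where "v x = a x / x\<^sup>2" for x
  \<comment> \<open>\<open>v1\<close>, \<open>v2\<close>, \<open>v3\<close> are the derivatives of \<open>v\<close> with respect to \<open>s = ln x\<close>\<close>
  define v1 where "v1 x = a1 x / x - 2 * (a x / x\<^sup>2)" for x
  define v2 where "v2 x = a2 x - 3 * (a1 x / x) + 4 * (a x / x\<^sup>2)" for x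
  define v3 where "v3 x = x * a3 x - 3 * a2 x + 7 * (a1 x / x) - 8 * (a x / x\<^sup>2)" for x
  \<comment> \<open>the exact derivatives split off: the first line belongs to \<open>v P(\<partial>\<^sub>s) v\<close>, the second to \<open>- 2 l a a2 / z\<close>\<close>
  define \<Psi> where "\<Psi> x = v x * v3 x - v1 x * v2 x + 2 * v x * v2 x - (v1 x)\<^sup>2 - v x * v1 x - (v x)\<^sup>2
      + 2 * l * (- (a x * a1 x / x) + (a x)\<^sup>2 / (2 * x\<^sup>2))" for x
  define J where "J x = integral {0..x} (\<lambda>s. \<tau> s * a s / s)" for x
  define \<Phi> where "\<Phi> x = l * J x - \<Psi> x" for x
  define \<phi> where "\<phi> x = ((v1 x)\<^sup>2 + (v2 x)\<^sup>2) / x + 2 * l * ((a1 x - a x / x)\<^sup>2 / x)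
      + l\<^sup>2 * (a x)\<^sup>2 / x" for x
  have v': "DERIV v x :> v1 x * (1 / x)" and v1': "DERIV v1 x :> v2 x * (1 / x)"
    and v2': "DERIV v2 x :> v3 x * (1 / x)"
    if x: "0 < x" "x < H" for x
    unfolding v_def v1_def v2_def v3_def using x
    by (auto intro!: derivative_eq_intros interior_derivatives simp: power2_eq_square field_simps)
  have J: "(J has_real_derivative \<tau> x * a x / x) (at x within {0..H})" if "x \<in> {0..H}" for x
    unfolding J_def using integral_has_real_derivative[OF cont_quot that] by simp
  have contJ: "continuous_on {0..H} J"
    by (rule DERIV_continuous_on[OF J])
  have cont: "continuous_on {x..H} v" "continuous_on {x..H} v1" "continuous_on {x..H} v2"
    "continuous_on {x..H} \<Phi>" if "0 < x" for x
  proof -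
    have "{x..H} \<subseteq> {0..H}" using that by auto
    note [continuous_intros] = cont_a[THEN continuous_on_subset, OF this] contJ[THEN continuous_on_subset, OF this]
    show "continuous_on {x..H} v" "continuous_on {x..H} v1" "continuous_on {x..H} v2"
    "continuous_on {x..H} \<Phi>"
      unfolding v_def v1_def v2_def v3_def \<Phi>_def \<Psi>_def
      by (intro continuous_intros; use that in force)+
  qed
  have \<Phi>': "DERIV \<Phi> x :> \<phi> x" if x: "0 < x" "x < H" for x
  proof -
    have J': "DERIV J x :> \<tau> x * a x / x" using J[of x] x by (simp add: at_within_Icc_at)
    have v3': "DERIV v3 x :> a4 x * x - 2 * a3 x + (7 * (a2 x / x) - 7 * (a1 x / x\<^sup>2)) - 8 * (v1 x * (1/x))"
      unfolding v_def v1_def v2_def v3_def using x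
      by (auto intro!: derivative_eq_intros interior_derivatives simp: power2_eq_square field_simps)
    have ode': "l * \<tau> x = a4 x - 2 * l * a2 x + l\<^sup>2 * a x" using ode[of x] x by simp
    have "DERIV \<Phi> x :> l * (\<tau> x * a x / x) - (
        (v1 x * (1/x)) * v3 x + v x * (a4 x * x - 2 * a3 x + (7 * (a2 x / x) - 7 * (a1 x / x\<^sup>2)) - 8 * (v1 x * (1/x)))
        - ((v2 x * (1/x)) * v2 x + v1 x * (v3 x * (1/x)))
        + 2 * ((v1 x * (1/x)) * v2 x + v x * (v3 x * (1/x)))
        - 2 * v1 x * (v2 x * (1/x))
        - ((v1 x * (1/x)) * v1 x + v x * (v2 x * (1/x)))
        - 2 * v x * (v1 x * (1/x))
        + 2 * l * (- ((a1 x * a1 x + a x * a2 x) / x - a x * a1 x / x\<^sup>2)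
             + (a x * a1 x / x\<^sup>2 - (a x)\<^sup>2 / x ^ 3)))"
      (is "DERIV _ _ :> ?d")
      unfolding \<Phi>_def \<Psi>_def using x
      by (auto intro!: derivative_eq_intros J' v'[OF x] v1'[OF x] v2'[OF x] v3' interior_derivatives)
         (simp add: field_simps power2_eq_square power3_eq_cube power4_eq_xxxx)
    moreover have "?d = \<phi> x"
    proof -
      \<comment> \<open>in terms of \<open>b = v\<close> and \<open>c = a1 / x\<close> the identity is polynomial, except for powers of \<open>x\<close>\<close>
      define b c where "b = a x / x\<^sup>2" and "c = a1 x / x"
      have subst: "a x = b * x\<^sup>2" "a1 x = c * x" using x by (simp_all add: b_def c_def)
      have load: "l * (\<tau> x * a x / x) = (l * \<tau> x) * (b * x)"
        using x by (simp add: subst power2_eq_square)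
      have quot: "a x / x = b * x" "a x / x\<^sup>2 = b" "a1 x / x = c" "a1 x / x\<^sup>2 = c / x"
        "a x * a1 x / x = b * c * x\<^sup>2" "a x * a1 x / x\<^sup>2 = b * c * x" "(a x)\<^sup>2 / x ^ 3 = b\<^sup>2 * x"
        "(a1 x * a1 x + a x * a2 x) / x = c\<^sup>2 * x + b * a2 x * x"
        "l\<^sup>2 * (a x)\<^sup>2 / x = l\<^sup>2 * b\<^sup>2 * x ^ 3"
        using x by (simp_all add: subst power2_eq_square power3_eq_cube field_simps)
      have "x * ?d = x * \<phi> x"
        unfolding load ode' \<phi>_def v_def v1_def v2_def v3_def quot using x
        by (simp add: subst field_simps power2_eq_square power3_eq_cube power4_eq_xxxx)
      then show ?thesis using x by simp
    qed
    ultimately show ?thesis by simp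
  qed
  have dom: "(v1 x)\<^sup>2 * (1 / x) \<le> \<phi> x" "(v2 x)\<^sup>2 * (1 / x) \<le> \<phi> x" "0 \<le> \<phi> x" if x: "0 < x" "x < H" for x
  proof -
    have "0 \<le> (v1 x)\<^sup>2 * (1 / x)" "0 \<le> (v2 x)\<^sup>2 * (1 / x)"
        "0 \<le> 2 * l * ((a1 x - a x / x)\<^sup>2 / x)" "0 \<le> l\<^sup>2 * (a x)\<^sup>2 / x"
      using x l by simp_all
    moreover have "\<phi> x = (v1 x)\<^sup>2 * (1 / x) + (v2 x)\<^sup>2 * (1 / x) + 2 * l * ((a1 x - a x / x)\<^sup>2 / x)
        + l\<^sup>2 * (a x)\<^sup>2 / x"
      by (simp add: \<phi>_def add_divide_distrib)
    ultimately show "(v1 x)\<^sup>2 * (1 / x) \<le> \<phi> x" "(v2 x)\<^sup>2 * (1 / x) \<le> \<phi> x" "0 \<le> \<phi> x"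
      by linarith+
  qed
  have \<Phi>_mono: "\<Phi> x \<le> \<Phi> y" if "0 < x" "x \<le> y" "y < H" for x y
  proof (rule DERIV_nonneg_imp_nondecreasing[where f=\<Phi>])
    fix s assume "x \<le> s" "s \<le> y"
    with that have "0 < s" "s < H" by auto
    with \<Phi>'[of s] dom(3)[of s] show "\<exists>d. DERIV \<Phi> s :> d \<and> 0 \<le> d" by auto
  qed (use that in simp)
  \<comment> \<open>at the wall \<open>v\<close> tends to \<open>a2 0 / 2\<close> and its derivatives tend to \<open>0\<close>, so the only surviving
    boundary term is \<open>- v\<^sup>2\<close>, which has the favourable sign\<close>
  have \<Phi>z: "0 \<le> \<Phi> z"
  proof -
    have ev: "eventually (\<lambda>x. 0 < x \<and> x < z) (at_right 0)"
      using z eventually_at_right by (auto simp: eventually_at_right_field)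
    have "at_right 0 = at 0 within {0..H}"
      using H by (simp add: at_within_Icc_at_right)
    then have "(J \<longlongrightarrow> J 0) (at_right 0)" "(a \<longlongrightarrow> a 0) (at_right 0)"
      using contJ cont_a(1) H by (auto simp: continuous_on_def)
    then have lim0: "(J \<longlongrightarrow> 0) (at_right 0)" "(a \<longlongrightarrow> 0) (at_right 0)"
      by (simp_all add: J_def clamped)
    have id: "((\<lambda>x::real. x) \<longlongrightarrow> 0) (at_right 0)" by (rule tendsto_ident_at)
    define p where "p x = a1 x / x" for x
    have lims: "(a2 \<longlongrightarrow> a2 0) (at_right 0)" "(a3 \<longlongrightarrow> a3 0) (at_right 0)" "(p \<longlongrightarrow> a2 0) (at_right 0)"
        "(v \<longlongrightarrow> a2 0 / 2) (at_right 0)"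
      using curvature_limit by (simp_all add: p_def[abs_def] v_def[abs_def])
    have "v1 = (\<lambda>x. p x - 2 * v x)" "v2 = (\<lambda>x. a2 x - 3 * p x + 4 * v x)"
        "v3 = (\<lambda>x. x * a3 x - 3 * a2 x + 7 * p x - 8 * v x)"
      by (simp_all add: p_def v_def v1_def v2_def v3_def fun_eq_iff)
    then have lv: "(v1 \<longlongrightarrow> 0) (at_right 0)" "(v2 \<longlongrightarrow> 0) (at_right 0)" "(v3 \<longlongrightarrow> 0) (at_right 0)"
      by (auto intro!: tendsto_eq_intros id lims)
    have "((\<lambda>x. (v x * v3 x - v1 x * v2 x + 2 * v x * v2 x - (v1 x)\<^sup>2 - v x * v1 x - (v x)\<^sup>2)
        + 2 * l * (- (a x * p x) + (v x)\<^sup>2 * x\<^sup>2 / 2)) \<longlongrightarrow> - ((a2 0 / 2)\<^sup>2)) (at_right 0)"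
      by (auto intro!: tendsto_eq_intros id lims lv lim0)
    then have "(\<Psi> \<longlongrightarrow> - ((a2 0 / 2)\<^sup>2)) (at_right 0)"
      by (rule Lim_transform_eventually, use ev in eventually_elim)
         (simp add: \<Psi>_def v_def p_def power2_eq_square)
    from tendsto_diff[OF tendsto_mult[OF tendsto_const[of l] lim0(1)] this]
    have "(\<Phi> \<longlongrightarrow> (a2 0 / 2)\<^sup>2) (at_right 0)" by (simp add: \<Phi>_def[abs_def])
    then have "(a2 0 / 2)\<^sup>2 \<le> \<Phi> z"
      by (rule tendsto_upperbound, use ev in eventually_elim)
         (use \<Phi>_mono z in auto)
    then show ?thesis using zero_le_power2[of "a2 0 / 2"] by linarith
  qed
  have \<Phi>H: "\<Phi> H = l * I"
    by (simp add: \<Phi>_def \<Psi>_def J_def I_def clamped v_def v1_def)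
  have L: "0 < ln (H / z)" using z by simp
  have energy: "ln (H / z) * (\<Phi> H - \<Phi> z) \<le> ln (H / z) * (l * I)"
    using \<Phi>z L by (simp add: \<Phi>H)
  have ends: "v H = 0" "v1 H = 0" by (simp_all add: v_def v1_def clamped)
  have lnz: "ln H - ln z = ln (H / z)" using z H by (simp add: ln_div)
  have "(v H - v z)\<^sup>2 \<le> (ln H - ln z) * (\<Phi> H - \<Phi> z)"
    by (rule cauchy_schwarz_by_derivatives[where \<omega>="\<lambda>x. 1 / x" and u=v1 and \<phi>=\<phi>])
       (use z v' \<Phi>' dom in \<open>auto intro!: cont continuous_intros derivative_eq_intros\<close>)
  then have b0: "(v z)\<^sup>2 \<le> ln (H / z) * (l * I)"
    using order_trans[OF _ energy] by (simp add: lnz ends)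
  have "(v1 H - v1 z)\<^sup>2 \<le> (ln H - ln z) * (\<Phi> H - \<Phi> z)"
    by (rule cauchy_schwarz_by_derivatives[where \<omega>="\<lambda>x. 1 / x" and u=v2 and \<phi>=\<phi>])
       (use z v1' \<Phi>' dom in \<open>auto intro!: cont continuous_intros derivative_eq_intros\<close>)
  then have b1: "(v1 z)\<^sup>2 \<le> ln (H / z) * (l * I)"
    using order_trans[OF _ energy] by (simp add: lnz ends)
  have "(a z)\<^sup>2 = z ^ 4 * (v z)\<^sup>2" using z by (simp add: v_def power2_eq_square power4_eq_xxxx)
  also have "\<dots> \<le> z ^ 4 * (ln (H / z) * (l * I))" by (intro mult_left_mono b0) simp
  finally show "(a z)\<^sup>2 \<le> z ^ 4 * ln (H / z) * (l * I)" by (simp add: mult.assoc)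
  have "a1 z = z * (v1 z + 2 * v z)" using z by (simp add: v_def v1_def power2_eq_square)
  then have "(a1 z)\<^sup>2 = z\<^sup>2 * (v1 z + 2 * v z)\<^sup>2" by (simp add: power_mult_distrib)
  also have "\<dots> \<le> z\<^sup>2 * (10 * (ln (H / z) * (l * I)))"
  proof (rule mult_left_mono)
    show "(v1 z + 2 * v z)\<^sup>2 \<le> 10 * (ln (H / z) * (l * I))"
      using b0 b1 sum_squares_bound[of "v1 z" "2 * v z"] by (simp add: power2_eq_square algebra_simps)
  qed simp
  finally show "(a1 z)\<^sup>2 \<le> 10 * z\<^sup>2 * ln (H / z) * (l * I)"
    by (simp add: mult_ac)
qed

end

section \<open>Fourier series of continuous functions on the periodicity cell\<close>

text \<open>
Averages are taken over the closed cube, which differs from the cell by a null set; this gives access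
to the calculus of gauge integrals over boxes (Leibniz rule, splitting, shifting).
\<close>

definition cell_avg :: "real \<Rightarrow> (real^'n::finite \<Rightarrow> 'a::euclidean_space) \<Rightarrow> 'a" where
  "cell_avg \<Lambda> g = integral (cbox 0 (\<chi> i. \<Lambda>)) g /\<^sub>R \<Lambda> ^ CARD('n)"

definition lattice_periodic :: "real \<Rightarrow> (real^'n::finite \<Rightarrow> 'a) \<Rightarrow> bool" where
  "lattice_periodic \<Lambda> g \<longleftrightarrow> (\<forall>y i. g (y + \<Lambda> *\<^sub>R axis i 1) = g y)"

lemma cell_integral_eq:
  fixes g :: "real^'n::finite \<Rightarrow> 'a::euclidean_space"
  assumes g: "continuous_on UNIV g"
  shows "(LBINT y:cell \<Lambda>. g y) = integral (cbox 0 (\<chi> i. \<Lambda>)) g"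
proof -
  let ?B = "cbox (0::real^'n) (\<chi> i. \<Lambda>)"
  have sub: "cell \<Lambda> \<subseteq> ?B" by (auto simp: cell_def mem_box_cart less_imp_le)
  have "cell \<Lambda> = (\<Inter>i. {y::real^'n. 0 \<le> y $ i} \<inter> {y. y $ i < \<Lambda>})" by (auto simp: cell_def)
  moreover have "closed {y::real^'n. 0 \<le> y $ i}" "open {y::real^'n. y $ i < \<Lambda>}" for i
    by (simp_all add: closed_halfspace_component_ge_cart open_halfspace_component_lt_cart)
  ultimately have meas: "cell \<Lambda> \<in> sets (lborel :: (real^'n) measure)"
    by (auto intro!: sets.finite_INT)
  have "set_integrable lborel ?B g"
    unfolding set_integrable_def
    by (rule borel_integrable_compact) (auto intro: continuous_on_subset[OF g])
  then have "set_integrable lborel (cell \<Lambda>) g"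
    by (rule set_integrable_subset) (use meas sub in auto)
  then have "(LBINT y:cell \<Lambda>. g y) = integral (cell \<Lambda>) g"
    by (rule set_borel_integral_eq_integral)
  also have "\<dots> = integral ?B g"
  proof (rule integral_subset_negligible[OF sub])
    show "negligible (?B - cell \<Lambda>)"
      by (rule negligible_subset[OF negligible_frontier_interval[of 0 "\<chi> i. \<Lambda>"]])
         (auto simp: cell_def mem_box_cart less_imp_le)
  qed
  finally show ?thesis .
qed

lemma cell_integrable:
  fixes g :: "real^'n::finite \<Rightarrow> 'a::euclidean_space"
  shows "continuous_on UNIV g \<Longrightarrow> g integrable_on cbox 0 (\<chi> i. \<Lambda>)"
  by (rule integrable_continuous) (auto intro: continuous_on_subset)

lemma cell_avg_add:
  "continuous_on UNIV f \<Longrightarrow> continuous_on UNIV g \<Longrightarrow>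
    cell_avg \<Lambda> (\<lambda>y. f y + g y) = cell_avg \<Lambda> f + cell_avg \<Lambda> g"
  by (simp add: cell_avg_def integral_add cell_integrable scaleR_add_right)

lemma cell_avg_diff:
  "continuous_on UNIV f \<Longrightarrow> continuous_on UNIV g \<Longrightarrow>
    cell_avg \<Lambda> (\<lambda>y. f y - g y) = cell_avg \<Lambda> f - cell_avg \<Lambda> g"
  by (simp add: cell_avg_def integral_diff cell_integrable scaleR_diff_right)

lemma cell_avg_sum:
  "(\<And>j. j \<in> F \<Longrightarrow> continuous_on UNIV (f j)) \<Longrightarrow>
    cell_avg \<Lambda> (\<lambda>y. \<Sum>j\<in>F. f j y) = (\<Sum>j\<in>F. cell_avg \<Lambda> (f j))"
proof (induction F rule: infinite_finite_induct)
  case (insert x F)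
  then show ?case by (simp add: cell_avg_add continuous_on_sum)
qed (simp_all add: cell_avg_def)

lemma cell_avg_linear:
  assumes "bounded_linear h" "continuous_on UNIV f"
  shows "cell_avg \<Lambda> (\<lambda>y. h (f y)) = h (cell_avg \<Lambda> f)"
  using integral_linear[OF cell_integrable[OF assms(2)] assms(1)]
  by (simp add: cell_avg_def o_def linear_cmul[OF bounded_linear.linear[OF assms(1)]])

lemma cell_avg_cmult:
  fixes f :: "real^'n::finite \<Rightarrow> 'a::{real_normed_algebra,euclidean_space}"
  shows "continuous_on UNIV f \<Longrightarrow> cell_avg \<Lambda> (\<lambda>y. c * f y) = c * cell_avg \<Lambda> f"
  using cell_avg_linear[OF bounded_linear_mult_right] .

lemma cell_avg_const [simp]:
  fixes c :: "'a::euclidean_space"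
  shows "0 < \<Lambda> \<Longrightarrow> cell_avg \<Lambda> (\<lambda>y::real^'n::finite. c) = c"
  by (simp add: cell_avg_def content_cbox_cart mem_box_cart interval_ne_empty_cart)

lemma cell_avg_mono:
  fixes f g :: "real^'n::finite \<Rightarrow> real"
  assumes "0 < \<Lambda>" "continuous_on UNIV f" "continuous_on UNIV g" "\<And>y. y \<in> cbox 0 (\<chi> i. \<Lambda>) \<Longrightarrow> f y \<le> g y"
  shows "cell_avg \<Lambda> f \<le> cell_avg \<Lambda> g"
  unfolding cell_avg_def using assms
  by (auto intro!: integral_le cell_integrable mult_left_mono)

lemma integral_cell_shift:
  fixes g :: "real^'n::finite \<Rightarrow> 'a::euclidean_space"
  assumes cont: "continuous_on UNIV g" and per: "lattice_periodic \<Lambda> g" and s: "0 \<le> s" "s \<le> \<Lambda>"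
  shows "integral (cbox 0 (\<chi> i. \<Lambda>)) (\<lambda>y. g (y + s *\<^sub>R axis j 1)) = integral (cbox 0 (\<chi> i. \<Lambda>)) g"
proof -
  let ?e = "axis j 1 :: real^'n"
  define A B where "A = cbox (s *\<^sub>R ?e) (\<chi> i. \<Lambda>)" and "B = cbox 0 (\<chi> i. if i = j then s else \<Lambda>)"
  have split: "integral (cbox 0 (\<chi> i. \<Lambda>)) h = integral (cbox 0 (\<chi> i. if i = j then c else \<Lambda>)) h
      + integral (cbox (c *\<^sub>R ?e) (\<chi> i. \<Lambda>)) h"
    if h: "continuous_on UNIV h" and c: "0 \<le> c" "c \<le> \<Lambda>" for h :: "real^'n \<Rightarrow> 'a" and c
  proof -
    have "cbox 0 (\<chi> i. \<Lambda>) \<inter> {x. x \<bullet> ?e \<le> c} = cbox 0 (\<chi> i. if i = j then c else \<Lambda>)"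
    proof -
      have "(\<chi> i. if i = j then min ((\<chi> i. \<Lambda>) $ j) c else (\<chi> i. \<Lambda>) $ i) = (\<chi> i. if i = j then c else \<Lambda> :: real^'n)"
        using c by (simp add: vec_eq_iff)
      then show ?thesis
        using interval_split_cart(1)[of 0 "\<chi> i. \<Lambda>" j c] by (simp add: interval_cbox_cart inner_axis)
    qed
    moreover have "cbox 0 (\<chi> i. \<Lambda>) \<inter> {x. x \<bullet> ?e \<ge> c} = cbox (c *\<^sub>R ?e) (\<chi> i. \<Lambda>)"
    proof -
      have "(\<chi> i. if i = j then max ((0::real^'n) $ j) c else (0::real^'n) $ i) = c *\<^sub>R ?e"
        using c by (simp add: vec_eq_iff axis_def)
      then show ?thesis
        using interval_split_cart(2)[where a=0 and b="\<chi> i. \<Lambda>" and k=j and c=c] by (simp add: interval_cbox_cart inner_axis)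
    qed
    ultimately show ?thesis
      using integral_split[OF cell_integrable[OF h], of ?e \<Lambda> c] by simp
  qed
  have cont': "continuous_on UNIV (\<lambda>y. g (y + s *\<^sub>R ?e))"
    by (rule continuous_on_compose2[OF cont]) (auto intro!: continuous_intros)
  \<comment> \<open>cut off the slice of the shifted cell that sticks out and move it back by one period\<close>
  have "integral (cbox 0 (\<chi> i. if i = j then \<Lambda> - s else \<Lambda>)) (\<lambda>y. g (y + s *\<^sub>R ?e)) = integral A g"
  proof -
    have "(\<chi> i. \<Lambda>) - s *\<^sub>R ?e = (\<chi> i. if i = j then \<Lambda> - s else \<Lambda>)"
      by (simp add: vec_eq_iff axis_def)
    then show ?thesis
      using integral_shift_cbox[of "s *\<^sub>R ?e" "s *\<^sub>R ?e" "\<chi> i. \<Lambda>" g] unfolding A_def by simp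
  qed
  moreover have "integral (cbox ((\<Lambda> - s) *\<^sub>R ?e) (\<chi> i. \<Lambda>)) (\<lambda>y. g (y + s *\<^sub>R ?e)) = integral B g"
  proof -
    have "(\<lambda>y. g (y + s *\<^sub>R ?e)) = (\<lambda>y. g (y + (s - \<Lambda>) *\<^sub>R ?e))"
    proof
      fix y
      show "g (y + s *\<^sub>R ?e) = g (y + (s - \<Lambda>) *\<^sub>R ?e)"
        using per[unfolded lattice_periodic_def, rule_format, of "y + (s - \<Lambda>) *\<^sub>R ?e" j]
        by (simp add: algebra_simps)
    qed
    moreover have "(\<chi> i. if i = j then s else \<Lambda>) - (s - \<Lambda>) *\<^sub>R ?e = (\<chi> i. \<Lambda>)"
      by (simp add: vec_eq_iff axis_def)
    moreover have "0 - (s - \<Lambda>) *\<^sub>R ?e = (\<Lambda> - s) *\<^sub>R ?e"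
      by (simp add: vec_eq_iff axis_def)
    ultimately show ?thesis
      using integral_shift_cbox[of 0 "(s - \<Lambda>) *\<^sub>R ?e" "\<chi> i. if i = j then s else \<Lambda>" g]
      unfolding B_def by metis
  qed
  ultimately show ?thesis
    using split[OF cont' , of "\<Lambda> - s"] split[OF cont, of s] s by (simp add: A_def B_def)
qed

text \<open>
Integration by parts without boundary terms: by periodicity the integral over the cell shifted in
direction \<open>j\<close> does not depend on the shift, and its derivative in the shift is the integral of \<open>g'\<close>.
\<close>

lemma cell_avg_derivative_zero:
  fixes g g' :: "real^'n::finite \<Rightarrow> 'a::euclidean_space"
  assumes \<Lambda>: "0 < \<Lambda>" and cont: "continuous_on UNIV g" "continuous_on UNIV g'"
    and per: "lattice_periodic \<Lambda> g"
    and deriv: "\<And>y. ((\<lambda>s. g (y + s *\<^sub>R axis j 1)) has_vector_derivative g' y) (at 0)"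
  shows "cell_avg \<Lambda> g' = 0"
proof -
  let ?e = "axis j 1 :: real^'n"
  have deriv': "((\<lambda>s. g (y + s *\<^sub>R ?e)) has_vector_derivative g' (y + s0 *\<^sub>R ?e)) (at s0 within {0..\<Lambda>})" for y s0
  proof -
    have shifted: "((\<lambda>s. g (y + s0 *\<^sub>R ?e + s *\<^sub>R ?e)) has_vector_derivative g' (y + s0 *\<^sub>R ?e)) (at (s0 - s0))"
      using deriv by simp
    have "((\<lambda>s. s - s0) has_vector_derivative 1) (at s0)"
      by (auto intro!: derivative_eq_intros)
    from vector_diff_chain_at[OF this shifted]
    have "((\<lambda>s. g (y + s0 *\<^sub>R ?e + (s - s0) *\<^sub>R ?e)) has_vector_derivative g' (y + s0 *\<^sub>R ?e)) (at s0)"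
      by (simp add: o_def)
    moreover have "y + s0 *\<^sub>R ?e + (s - s0) *\<^sub>R ?e = y + s *\<^sub>R ?e" for s
      by (simp add: algebra_simps)
    ultimately show ?thesis by (simp add: has_vector_derivative_at_within)
  qed
  have "((\<lambda>s. integral (cbox 0 (\<chi> i. \<Lambda>)) (\<lambda>y. g (y + s *\<^sub>R ?e))) has_vector_derivative
      integral (cbox 0 (\<chi> i. \<Lambda>)) (\<lambda>y. g' (y + 0 *\<^sub>R ?e))) (at 0 within {0..\<Lambda>})"
  proof (rule leibniz_rule_vector_derivative[where fx="\<lambda>s y. g' (y + s *\<^sub>R ?e)"])
    show "(\<lambda>y. g (y + s *\<^sub>R ?e)) integrable_on cbox 0 (\<chi> i. \<Lambda>)" for s
      by (intro cell_integrable continuous_on_compose2[OF cont(1)]) (auto intro!: continuous_intros)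
    show "continuous_on ({0..\<Lambda>} \<times> cbox 0 (\<chi> i. \<Lambda>)) (\<lambda>(s, y). g' (y + s *\<^sub>R ?e))"
      unfolding split_beta by (intro continuous_on_compose2[OF cont(2)]) (auto intro!: continuous_intros)
  qed (use deriv' \<Lambda> in auto)
  moreover have "((\<lambda>s. integral (cbox 0 (\<chi> i. \<Lambda>)) (\<lambda>y. g (y + s *\<^sub>R ?e))) has_vector_derivative 0) (at 0 within {0..\<Lambda>})"
    by (rule has_vector_derivative_transform[OF _ _ has_vector_derivative_const[of "integral (cbox 0 (\<chi> i. \<Lambda>)) g"]])
       (use \<Lambda> integral_cell_shift[OF cont(1) per] in auto)
  ultimately have "integral (cbox 0 (\<chi> i. \<Lambda>)) (\<lambda>y. g' (y + 0 *\<^sub>R ?e)) = 0"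
    using \<Lambda> by (intro vector_derivative_unique_within_closed_interval[of 0 \<Lambda> 0]) auto
  then show ?thesis by (simp add: cell_avg_def)
qed

definition wave :: "real^'n::finite \<Rightarrow> real^'n \<Rightarrow> complex" where
  "wave k y = cis (k \<bullet> y)"

lemma continuous_wave [continuous_intros]: "continuous_on S (wave k)"
  unfolding wave_def[abs_def] by (intro continuous_intros)

lemma wave_mult: "wave k y * wave l y = wave (k + l) y"
  by (simp add: wave_def cis_mult inner_add_left)

lemma cnj_wave: "cnj (wave k y) = wave (- k) y"
  by (simp add: wave_def cis_cnj)

lemma wave_0 [simp]: "wave 0 y = 1" by (simp add: wave_def)

lemma dual_lattice_diff: "k \<in> dual_lattice \<Lambda> \<Longrightarrow> l \<in> dual_lattice \<Lambda> \<Longrightarrow> k - l \<in> dual_lattice \<Lambda>"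
proof -
  assume kl: "k \<in> dual_lattice \<Lambda>" "l \<in> dual_lattice \<Lambda>"
  have "\<exists>m::int. (k - l) $ i = 2 * pi / \<Lambda> * of_int m" for i
  proof -
    obtain m n :: int where "k $ i = 2 * pi / \<Lambda> * of_int m" "l $ i = 2 * pi / \<Lambda> * of_int n"
      using kl unfolding dual_lattice_def by blast
    then have "(k - l) $ i = 2 * pi / \<Lambda> * of_int (m - n)" by (simp add: right_diff_distrib)
    then show ?thesis by blast
  qed
  then show ?thesis by (simp add: dual_lattice_def)
qed

lemma dual_lattice_0 [simp]: "0 \<in> dual_lattice \<Lambda>"
  by (auto simp: dual_lattice_def intro: exI[of _ 0])

lemma dual_lattice_uminus: "k \<in> dual_lattice \<Lambda> \<Longrightarrow> - k \<in> dual_lattice \<Lambda>"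
  using dual_lattice_diff[of 0 \<Lambda> k] by simp

lemma dual_lattice_add: "k \<in> dual_lattice \<Lambda> \<Longrightarrow> l \<in> dual_lattice \<Lambda> \<Longrightarrow> k + l \<in> dual_lattice \<Lambda>"
  using dual_lattice_diff[OF _ dual_lattice_uminus] by fastforce

lemma countable_dual_lattice: "countable (dual_lattice \<Lambda> :: (real^'n::finite) set)"
proof -
  have "dual_lattice \<Lambda> \<subseteq> range (\<lambda>m::'n \<Rightarrow> int. \<chi> i. 2 * pi / \<Lambda> * of_int (m i))"
  proof
    fix k :: "real^'n" assume "k \<in> dual_lattice \<Lambda>"
    then have "\<forall>i. \<exists>m::int. k $ i = 2 * pi / \<Lambda> * of_int m" by (simp add: dual_lattice_def)
    from choice[OF this] obtain m where "\<And>i. k $ i = 2 * pi / \<Lambda> * of_int (m i)" by blast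
    then have "k = (\<chi> i. 2 * pi / \<Lambda> * of_int (m i))" by (simp add: vec_eq_iff)
    then show "k \<in> range (\<lambda>m::'n \<Rightarrow> int. \<chi> i. 2 * pi / \<Lambda> * of_int (m i))" by blast
  qed
  then show ?thesis by (rule countable_subset) simp
qed

lemma dual_lattice_period:
  assumes "k \<in> dual_lattice \<Lambda>" "0 < \<Lambda>"
  obtains m :: int where "k \<bullet> (y + \<Lambda> *\<^sub>R axis i 1) = k \<bullet> y + 2 * pi * of_int m"
proof -
  obtain m :: int where "k $ i = 2 * pi / \<Lambda> * of_int m" using assms by (auto simp: dual_lattice_def)
  with that[of m] assms show ?thesis by (simp add: inner_add_right inner_axis)
qed

lemma wave_periodic: "k \<in> dual_lattice \<Lambda> \<Longrightarrow> 0 < \<Lambda> \<Longrightarrow> lattice_periodic \<Lambda> (wave k)"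
proof -
  assume k: "k \<in> dual_lattice \<Lambda>" "0 < \<Lambda>"
  have "wave k (y + \<Lambda> *\<^sub>R axis i 1) = wave k y" for y i
  proof -
    obtain m :: int where "k \<bullet> (y + \<Lambda> *\<^sub>R axis i 1) = k \<bullet> y + 2 * pi * of_int m"
      using dual_lattice_period[OF k] .
    then show ?thesis by (simp add: wave_def cis_multiple_2pi flip: cis_mult)
  qed
  then show ?thesis by (simp add: lattice_periodic_def)
qed

lemma cell_avg_wave:
  assumes k: "k \<in> dual_lattice \<Lambda>" and \<Lambda>: "0 < \<Lambda>"
  shows "cell_avg \<Lambda> (wave k) = (if k = 0 then 1 else 0)"
proof (cases "k = 0")
  case True
  then show ?thesis using \<Lambda> cell_avg_const[of \<Lambda> "1::complex"] by (simp add: wave_def[abs_def])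
next
  case False
  then obtain j where j: "k $ j \<noteq> 0" by (auto simp: vec_eq_iff)
  have "cell_avg \<Lambda> (\<lambda>y. \<i> * of_real (k $ j) * wave k y) = 0"
  proof (rule cell_avg_derivative_zero[OF \<Lambda> _ _ wave_periodic[OF k \<Lambda>], of _ j])
    show "((\<lambda>s. wave k (y + s *\<^sub>R axis j 1)) has_vector_derivative \<i> * of_real (k $ j) * wave k y) (at 0)" for y
    proof -
      have "((\<lambda>\<zeta>. exp (\<i> * (of_real (k \<bullet> y) + \<zeta> * of_real (k $ j)))) has_field_derivative
          \<i> * of_real (k $ j) * wave k y) (at (of_real 0))"
        by (auto intro!: derivative_eq_intros simp: wave_def cis_conv_exp)
      from has_vector_derivative_real_field[OF this] show ?thesis
        by (simp add: wave_def cis_conv_exp inner_add_right inner_axis)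
    qed
  qed (intro continuous_intros)+
  then show ?thesis using False j by (simp add: cell_avg_cmult continuous_wave)
qed

lemma fourier_eq_cell_avg:
  assumes "continuous_on UNIV f"
  shows "fourier \<Lambda> f k = cell_avg \<Lambda> (\<lambda>y. wave k y * of_real (f y))"
proof -
  have "continuous_on UNIV (\<lambda>y. wave k y * complex_of_real (f y))"
    using assms by (intro continuous_intros)
  from cell_integral_eq[OF this] show ?thesis
    by (simp add: fourier_def cell_avg_def wave_def cis_conv_exp scaleR_conv_of_real divide_inverse mult.commute)
qed

text \<open>
Trigonometric polynomials, introduced inductively so that closure under products is a short induction;
a finite expansion over distinct wave vectors is only extracted at the end.
\<close>

inductive trig_sum :: "real \<Rightarrow> (real^'n::finite \<Rightarrow> complex) \<Rightarrow> bool" for \<Lambda> where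
  wave: "k \<in> dual_lattice \<Lambda> \<Longrightarrow> trig_sum \<Lambda> (\<lambda>y. c * wave k y)"
| add: "trig_sum \<Lambda> f \<Longrightarrow> trig_sum \<Lambda> g \<Longrightarrow> trig_sum \<Lambda> (\<lambda>y. f y + g y)"

lemma trig_sum_const: "trig_sum \<Lambda> (\<lambda>y. c)"
  using trig_sum.wave[of 0 \<Lambda> c] by simp

lemma trig_sum_sum: "(\<And>j. j \<in> F \<Longrightarrow> trig_sum \<Lambda> (f j)) \<Longrightarrow> trig_sum \<Lambda> (\<lambda>y. \<Sum>j\<in>F. f j y)"
  by (induction F rule: infinite_finite_induct) (auto intro: trig_sum_const trig_sum.add)

lemma trig_sum_mult:
  assumes "trig_sum \<Lambda> f" "trig_sum \<Lambda> g"
  shows "trig_sum \<Lambda> (\<lambda>y. f y * g y)"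
  using assms(1)
proof induction
  case (wave k c)
  note k = this
  show ?case using assms(2)
  proof induction
    case (wave l d)
    have "trig_sum \<Lambda> (\<lambda>y. (c * d) * wave (k + l) y)"
      by (intro trig_sum.wave dual_lattice_add k wave)
    then show ?case by (simp add: mult_ac flip: wave_mult)
  next
    case (add f g)
    from trig_sum.add[OF add.IH] show ?case by (simp add: distrib_left)
  qed
next
  case (add f1 f2)
  from trig_sum.add[OF add.IH] show ?case by (simp add: distrib_right)
qed

lemma trig_sum_finite_expansion:
  assumes "trig_sum \<Lambda> f"
  obtains F c where "finite F" "F \<subseteq> dual_lattice \<Lambda>" "\<And>y. f y = (\<Sum>k\<in>F. c k * wave k y)"
  using assms
proof (induction arbitrary: thesis)
  case (wave k c)
  show ?case by (rule wave.prems[of "{k}" "\<lambda>_. c"]) (use wave in auto)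
next
  case (add f g)
  obtain F c where F: "finite F" "F \<subseteq> dual_lattice \<Lambda>" "\<And>y. f y = (\<Sum>k\<in>F. c k * wave k y)"
    using add.IH(1) by blast
  obtain G d where G: "finite G" "G \<subseteq> dual_lattice \<Lambda>" "\<And>y. g y = (\<Sum>k\<in>G. d k * wave k y)"
    using add.IH(2) by blast
  define e where "e k = (if k \<in> F then c k else 0) + (if k \<in> G then d k else 0)" for k
  have "f y + g y = (\<Sum>k\<in>F \<union> G. e k * wave k y)" for y
  proof -
    have "(\<Sum>k\<in>F \<union> G. (if k \<in> F then c k else 0) * wave k y) = f y"
      unfolding F(3) by (rule sum.mono_neutral_cong_right) (use F G in auto)
    moreover have "(\<Sum>k\<in>F \<union> G. (if k \<in> G then d k else 0) * wave k y) = g y"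
      unfolding G(3) by (rule sum.mono_neutral_cong_right) (use F G in auto)
    ultimately show ?thesis by (simp add: e_def distrib_right sum.distrib)
  qed
  with F G show ?case by (intro add.prems[of "F \<union> G" e]) auto
qed

text \<open>
The Stone--Weierstrass theorem needs functions that separate points, while periodic functions do not
separate opposite faces of the cell. The embedding of the torus repairs this: a polynomial in the
coordinates of \<open>torus_map \<Lambda> y\<close> is a trigonometric polynomial in \<open>y\<close>.
\<close>

definition torus_map :: "real \<Rightarrow> real^'n::finite \<Rightarrow> complex^'n" where
  "torus_map \<Lambda> y = (\<chi> i. cis (2 * pi / \<Lambda> * y $ i))"

lemma continuous_torus_map: "continuous_on S (torus_map \<Lambda>)"
  unfolding torus_map_def[abs_def] continuous_on_vec_lambda
  by (intro continuous_on_vec_lambda continuous_intros)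

lemma trig_sum_polynomial:
  fixes p :: "complex^'n::finite \<Rightarrow> real"
  assumes "real_polynomial_function p"
  shows "trig_sum \<Lambda> (\<lambda>y. of_real (p (torus_map \<Lambda> y)))"
  using assms
proof induction
  case (linear f)
  then interpret f: bounded_linear f .
  let ?k = "\<lambda>i::'n. axis i (2 * pi / \<Lambda>) :: real^'n"
  have k: "?k i \<in> dual_lattice \<Lambda>" for i
  proof -
    have "\<exists>m::int. ?k i $ j = 2 * pi / \<Lambda> * of_int m" for j
      by (intro exI[of _ "if j = i then 1 else 0"]) (simp add: axis_def)
    then show ?thesis by (simp add: dual_lattice_def)
  qed
  \<comment> \<open>a linear functional combines the real and imaginary parts of the coordinates, and these
    are cosines and sines, hence combinations of two opposite waves\<close>
  define \<alpha> \<beta> where "\<alpha> i = f (axis i 1)" and "\<beta> i = f (axis i \<i>)" for i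
  have coords: "f u = (\<Sum>i\<in>UNIV. Re (u $ i) * \<alpha> i + Im (u $ i) * \<beta> i)" for u
  proof -
    have "u = (\<Sum>i\<in>UNIV. Re (u $ i) *\<^sub>R axis i 1 + Im (u $ i) *\<^sub>R axis i \<i>)"
      by (simp add: vec_eq_iff axis_def complex_eq_iff if_distrib[of Re] if_distrib[of Im] if_distrib cong: if_cong)
    then have "f u = f (\<Sum>i\<in>UNIV. Re (u $ i) *\<^sub>R axis i 1 + Im (u $ i) *\<^sub>R axis i \<i>)" by simp
    also have "\<dots> = (\<Sum>i\<in>UNIV. Re (u $ i) * \<alpha> i + Im (u $ i) * \<beta> i)"
      by (simp add: f.sum f.add f.scaleR \<alpha>_def \<beta>_def)
    finally show ?thesis .
  qed
  have "of_real (f (torus_map \<Lambda> y)) = (\<Sum>i\<in>UNIV. (of_real (\<alpha> i) - \<i> * of_real (\<beta> i)) / 2 * wave (?k i) y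
      + (of_real (\<alpha> i) + \<i> * of_real (\<beta> i)) / 2 * wave (- ?k i) y)" for y
    unfolding coords of_real_sum
    by (rule sum.cong) (auto simp: torus_map_def wave_def inner_axis' complex_eq_iff field_simps)
  then show ?case
    by (simp only:) (intro trig_sum_sum trig_sum.add trig_sum.wave dual_lattice_uminus k)
qed (auto intro: trig_sum_const trig_sum.add trig_sum_mult)

lemma lattice_periodic_int_shift:
  assumes "lattice_periodic \<Lambda> f"
  shows "f (y + of_int m *\<^sub>R (\<Lambda> *\<^sub>R axis i 1)) = f y"
proof (induction m rule: int_induct[where k=0])
  case (step1 m)
  then show ?case
    using assms[unfolded lattice_periodic_def, rule_format, of "y + of_int m *\<^sub>R (\<Lambda> *\<^sub>R axis i 1)" i]
    by (simp add: algebra_simps)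
next
  case (step2 m)
  then show ?case
    using assms[unfolded lattice_periodic_def, rule_format, of "y + of_int (m - 1) *\<^sub>R (\<Lambda> *\<^sub>R axis i 1)" i]
    by (simp add: algebra_simps)
qed simp

lemma torus_map_eq_imp:
  fixes f :: "real^'n::finite \<Rightarrow> 'a"
  assumes per: "lattice_periodic \<Lambda> f" and \<Lambda>: "0 < \<Lambda>" and eq: "torus_map \<Lambda> x = torus_map \<Lambda> y"
  shows "f x = f y"
proof -
  have "\<exists>m::int. x $ i = y $ i + of_int m * \<Lambda>" for i
  proof -
    have "cis (2 * pi / \<Lambda> * x $ i) = cis (2 * pi / \<Lambda> * y $ i)"
      using eq by (simp add: torus_map_def vec_eq_iff)
    then have "sin (2 * pi / \<Lambda> * x $ i) = sin (2 * pi / \<Lambda> * y $ i) \<and> cos (2 * pi / \<Lambda> * x $ i) = cos (2 * pi / \<Lambda> * y $ i)"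
      by (simp add: complex_eq_iff)
    then obtain m :: int where "2 * pi / \<Lambda> * x $ i = 2 * pi / \<Lambda> * y $ i + 2 * pi * of_int m"
      unfolding sin_cos_eq_iff by auto
    then have "2 * pi / \<Lambda> * (x $ i - (y $ i + of_int m * \<Lambda>)) = 0"
      using \<Lambda> by (simp add: ring_distribs)
    then have "x $ i = y $ i + of_int m * \<Lambda>" using \<Lambda> by simp
    then show ?thesis ..
  qed
  then have "\<forall>i. \<exists>m::int. x $ i = y $ i + of_int m * \<Lambda>" by blast
  from choice[OF this] obtain m :: "'n \<Rightarrow> int" where m: "\<And>i. x $ i = y $ i + of_int (m i) * \<Lambda>" by blast
  have "f (y + (\<Sum>i\<in>S. of_int (m i) *\<^sub>R (\<Lambda> *\<^sub>R axis i 1))) = f y" if "finite S" for S :: "'n set"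
    using that
  proof induction
    case (insert i S)
    then show ?case
      using lattice_periodic_int_shift[OF per, of "y + (\<Sum>i\<in>S. of_int (m i) *\<^sub>R (\<Lambda> *\<^sub>R axis i 1))" "m i" i]
      by (simp add: add_ac)
  qed simp
  moreover have "x = y + (\<Sum>i\<in>UNIV. of_int (m i) *\<^sub>R (\<Lambda> *\<^sub>R axis i 1))"
    by (simp add: vec_eq_iff m axis_def if_distrib cong: if_cong)
  ultimately show ?thesis by simp
qed

text \<open>
A continuous map of a compact space into a Hausdorff space is closed, hence a quotient map onto its
image: a function on the image is continuous once its pullback is.
\<close>

lemma compact_factor_continuous:
  fixes g :: "'a::topological_space \<Rightarrow> 'b::t2_space" and f :: "'b \<Rightarrow> 'c::topological_space"
  assumes "compact C" "continuous_on C g" "continuous_on C (f \<circ> g)"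
  shows "continuous_on (g ` C) f"
  unfolding continuous_on_closed_invariant
proof (intro allI impI)
  fix B :: "'c set" assume "closed B"
  then obtain A where A: "closed A" "A \<inter> C = (f \<circ> g) -` B \<inter> C"
    using assms(3) unfolding continuous_on_closed_invariant by blast
  have "compact (A \<inter> C)" using A(1) assms(1) by (simp add: closed_Int_compact)
  then have "compact (g ` (A \<inter> C))"
    by (intro compact_continuous_image continuous_on_subset[OF assms(2)]) auto
  moreover have "g ` (A \<inter> C) \<inter> g ` C = f -` B \<inter> g ` C"
    unfolding A(2) by auto
  ultimately show "\<exists>A. closed A \<and> A \<inter> g ` C = f -` B \<inter> g ` C"
    by (metis compact_imp_closed)
qed

lemma trig_sum_dense:
  fixes f :: "real^'n::finite \<Rightarrow> real"
  assumes cont: "continuous_on UNIV f" and per: "lattice_periodic \<Lambda> f" and \<Lambda>: "0 < \<Lambda>" and \<epsilon>: "0 < \<epsilon>"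
  obtains p where "trig_sum \<Lambda> p" "\<And>y. y \<in> cbox 0 (\<chi> i. \<Lambda>) \<Longrightarrow> cmod (of_real (f y) - p y) < \<epsilon>"
proof -
  let ?C = "cbox (0::real^'n) (\<chi> i. \<Lambda>)"
  obtain h where h: "\<And>y. f y = h (torus_map \<Lambda> y)"
  proof
    show "f y = (\<lambda>u. f (SOME y. torus_map \<Lambda> y = u)) (torus_map \<Lambda> y)" for y
      using torus_map_eq_imp[OF per \<Lambda>, of y "SOME x. torus_map \<Lambda> x = torus_map \<Lambda> y"]
        someI[of "\<lambda>x. torus_map \<Lambda> x = torus_map \<Lambda> y" y] by simp
  qed
  have "continuous_on ?C (h \<circ> torus_map \<Lambda>)"
    using continuous_on_subset[OF cont, of ?C] by (simp add: o_def flip: h)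
  then have "continuous_on (torus_map \<Lambda> ` ?C) h"
    by (intro compact_factor_continuous compact_cbox continuous_torus_map)
  moreover have "compact (torus_map \<Lambda> ` ?C)"
    by (intro compact_continuous_image compact_cbox continuous_torus_map)
  ultimately obtain p where p: "real_polynomial_function p" "\<And>u. u \<in> torus_map \<Lambda> ` ?C \<Longrightarrow> \<bar>h u - p u\<bar> < \<epsilon>"
    using Stone_Weierstrass_real_polynomial_function \<epsilon> by metis
  show ?thesis
  proof (rule that[OF trig_sum_polynomial[OF p(1)]])
    fix y assume "y \<in> ?C"
    then have "\<bar>f y - p (torus_map \<Lambda> y)\<bar> < \<epsilon>" using p(2) by (simp add: h)
    then show "cmod (of_real (f y) - of_real (p (torus_map \<Lambda> y))) < \<epsilon>"
      by (metis norm_of_real of_real_diff)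
  qed
qed

lemma cell_avg_cnj:
  "continuous_on UNIV f \<Longrightarrow> cell_avg \<Lambda> (\<lambda>y. cnj (f y)) = cnj (cell_avg \<Lambda> f)"
  by (rule cell_avg_linear[OF bounded_linear_cnj])

lemma cell_avg_of_real:
  "continuous_on UNIV f \<Longrightarrow> cell_avg \<Lambda> (\<lambda>y. complex_of_real (f y)) = of_real (cell_avg \<Lambda> f)"
  by (rule cell_avg_linear[OF bounded_linear_of_real])

text \<open>
Pythagoras: the Fourier coefficients are the coordinates of the orthogonal projection onto the span of
finitely many waves. The waves carry \<open>- k\<close> because \<^const>\<open>fourier\<close> integrates against \<open>wave k\<close>.
\<close>

lemma mean_square_distance:
  fixes f :: "real^'n::finite \<Rightarrow> real"
  assumes cont: "continuous_on UNIV f" and \<Lambda>: "0 < \<Lambda>" and F: "finite F" "F \<subseteq> dual_lattice \<Lambda>"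
  shows "cell_avg \<Lambda> (\<lambda>y. (cmod (of_real (f y) - (\<Sum>k\<in>F. c k * wave (- k) y)))\<^sup>2) =
      cell_avg \<Lambda> (\<lambda>y. (f y)\<^sup>2) - (\<Sum>k\<in>F. (cmod (fourier \<Lambda> f k))\<^sup>2) + (\<Sum>k\<in>F. (cmod (fourier \<Lambda> f k - c k))\<^sup>2)"
proof -
  let ?f = "\<lambda>y. complex_of_real (f y)" and ?F = "fourier \<Lambda> f"
  define p where "p y = (\<Sum>k\<in>F. c k * wave (- k) y)" for y
  have cf: "continuous_on UNIV ?f" using cont by (intro continuous_intros)
  have cp: "continuous_on UNIV p" unfolding p_def[abs_def] by (intro continuous_intros)
  note [continuous_intros] = cf cp
  have cross: "cell_avg \<Lambda> (\<lambda>y. ?f y * cnj (p y)) = (\<Sum>k\<in>F. cnj (c k) * ?F k)"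
  proof -
    have "(\<lambda>y. ?f y * cnj (p y)) = (\<lambda>y. \<Sum>k\<in>F. cnj (c k) * (wave k y * ?f y))"
      by (simp add: p_def cnj_wave sum_distrib_left mult_ac fun_eq_iff)
    then have "cell_avg \<Lambda> (\<lambda>y. ?f y * cnj (p y)) = (\<Sum>k\<in>F. cell_avg \<Lambda> (\<lambda>y. cnj (c k) * (wave k y * ?f y)))"
      by (simp only:) (intro cell_avg_sum continuous_intros)
    also have "\<dots> = (\<Sum>k\<in>F. cnj (c k) * ?F k)"
      unfolding fourier_eq_cell_avg[OF cont] by (intro sum.cong refl cell_avg_cmult continuous_intros)
    finally show ?thesis .
  qed
  have sq: "cell_avg \<Lambda> (\<lambda>y. p y * cnj (p y)) = (\<Sum>k\<in>F. c k * cnj (c k))"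
  proof -
    have "(\<lambda>y. p y * cnj (p y)) = (\<lambda>y. \<Sum>k\<in>F. \<Sum>l\<in>F. (c k * cnj (c l)) * wave (l - k) y)"
      by (simp add: p_def cnj_wave sum_product fun_eq_iff mult_ac flip: wave_mult) (simp add: mult_ac wave_mult)
    then have "cell_avg \<Lambda> (\<lambda>y. p y * cnj (p y)) = (\<Sum>k\<in>F. cell_avg \<Lambda> (\<lambda>y. \<Sum>l\<in>F. (c k * cnj (c l)) * wave (l - k) y))"
      by (simp only:) (intro cell_avg_sum continuous_intros)
    also have "\<dots> = (\<Sum>k\<in>F. \<Sum>l\<in>F. cell_avg \<Lambda> (\<lambda>y. (c k * cnj (c l)) * wave (l - k) y))"
      by (intro sum.cong refl cell_avg_sum continuous_intros)
    also have "\<dots> = (\<Sum>k\<in>F. \<Sum>l\<in>F. (c k * cnj (c l)) * cell_avg \<Lambda> (wave (l - k)))"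
      by (intro sum.cong refl cell_avg_cmult continuous_intros)
    also have "\<dots> = (\<Sum>k\<in>F. \<Sum>l\<in>F. if l = k then c k * cnj (c k) else 0)"
      using F \<Lambda> by (intro sum.cong refl) (auto simp: cell_avg_wave dual_lattice_diff subset_iff)
    finally show ?thesis using F by simp
  qed
  have "complex_of_real (cell_avg \<Lambda> (\<lambda>y. (cmod (?f y - p y))\<^sup>2)) = cell_avg \<Lambda> (\<lambda>y. complex_of_real ((cmod (?f y - p y))\<^sup>2))"
    by (rule cell_avg_of_real[symmetric]) (intro continuous_intros)
  also have "\<dots> = cell_avg \<Lambda> (\<lambda>y. of_real ((f y)\<^sup>2) - (?f y * cnj (p y) + cnj (?f y * cnj (p y))) + p y * cnj (p y))"
    by (rule arg_cong[where f="cell_avg \<Lambda>"])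
       (unfold complex_norm_square, simp add: fun_eq_iff algebra_simps power2_eq_square)
  also have "\<dots> = of_real (cell_avg \<Lambda> (\<lambda>y. (f y)\<^sup>2)) - (cell_avg \<Lambda> (\<lambda>y. ?f y * cnj (p y)) + cnj (cell_avg \<Lambda> (\<lambda>y. ?f y * cnj (p y))))
      + cell_avg \<Lambda> (\<lambda>y. p y * cnj (p y))"
    using cont by (simp add: cell_avg_add cell_avg_diff cell_avg_cnj cell_avg_of_real continuous_intros
        del: of_real_power complex_cnj_mult complex_cnj_cnj)
  also have "\<dots> = of_real (cell_avg \<Lambda> (\<lambda>y. (f y)\<^sup>2)) - (\<Sum>k\<in>F. cnj (c k) * ?F k + c k * cnj (?F k) - c k * cnj (c k))"
    unfolding cross sq by (simp add: sum.distrib sum_subtractf)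
  also have "\<dots> = of_real (cell_avg \<Lambda> (\<lambda>y. (f y)\<^sup>2) - (\<Sum>k\<in>F. (cmod (?F k))\<^sup>2) + (\<Sum>k\<in>F. (cmod (?F k - c k))\<^sup>2))"
    by (simp add: complex_norm_square algebra_simps sum.distrib sum_subtractf del: of_real_power)
  finally show ?thesis unfolding p_def of_real_eq_iff .
qed

lemma bessel:
  fixes f :: "real^'n::finite \<Rightarrow> real"
  assumes "continuous_on UNIV f" "0 < \<Lambda>" "finite F" "F \<subseteq> dual_lattice \<Lambda>"
  shows "(\<Sum>k\<in>F. (cmod (fourier \<Lambda> f k))\<^sup>2) \<le> cell_avg \<Lambda> (\<lambda>y. (f y)\<^sup>2)"
proof -
  have "0 = cell_avg \<Lambda> (\<lambda>y::real^'n. 0::real)" using assms by simp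
  also have "\<dots> \<le> cell_avg \<Lambda> (\<lambda>y. (cmod (of_real (f y) - (\<Sum>k\<in>F. fourier \<Lambda> f k * wave (- k) y)))\<^sup>2)"
    by (intro cell_avg_mono) (use assms in \<open>auto intro!: continuous_intros\<close>)
  also have "\<dots> = cell_avg \<Lambda> (\<lambda>y. (f y)\<^sup>2) - (\<Sum>k\<in>F. (cmod (fourier \<Lambda> f k))\<^sup>2)"
    by (simp add: mean_square_distance[OF assms])
  finally show ?thesis by simp
qed

text \<open>
Completeness of the waves: the trigonometric sums are uniformly dense, and no combination of given waves
approximates \<open>f\<close> better in mean square than its Fourier sum.
\<close>

theorem parseval:
  fixes f :: "real^'n::finite \<Rightarrow> real"
  assumes cont: "continuous_on UNIV f" and per: "lattice_periodic \<Lambda> f" and \<Lambda>: "0 < \<Lambda>"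
  shows "((\<lambda>k. (cmod (fourier \<Lambda> f k))\<^sup>2) has_sum cell_avg \<Lambda> (\<lambda>y. (f y)\<^sup>2)) (dual_lattice \<Lambda>)"
proof -
  let ?a = "\<lambda>k. (cmod (fourier \<Lambda> f k))\<^sup>2" and ?S = "cell_avg \<Lambda> (\<lambda>y. (f y)\<^sup>2)"
  have approx: "\<exists>F. finite F \<and> F \<subseteq> dual_lattice \<Lambda> \<and> ?S - e < sum ?a F" if "0 < e" for e
  proof -
    define \<epsilon> where "\<epsilon> = sqrt (e / 2)"
    have \<epsilon>: "0 < \<epsilon>" "\<epsilon>\<^sup>2 < e" using that by (simp_all add: \<epsilon>_def)
    obtain p where p: "trig_sum \<Lambda> p" "\<And>y. y \<in> cbox 0 (\<chi> i. \<Lambda>) \<Longrightarrow> cmod (of_real (f y) - p y) < \<epsilon>"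
      using trig_sum_dense[OF cont per \<Lambda> \<epsilon>(1)] by blast
    obtain G c where G: "finite G" "G \<subseteq> dual_lattice \<Lambda>" "\<And>y. p y = (\<Sum>k\<in>G. c k * wave k y)"
      using trig_sum_finite_expansion[OF p(1)] by blast
    \<comment> \<open>the Fourier sum is indexed by the negatives of the wave vectors\<close>
    define F where "F = uminus ` G"
    have F: "finite F" "F \<subseteq> dual_lattice \<Lambda>"
      using G dual_lattice_uminus by (auto simp: F_def)
    have pF: "p y = (\<Sum>k\<in>F. c (- k) * wave (- k) y)" for y
      unfolding F_def G(3) by (subst sum.reindex) (auto simp: inj_on_def)
    have "?S - sum ?a F \<le> ?S - sum ?a F + (\<Sum>k\<in>F. (cmod (fourier \<Lambda> f k - c (- k)))\<^sup>2)"
      by (simp add: sum_nonneg)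
    also have "\<dots> = cell_avg \<Lambda> (\<lambda>y. (cmod (of_real (f y) - p y))\<^sup>2)"
      unfolding pF by (rule mean_square_distance[OF cont \<Lambda> F, symmetric])
    also have "\<dots> \<le> cell_avg \<Lambda> (\<lambda>y::real^'n. \<epsilon>\<^sup>2)"
    proof (rule cell_avg_mono[OF \<Lambda>])
      show "(cmod (of_real (f y) - p y))\<^sup>2 \<le> \<epsilon>\<^sup>2" if "y \<in> cbox 0 (\<chi> i. \<Lambda>)" for y
        using p(2)[OF that] by (intro power_mono) auto
      show "continuous_on UNIV (\<lambda>y. (cmod (of_real (f y) - p y))\<^sup>2)"
        unfolding pF by (intro continuous_intros cont)
    qed (rule continuous_on_const)
    also have "\<dots> < e" using \<Lambda> \<epsilon> by simp
    finally show ?thesis using F by (intro exI[of _ F]) auto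
  qed
  have "(?a has_sum (SUP F\<in>{F. finite F \<and> F \<subseteq> dual_lattice \<Lambda>}. sum ?a F)) (dual_lattice \<Lambda>)"
    by (rule nonneg_bdd_above_has_sum) (auto intro!: bdd_aboveI[of _ ?S] bessel cont \<Lambda>)
  moreover have "(SUP F\<in>{F. finite F \<and> F \<subseteq> dual_lattice \<Lambda>}. sum ?a F) = ?S"
  proof (rule cSup_eq_non_empty)
    fix b assume b: "\<And>x. x \<in> sum ?a ` {F. finite F \<and> F \<subseteq> dual_lattice \<Lambda>} \<Longrightarrow> x \<le> b"
    show "?S \<le> b"
    proof (rule ccontr)
      assume "\<not> ?S \<le> b"
      then obtain F where "finite F" "F \<subseteq> dual_lattice \<Lambda>" "?S - (?S - b) < sum ?a F"
        using approx[of "?S - b"] by auto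
      with b[of "sum ?a F"] show False by auto
    qed
  qed (auto intro!: bessel cont \<Lambda>)
  ultimately show ?thesis by simp
qed

lemma fourier_add:
  assumes "continuous_on UNIV f" "continuous_on UNIV g"
  shows "fourier \<Lambda> (\<lambda>y. f y + g y) k = fourier \<Lambda> f k + fourier \<Lambda> g k"
    and "fourier \<Lambda> (\<lambda>y. f y - g y) k = fourier \<Lambda> f k - fourier \<Lambda> g k"
  using assms
  by (simp_all add: fourier_eq_cell_avg continuous_intros ring_distribs cell_avg_add cell_avg_diff)

text \<open>
By polarization; the summand is the real part of \<open>fourier \<Lambda> f k * cnj (fourier \<Lambda> g k)\<close>.
\<close>

corollary parseval_product:
  fixes f g :: "real^'n::finite \<Rightarrow> real"
  assumes f: "continuous_on UNIV f" "lattice_periodic \<Lambda> f" and g: "continuous_on UNIV g" "lattice_periodic \<Lambda> g"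
    and \<Lambda>: "0 < \<Lambda>"
  shows "((\<lambda>k. Re (fourier \<Lambda> f k) * Re (fourier \<Lambda> g k) + Im (fourier \<Lambda> f k) * Im (fourier \<Lambda> g k))
    has_sum cell_avg \<Lambda> (\<lambda>y. f y * g y)) (dual_lattice \<Lambda>)"
proof -
  have "((\<lambda>k. ((cmod (fourier \<Lambda> f k + fourier \<Lambda> g k))\<^sup>2 - (cmod (fourier \<Lambda> f k - fourier \<Lambda> g k))\<^sup>2) / 4)
      has_sum (cell_avg \<Lambda> (\<lambda>y. (f y + g y)\<^sup>2) - cell_avg \<Lambda> (\<lambda>y. (f y - g y)\<^sup>2)) / 4) (dual_lattice \<Lambda>)"
  proof (rule has_sum_divide_const)
    have plus: "((\<lambda>k. (cmod (fourier \<Lambda> f k + fourier \<Lambda> g k))\<^sup>2) has_sum cell_avg \<Lambda> (\<lambda>y. (f y + g y)\<^sup>2)) (dual_lattice \<Lambda>)"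
      using parseval[of "\<lambda>y. f y + g y" \<Lambda>] f g \<Lambda> by (simp add: fourier_add lattice_periodic_def continuous_on_add)
    have minus: "((\<lambda>k. (cmod (fourier \<Lambda> f k - fourier \<Lambda> g k))\<^sup>2) has_sum cell_avg \<Lambda> (\<lambda>y. (f y - g y)\<^sup>2)) (dual_lattice \<Lambda>)"
      using parseval[of "\<lambda>y. f y - g y" \<Lambda>] f g \<Lambda> by (simp add: fourier_add lattice_periodic_def continuous_on_diff)
    from has_sum_add[OF plus has_sum_uminusI[OF minus]]
    show "((\<lambda>k. (cmod (fourier \<Lambda> f k + fourier \<Lambda> g k))\<^sup>2 - (cmod (fourier \<Lambda> f k - fourier \<Lambda> g k))\<^sup>2)
      has_sum cell_avg \<Lambda> (\<lambda>y. (f y + g y)\<^sup>2) - cell_avg \<Lambda> (\<lambda>y. (f y - g y)\<^sup>2)) (dual_lattice \<Lambda>)"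
      by simp
  qed
  moreover have "cell_avg \<Lambda> (\<lambda>y. (f y + g y)\<^sup>2) - cell_avg \<Lambda> (\<lambda>y. (f y - g y)\<^sup>2) = cell_avg \<Lambda> (\<lambda>y. 4 * (f y * g y))"
    using f g by (subst cell_avg_diff[symmetric]) (auto intro!: continuous_intros arg_cong[where f="cell_avg \<Lambda>"] simp: power2_eq_square algebra_simps)
  moreover have "cell_avg \<Lambda> (\<lambda>y. 4 * (f y * g y)) = 4 * cell_avg \<Lambda> (\<lambda>y. f y * g y)"
    using f g by (intro cell_avg_cmult continuous_intros)
  moreover have "((cmod (a + b))\<^sup>2 - (cmod (a - b))\<^sup>2) / 4 = Re a * Re b + Im a * Im b" for a b
    unfolding cmod_power2 by (simp add: power2_eq_square algebra_simps)
  ultimately show ?thesis by simp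
qed

section \<open>Derivatives of fields on the slab and of their modes\<close>

lemma has_vector_derivative_cong_on:
  assumes "\<And>x. x \<in> S \<Longrightarrow> f x = g x" "z \<in> S"
  shows "(f has_vector_derivative d) (at z within S) \<longleftrightarrow> (g has_vector_derivative d) (at z within S)"
  using has_vector_derivative_transform[OF assms(2), of f g] has_vector_derivative_transform[OF assms(2), of g f] assms(1)
  by auto

lemma dz_cong:
  assumes "\<And>z. z \<in> {0..H} \<Longrightarrow> f t y z = g t y z" "z \<in> {0..H}"
  shows "dz H f t y z = dz H g t y z"
  unfolding dz_def vector_derivative_def using has_vector_derivative_cong_on[OF assms] by simp

lemma dy_cong:
  assumes "\<And>y. f t y z = g t y z"
  shows "dy i f t y z = dy i g t y z"
  unfolding dy_def using assms by simp

lemma C_slab_continuous: "C_slab k H f \<Longrightarrow> continuous_on ({0..} \<times> UNIV \<times> {0..H}) (\<lambda>(t, y, z). f t y z)"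
  by (cases k) auto

text \<open>
Only the values for \<open>t \<ge> 0\<close> and \<open>z \<in> {0..H}\<close> matter. This is needed because \<^const>\<open>dz\<close> and \<^const>\<open>dy\<close> of a
sum are known to agree with the sum of the derivatives only there.
\<close>

lemma C_slab_cong:
  assumes "\<And>t y z. 0 \<le> t \<Longrightarrow> z \<in> {0..H} \<Longrightarrow> f t y z = g t y z" "C_slab k H f"
  shows "C_slab k H g"
  using assms
proof (induction k arbitrary: f g)
  case 0
  then show ?case
    by (auto elim!: continuous_on_eq)
next
  case (Suc k)
  have cont: "continuous_on ({0..} \<times> UNIV \<times> {0..H}) (\<lambda>(t, y, z). g t y z)"
    using C_slab_continuous[OF Suc.prems(2)] by (rule continuous_on_eq) (use Suc.prems(1) in auto)
  have z: "g t y differentiable (at z within {0..H})" if "0 \<le> t" "z \<in> {0..H}" for t y z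
  proof -
    have "f t y differentiable (at z within {0..H})" using Suc.prems(2) that by simp
    then obtain d where "(f t y has_vector_derivative d) (at z within {0..H})"
      using vector_derivative_works by blast
    then have "(g t y has_vector_derivative d) (at z within {0..H})"
      using has_vector_derivative_cong_on[of "{0..H}" "f t y" "g t y" z d] Suc.prems(1) that by blast
    then show ?thesis by (rule differentiableI_vector)
  qed
  have y: "(\<lambda>s. g t (y + s *\<^sub>R axis i 1) z) differentiable (at 0)" if "0 \<le> t" "z \<in> {0..H}" for t y z i
  proof -
    have "(\<lambda>s. f t (y + s *\<^sub>R axis i 1) z) = (\<lambda>s. g t (y + s *\<^sub>R axis i 1) z)"
      using Suc.prems(1)[OF that] by simp
    moreover have "(\<lambda>s. f t (y + s *\<^sub>R axis i 1) z) differentiable (at 0)"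
      using Suc.prems(2) that by simp
    ultimately show ?thesis by simp
  qed
  have "C_slab k H (dz H g)"
    by (rule Suc.IH[of "dz H f"]) (use Suc.prems in \<open>auto intro!: dz_cong\<close>)
  moreover have "C_slab k H (dy i g)" for i
    by (rule Suc.IH[of "dy i f"]) (use Suc.prems in \<open>auto intro!: dy_cong\<close>)
  ultimately show ?case using cont z y by simp
qed

lemma C_slab_dz_has_derivative:
  assumes "C_slab (Suc k) H f" "0 \<le> t" "z \<in> {0..H}"
  shows "(f t y has_vector_derivative dz H f t y z) (at z within {0..H})"
  using assms unfolding dz_def by (simp flip: vector_derivative_works)

lemma C_slab_dy_has_derivative:
  assumes "C_slab (Suc k) H f" "0 \<le> t" "z \<in> {0..H}"
  shows "((\<lambda>s. f t (y + s *\<^sub>R axis i 1) z) has_real_derivative dy i f t y z) (at 0)"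
  using assms unfolding dy_def
  by (simp add: DERIV_deriv_iff_real_differentiable real_differentiable_def differentiable_def)

lemma C_slab_dz: "C_slab (Suc k) H f \<Longrightarrow> C_slab k H (dz H f)"
  and C_slab_dy: "C_slab (Suc k) H f \<Longrightarrow> C_slab k H (dy i f)"
  by simp_all

lemma dz_unique:
  assumes "0 < H" "z \<in> {0..H}" "(f t y has_vector_derivative d) (at z within {0..H})"
  shows "dz H f t y z = d"
  unfolding dz_def using assms
  by (intro vector_derivative_within_closed_interval) auto

lemma dy_unique:
  assumes "((\<lambda>s. f t (y + s *\<^sub>R axis i 1) z) has_real_derivative d) (at 0)"
  shows "dy i f t y z = d"
  unfolding dy_def by (rule DERIV_imp_deriv[OF assms])

lemma C_slab_add:
  assumes H: "0 < H" and "C_slab k H f" "C_slab k H g"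
  shows "C_slab k H (\<lambda>t y z. f t y z + g t y z)"
  using assms(2,3)
proof (induction k arbitrary: f g)
  case 0
  then show ?case by (auto simp: split_beta intro!: continuous_on_add)
next
  case (Suc k)
  let ?h = "\<lambda>t y z. f t y z + g t y z"
  have z: "(?h t y has_vector_derivative dz H f t y z + dz H g t y z) (at z within {0..H})"
    if "0 \<le> t" "z \<in> {0..H}" for t y z
    by (rule has_vector_derivative_add[OF C_slab_dz_has_derivative[OF Suc.prems(1) that] C_slab_dz_has_derivative[OF Suc.prems(2) that]])
  have y: "((\<lambda>s. ?h t (y + s *\<^sub>R axis i 1) z) has_real_derivative dy i f t y z + dy i g t y z) (at 0)"
    if "0 \<le> t" "z \<in> {0..H}" for t y z i
    by (rule DERIV_add[OF C_slab_dy_has_derivative[OF Suc.prems(1) that] C_slab_dy_has_derivative[OF Suc.prems(2) that]])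
  have "C_slab k H (dz H ?h)"
    by (rule C_slab_cong[of H "\<lambda>t y z. dz H f t y z + dz H g t y z"])
       (use Suc in \<open>auto intro!: dz_unique[OF H, symmetric] z\<close>)
  moreover have "C_slab k H (dy i ?h)" for i
    by (rule C_slab_cong[of H "\<lambda>t y z. dy i f t y z + dy i g t y z"])
       (use Suc in \<open>auto intro!: dy_unique[symmetric] y\<close>)
  moreover have "continuous_on ({0..} \<times> UNIV \<times> {0..H}) (\<lambda>(t, y, z). ?h t y z)"
    using Suc.prems by (auto simp: split_beta intro!: continuous_on_add)
  moreover have "?h t y differentiable (at z within {0..H})" if "0 \<le> t" "z \<in> {0..H}" for t y z
    using z[OF that] by (rule differentiableI_vector)
  moreover have "(\<lambda>s. ?h t (y + s *\<^sub>R axis i 1) z) differentiable (at 0)" if "0 \<le> t" "z \<in> {0..H}" for t y z i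
    using y[OF that] by (auto simp: real_differentiable_def)
  ultimately show ?case by simp
qed

lemma C_slab_sum:
  assumes "0 < H" "finite F" "F \<noteq> {}" "\<And>j. j \<in> F \<Longrightarrow> C_slab k H (f j)"
  shows "C_slab k H (\<lambda>t y z. \<Sum>j\<in>F. f j t y z)"
  using assms(2-4) by (induction rule: finite_ne_induct) (auto intro: C_slab_add[OF assms(1)])

lemma C_slab_laplace_y: "0 < H \<Longrightarrow> C_slab (Suc (Suc k)) H f \<Longrightarrow> C_slab k H (laplace_y f)"
  unfolding laplace_y_def by (intro C_slab_sum) auto

lemma C_slab_laplace: "0 < H \<Longrightarrow> C_slab (Suc (Suc k)) H f \<Longrightarrow> C_slab k H (laplace H f)"
  unfolding laplace_def by (intro C_slab_add C_slab_laplace_y C_slab_dz)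

lemma periodic_y_dy:
  fixes f :: "'n::finite field_fun"
  shows "periodic_y \<Lambda> H f \<Longrightarrow> periodic_y \<Lambda> H (dy i f)"
  unfolding periodic_y_def dy_def
proof (intro allI ballI impI)
  fix t z :: real and y :: "real^'n" and j :: 'n
  assume f: "\<forall>t\<ge>0. \<forall>y. \<forall>z\<in>{0..H}. \<forall>i. f t (y + \<Lambda> *\<^sub>R axis i 1) z = f t y z" and "0 \<le> t" "z \<in> {0..H}"
  have "f t (y + \<Lambda> *\<^sub>R axis j 1 + s *\<^sub>R axis i 1) z = f t (y + s *\<^sub>R axis i 1) z" for s
    using f[rule_format, of t z "y + s *\<^sub>R axis i 1" j] \<open>0 \<le> t\<close> \<open>z \<in> {0..H}\<close> by (simp add: add_ac)
  then show "deriv (\<lambda>s. f t (y + \<Lambda> *\<^sub>R axis j 1 + s *\<^sub>R axis i 1) z) 0 = deriv (\<lambda>s. f t (y + s *\<^sub>R axis i 1) z) 0"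
    by simp
qed

lemma periodic_y_dz:
  fixes f :: "'n::finite field_fun"
  shows "periodic_y \<Lambda> H f \<Longrightarrow> periodic_y \<Lambda> H (dz H f)"
  unfolding periodic_y_def
proof (intro allI ballI impI)
  fix t z :: real and y :: "real^'n" and j :: 'n
  assume f: "\<forall>t\<ge>0. \<forall>y. \<forall>z\<in>{0..H}. \<forall>i. f t (y + \<Lambda> *\<^sub>R axis i 1) z = f t y z" and t: "0 \<le> t" "z \<in> {0..H}"
  have "dz H f t (y + \<Lambda> *\<^sub>R axis j 1) z = dz H (\<lambda>t y. f t (y + \<Lambda> *\<^sub>R axis j 1)) t y z"
    by (simp add: dz_def)
  also have "\<dots> = dz H f t y z"
    by (rule dz_cong) (use f t in auto)
  finally show "dz H f t (y + \<Lambda> *\<^sub>R axis j 1) z = dz H f t y z" .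
qed

lemma periodic_y_laplace: "periodic_y \<Lambda> H f \<Longrightarrow> periodic_y \<Lambda> H (laplace H f)"
proof -
  assume f: "periodic_y \<Lambda> H f"
  have "periodic_y \<Lambda> H (dy i (dy i f))" "periodic_y \<Lambda> H (dz H (dz H f))" for i
    by (intro periodic_y_dy periodic_y_dz f)+
  then show ?thesis by (simp add: periodic_y_def laplace_def laplace_y_def)
qed

lemma periodic_y_slice: "periodic_y \<Lambda> H f \<Longrightarrow> 0 \<le> t \<Longrightarrow> z \<in> {0..H} \<Longrightarrow> lattice_periodic \<Lambda> (\<lambda>y. f t y z)"
  by (simp add: periodic_y_def lattice_periodic_def)

lemma C_slab_continuous_slice:
  assumes "C_slab k H f" "0 \<le> t" "z \<in> {0..H}"
  shows "continuous_on UNIV (\<lambda>y. f t y z)"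
proof -
  have "continuous_on UNIV (\<lambda>y. (\<lambda>(t, y, z). f t y z) (t, y, z))"
    by (rule continuous_on_compose2[OF C_slab_continuous[OF assms(1)]])
       (use assms in \<open>auto intro!: continuous_intros\<close>)
  then show ?thesis by simp
qed

text \<open>
Real and imaginary parts of a Fourier coefficient are treated together as cosine modes with a phase,
\<open>0\<close> and \<open>- pi / 2\<close> respectively. Up to a factor, a horizontal derivative then merely shifts the phase by \<open>pi / 2\<close>.
\<close>

definition mode :: "real \<Rightarrow> real^'n::finite \<Rightarrow> real \<Rightarrow> (real^'n \<Rightarrow> real) \<Rightarrow> real" where
  "mode \<Lambda> k \<theta> g = cell_avg \<Lambda> (\<lambda>y. g y * cos (k \<bullet> y + \<theta>))"

lemma fourier_mode:
  assumes "continuous_on UNIV g"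
  shows "Re (fourier \<Lambda> g k) = mode \<Lambda> k 0 g" "Im (fourier \<Lambda> g k) = mode \<Lambda> k (- (pi / 2)) g"
proof -
  have c: "continuous_on UNIV (\<lambda>y. wave k y * complex_of_real (g y))"
    using assms by (intro continuous_intros)
  have "sin x = cos (x - pi / 2)" for x :: real
    by (simp add: cos_diff)
  then show "Re (fourier \<Lambda> g k) = mode \<Lambda> k 0 g" "Im (fourier \<Lambda> g k) = mode \<Lambda> k (- (pi / 2)) g"
    unfolding fourier_eq_cell_avg[OF assms] mode_def
      cell_avg_linear[OF bounded_linear_Re c, symmetric] cell_avg_linear[OF bounded_linear_Im c, symmetric]
    by (simp_all add: wave_def mult.commute)
qed

lemma mode_add: "continuous_on UNIV f \<Longrightarrow> continuous_on UNIV g \<Longrightarrow>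
    mode \<Lambda> k \<theta> (\<lambda>y. f y + g y) = mode \<Lambda> k \<theta> f + mode \<Lambda> k \<theta> g"
  unfolding mode_def distrib_right by (intro cell_avg_add continuous_intros)

lemma mode_sum: "(\<And>j. j \<in> F \<Longrightarrow> continuous_on UNIV (f j)) \<Longrightarrow>
    mode \<Lambda> k \<theta> (\<lambda>y. \<Sum>j\<in>F. f j y) = (\<Sum>j\<in>F. mode \<Lambda> k \<theta> (f j))"
  unfolding mode_def sum_distrib_right by (intro cell_avg_sum continuous_intros)

lemma mode_minus: "continuous_on UNIV f \<Longrightarrow> mode \<Lambda> k \<theta> (\<lambda>y. - f y) = - mode \<Lambda> k \<theta> f"
proof -
  assume "continuous_on UNIV f"
  then have "cell_avg \<Lambda> (\<lambda>y. (- 1) * (f y * cos (k \<bullet> y + \<theta>))) = (- 1) * cell_avg \<Lambda> (\<lambda>y. f y * cos (k \<bullet> y + \<theta>))"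
    by (intro cell_avg_cmult continuous_intros)
  then show ?thesis by (simp add: mode_def)
qed

lemma mode_dy:
  assumes f: "C_slab (Suc m) H f" "periodic_y \<Lambda> H f" and t: "0 \<le> t" "z \<in> {0..H}"
    and k: "k \<in> dual_lattice \<Lambda>" and \<Lambda>: "0 < \<Lambda>"
  shows "mode \<Lambda> k \<theta> (\<lambda>y. dy i f t y z) = - (k $ i) * mode \<Lambda> k (\<theta> + pi / 2) (\<lambda>y. f t y z)"
proof -
  note [continuous_intros] = C_slab_continuous_slice[OF f(1) t] C_slab_continuous_slice[OF C_slab_dy[OF f(1)] t]
  have "cell_avg \<Lambda> (\<lambda>y. dy i f t y z * cos (k \<bullet> y + \<theta>) + k $ i * (f t y z * cos (k \<bullet> y + (\<theta> + pi / 2)))) = 0"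
  proof (rule cell_avg_derivative_zero[OF \<Lambda>, where g="\<lambda>y. f t y z * cos (k \<bullet> y + \<theta>)" and j=i])
    show "lattice_periodic \<Lambda> (\<lambda>y. f t y z * cos (k \<bullet> y + \<theta>))"
      unfolding lattice_periodic_def
    proof (intro allI)
      fix y j
      obtain m :: int where m: "k \<bullet> (y + \<Lambda> *\<^sub>R axis j 1) = k \<bullet> y + 2 * pi * of_int m"
        using dual_lattice_period[OF k \<Lambda>] .
      have "cos (k \<bullet> y + 2 * pi * of_int m + \<theta>) = cos (k \<bullet> y + \<theta>)"
        using cos_add[of "k \<bullet> y + \<theta>" "2 * pi * of_int m"] by (simp add: add_ac cos_int_2pin sin_int_2pin)
      then show "f t (y + \<Lambda> *\<^sub>R axis j 1) z * cos (k \<bullet> (y + \<Lambda> *\<^sub>R axis j 1) + \<theta>) = f t y z * cos (k \<bullet> y + \<theta>)"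
        using f(2) t unfolding periodic_y_def m by simp
    qed
    fix y
    have c: "cos (k \<bullet> y + (\<theta> + pi / 2)) = - sin (k \<bullet> y + \<theta>)"
      by (simp add: cos_add sin_add)
    have "((\<lambda>s. cos (k \<bullet> (y + s *\<^sub>R axis i 1) + \<theta>)) has_real_derivative - sin (k \<bullet> y + \<theta>) * k $ i) (at 0)"
      unfolding inner_add_right inner_scaleR_right inner_axis
      by (auto intro!: derivative_eq_intros)
    from DERIV_mult[OF C_slab_dy_has_derivative[OF f(1) t, of y i] this]
    have "((\<lambda>s. f t (y + s *\<^sub>R axis i 1) z * cos (k \<bullet> (y + s *\<^sub>R axis i 1) + \<theta>)) has_real_derivative
        dy i f t y z * cos (k \<bullet> y + \<theta>) + k $ i * (f t y z * cos (k \<bullet> y + (\<theta> + pi / 2)))) (at 0)"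
      unfolding c by (simp add: mult_ac)
    then show "((\<lambda>s. f t (y + s *\<^sub>R axis i 1) z * cos (k \<bullet> (y + s *\<^sub>R axis i 1) + \<theta>)) has_vector_derivative
        dy i f t y z * cos (k \<bullet> y + \<theta>) + k $ i * (f t y z * cos (k \<bullet> y + (\<theta> + pi / 2)))) (at 0)"
      by (simp add: has_real_derivative_iff_has_vector_derivative)
  qed (intro continuous_intros)+
  also have "cell_avg \<Lambda> (\<lambda>y. dy i f t y z * cos (k \<bullet> y + \<theta>) + k $ i * (f t y z * cos (k \<bullet> y + (\<theta> + pi / 2)))) =
      mode \<Lambda> k \<theta> (\<lambda>y. dy i f t y z) + k $ i * mode \<Lambda> k (\<theta> + pi / 2) (\<lambda>y. f t y z)"
  proof -
    have "cell_avg \<Lambda> (\<lambda>y. k $ i * (f t y z * cos (k \<bullet> y + (\<theta> + pi / 2)))) =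
        k $ i * cell_avg \<Lambda> (\<lambda>y. f t y z * cos (k \<bullet> y + (\<theta> + pi / 2)))"
      by (intro cell_avg_cmult continuous_intros)
    then show ?thesis
      unfolding mode_def by (subst cell_avg_add) (intro continuous_intros, intro continuous_intros, simp)
  qed
  finally show ?thesis by simp
qed

lemma mode_laplace_y:
  fixes f :: "'n::finite field_fun"
  assumes f: "C_slab (Suc (Suc m)) H f" "periodic_y \<Lambda> H f" and t: "0 \<le> t" "z \<in> {0..H}"
    and k: "k \<in> dual_lattice \<Lambda>" and \<Lambda>: "0 < \<Lambda>"
  shows "mode \<Lambda> k \<theta> (\<lambda>y. laplace_y f t y z) = - (norm k)\<^sup>2 * mode \<Lambda> k \<theta> (\<lambda>y. f t y z)"
proof -
  have "mode \<Lambda> k \<theta> (\<lambda>y. laplace_y f t y z) = (\<Sum>i\<in>UNIV. mode \<Lambda> k \<theta> (\<lambda>y. dy i (dy i f) t y z))"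
    unfolding laplace_y_def
    by (rule mode_sum) (rule C_slab_continuous_slice[OF C_slab_dy[OF C_slab_dy[OF f(1)]] t])
  also have "\<dots> = (\<Sum>i\<in>UNIV. - ((k $ i)\<^sup>2) * mode \<Lambda> k \<theta> (\<lambda>y. f t y z))"
  proof (rule sum.cong[OF refl])
    fix i
    have "mode \<Lambda> k (\<theta> + pi / 2 + pi / 2) g = - mode \<Lambda> k \<theta> g" if "continuous_on UNIV g" for g
    proof -
      have "cos (k \<bullet> y + (\<theta> + pi / 2 + pi / 2)) = - cos (k \<bullet> y + \<theta>)" for y
        by (simp add: cos_add sin_add)
      then show ?thesis using mode_minus[OF that] by (simp add: mode_def)
    qed
    then show "mode \<Lambda> k \<theta> (\<lambda>y. dy i (dy i f) t y z) = - ((k $ i)\<^sup>2) * mode \<Lambda> k \<theta> (\<lambda>y. f t y z)"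
      using C_slab_continuous_slice[OF f(1) t]
      by (simp add: mode_dy[OF C_slab_dy[OF f(1)] periodic_y_dy[OF f(2)] t k \<Lambda>] mode_dy[OF f t k \<Lambda>] power2_eq_square)
  qed
  also have "\<dots> = - (norm k)\<^sup>2 * mode \<Lambda> k \<theta> (\<lambda>y. f t y z)"
    by (simp add: norm_eq_sqrt_inner inner_vec_def power2_eq_square sum_distrib_right sum_negf sum_nonneg)
  finally show ?thesis .
qed

lemma mode_dz:
  fixes f :: "'n::finite field_fun"
  assumes f: "C_slab (Suc m) H f" and t: "0 \<le> t" and z: "z \<in> {0..H}"
  shows "((\<lambda>z. mode \<Lambda> k \<theta> (\<lambda>y. f t y z)) has_real_derivative mode \<Lambda> k \<theta> (\<lambda>y. dz H f t y z)) (at z within {0..H})"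
proof -
  let ?c = "\<lambda>y. cos (k \<bullet> y + \<theta>)"
  have "((\<lambda>z. integral (cbox 0 (\<chi> i. \<Lambda>)) (\<lambda>y. f t y z * ?c y)) has_real_derivative
      integral (cbox 0 (\<chi> i. \<Lambda>)) (\<lambda>y. dz H f t y z * ?c y)) (at z within {0..H})"
  proof (rule leibniz_rule_field_derivative[where fx="\<lambda>z y. dz H f t y z * ?c y"])
    show "(\<lambda>y. f t y z * ?c y) integrable_on cbox 0 (\<chi> i. \<Lambda>)" if "z \<in> {0..H}" for z
      by (intro cell_integrable continuous_intros C_slab_continuous_slice[OF f t that])
    have "continuous_on ({0..H} \<times> cbox 0 (\<chi> i. \<Lambda>)) (\<lambda>x. (\<lambda>(t, y, z). dz H f t y z) (t, snd x, fst x))"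
      by (rule continuous_on_compose2[OF C_slab_continuous[OF C_slab_dz[OF f]]])
         (use t in \<open>auto intro!: continuous_intros\<close>)
    then have "continuous_on ({0..H} \<times> cbox 0 (\<chi> i. \<Lambda>)) (\<lambda>x. dz H f t (snd x) (fst x))"
      by simp
    then show "continuous_on ({0..H} \<times> cbox 0 (\<chi> i. \<Lambda>)) (\<lambda>(z, y). dz H f t y z * ?c y)"
      unfolding split_beta by (intro continuous_intros)
    show "((\<lambda>z. f t y z * ?c y) has_real_derivative dz H f t y z * ?c y) (at z within {0..H})" if "z \<in> {0..H}" for y z
      using C_slab_dz_has_derivative[OF f t that] by (intro DERIV_cmult_right) (simp add: has_real_derivative_iff_has_vector_derivative)
  qed (use z in auto)
  then show ?thesis unfolding mode_def cell_avg_def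
    by (auto intro!: DERIV_cmult simp: divide_inverse[symmetric])
qed

section \<open>Estimates at a fixed time\<close>

text \<open>
Turns an unordered sum over a countable set into the limit of a sequence of finite partial sums, as
dominated convergence requires.
\<close>

lemma filterlim_exhaust_countable:
  assumes "countable A" "A \<noteq> {}"
  shows "filterlim (\<lambda>n. from_nat_into A ` {..n}) (finite_subsets_at_top A) sequentially"
  unfolding filterlim_finite_subsets_at_top
proof (intro allI impI)
  fix X assume X: "finite X \<and> X \<subseteq> A"
  define N where "N = Max (insert 0 (to_nat_on A ` X))"
  have "eventually (\<lambda>n. N \<le> n) sequentially" by (rule eventually_ge_at_top)
  then show "\<forall>\<^sub>F n in sequentially. finite (from_nat_into A ` {..n}) \<and> X \<subseteq> from_nat_into A ` {..n} \<and> from_nat_into A ` {..n} \<subseteq> A"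
  proof eventually_elim
    case (elim n)
    have "X \<subseteq> from_nat_into A ` {..n}"
    proof
      fix x assume x: "x \<in> X"
      then have "to_nat_on A x \<le> N" using X by (auto simp: N_def intro!: Max_ge)
      moreover have "from_nat_into A (to_nat_on A x) = x" using x X assms by auto
      ultimately show "x \<in> from_nat_into A ` {..n}" using elim by (metis atMost_iff image_eqI order_trans)
    qed
    then show ?case using assms by (auto intro: from_nat_into)
  qed
qed

text \<open>
The hypotheses of the theorem. In hydrodynamics \<open>w\<close> is the vertical velocity of the buoyant flow driven by
the temperature \<open>T\<close>; formally the equation is that of a clamped plate.
\<close>

locale plate =
  fixes H \<Lambda> M :: real and w T :: "'n::finite field_fun"
  assumes H: "0 < H" and \<Lambda>: "0 < \<Lambda>"
    and w: "C_slab 4 H w" and T: "C_slab 2 H T"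
    and w_per: "periodic_y \<Lambda> H w" and T_per: "periodic_y \<Lambda> H T"
    and T_bound: "\<And>t y z. 0 \<le> t \<Longrightarrow> z \<in> {0..H} \<Longrightarrow> \<bar>T t y z\<bar> \<le> M"
    and pde: "\<And>t y z. 0 \<le> t \<Longrightarrow> z \<in> {0<..<H} \<Longrightarrow> laplace H (laplace H w) t y z = - laplace_y T t y z"
    and bc: "\<And>t y z. 0 \<le> t \<Longrightarrow> z \<in> {0, H} \<Longrightarrow> w t y z = 0 \<and> dz H w t y z = 0"
begin

lemma w_derivatives:
  "C_slab (Suc (Suc (Suc (Suc 0)))) H w" "C_slab (Suc (Suc (Suc 0))) H (dz H w)"
  "C_slab (Suc (Suc 0)) H (dz H (dz H w))" "C_slab (Suc 0) H (dz H (dz H (dz H w)))"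
proof -
  show 1: "C_slab (Suc (Suc (Suc (Suc 0)))) H w" using w by (simp add: numeral_eq_Suc del: C_slab.simps)
  show 2: "C_slab (Suc (Suc (Suc 0))) H (dz H w)" by (rule C_slab_dz[OF 1])
  show 3: "C_slab (Suc (Suc 0)) H (dz H (dz H w))" by (rule C_slab_dz[OF 2])
  show "C_slab (Suc 0) H (dz H (dz H (dz H w)))" by (rule C_slab_dz[OF 3])
qed

lemma T_smooth: "C_slab (Suc (Suc 0)) H T"
  using T by (simp add: numeral_eq_Suc del: C_slab.simps)

lemmas slice = C_slab_continuous_slice[OF w_derivatives(1)] C_slab_continuous_slice[OF w_derivatives(2)]
  C_slab_continuous_slice[OF T_smooth]

lemma continuous_mode:
  assumes "C_slab (Suc m) H f" "0 \<le> t"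
  shows "continuous_on {0..H} (\<lambda>z. mode \<Lambda> k \<theta> (\<lambda>y. f t y z))"
  by (rule DERIV_continuous_on[OF mode_dz[OF assms]])

text \<open>
Taking modes of the equation. Writing \<open>laplace H (laplace H w) = laplace H G\<close> with \<open>G = laplace H w\<close> and taking
modes in two stages avoids commuting horizontal with vertical derivatives: the vertical derivatives of the
modes of \<open>G\<close> follow by differentiating the identity between the modes of \<open>G\<close> and \<open>w\<close>. For \<open>k = 0\<close> this
includes the equation for the horizontal mean.
\<close>

lemma mode_clamped:
  assumes k: "k \<in> dual_lattice \<Lambda>" and t: "0 \<le> t"
  shows "clamped_mode H ((norm k)\<^sup>2) (\<lambda>z. mode \<Lambda> k \<theta> (\<lambda>y. w t y z)) (\<lambda>z. mode \<Lambda> k \<theta> (\<lambda>y. dz H w t y z))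
    (\<lambda>z. mode \<Lambda> k \<theta> (\<lambda>y. dz H (dz H w) t y z)) (\<lambda>z. mode \<Lambda> k \<theta> (\<lambda>y. dz H (dz H (dz H w)) t y z))
    (\<lambda>z. mode \<Lambda> k \<theta> (\<lambda>y. dz H (dz H (dz H (dz H w))) t y z)) (\<lambda>z. mode \<Lambda> k \<theta> (\<lambda>y. T t y z))"
proof
  let ?m = "\<lambda>f z. mode \<Lambda> k \<theta> (\<lambda>y. f t y z)" and ?l = "(norm k)\<^sup>2"
  let ?w2 = "dz H (dz H w)"
  define G where "G = laplace H w"
  have G: "C_slab (Suc (Suc 0)) H G" unfolding G_def by (rule C_slab_laplace[OF H w_derivatives(1)])
  have G_per: "periodic_y \<Lambda> H G" unfolding G_def by (rule periodic_y_laplace[OF w_per])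
  have lap: "?m (laplace H f) z = - ?l * ?m f z + ?m (dz H (dz H f)) z"
    if f: "C_slab (Suc (Suc m)) H f" "periodic_y \<Lambda> H f" and z: "z \<in> {0..H}" for f m z
    unfolding laplace_def
    using mode_add[OF C_slab_continuous_slice[OF C_slab_laplace_y[OF H f(1)] t z]
        C_slab_continuous_slice[OF C_slab_dz[OF C_slab_dz[OF f(1)]] t z]]
    by (simp add: mode_laplace_y[OF f t z k \<Lambda>])
  note mG = lap[OF w_derivatives(1) w_per, folded G_def]
  have unique: "d = e" if "(f has_real_derivative d) (at z within {0..H})"
      "(g has_real_derivative e) (at z within {0..H})" "\<And>z. z \<in> {0..H} \<Longrightarrow> f z = g z" "z \<in> {0..H}" for f g d e z
    using that H has_vector_derivative_cong_on[of "{0..H}" f g z e]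
      vector_derivative_unique_within_closed_interval[of 0 H z f d e]
    by (simp add: has_real_derivative_iff_has_vector_derivative cbox_interval)
  have mG1: "?m (dz H G) z = - ?l * ?m (dz H w) z + ?m (dz H ?w2) z" if z: "z \<in> {0..H}" for z
    by (rule unique[OF mode_dz[OF G t z] DERIV_add[OF DERIV_cmult[OF mode_dz[OF w_derivatives(1) t z]] mode_dz[OF w_derivatives(3) t z]] mG z])
  have mG2: "?m (dz H (dz H G)) z = - ?l * ?m ?w2 z + ?m (dz H (dz H ?w2)) z" if z: "z \<in> {0..H}" for z
    by (rule unique[OF mode_dz[OF C_slab_dz[OF G] t z] DERIV_add[OF DERIV_cmult[OF mode_dz[OF w_derivatives(2) t z]] mode_dz[OF w_derivatives(4) t z]] mG1 z])
  show "?m (dz H (dz H ?w2)) z - 2 * ?l * ?m ?w2 z + ?l\<^sup>2 * ?m w z = ?l * ?m T z" if z: "z \<in> {0<..<H}" for z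
  proof -
    have z': "z \<in> {0..H}" using z by simp
    have "?m (laplace H G) z = ?m (\<lambda>t y z. - laplace_y T t y z) z"
      unfolding G_def by (simp add: pde[OF t z])
    also have "\<dots> = ?l * ?m T z"
      using mode_minus[OF C_slab_continuous_slice[OF C_slab_laplace_y[OF H T_smooth] t z']]
      by (simp add: mode_laplace_y[OF T_smooth T_per t z' k \<Lambda>])
    also have "?m (laplace H G) z = ?m (dz H (dz H ?w2)) z - 2 * ?l * ?m ?w2 z + ?l\<^sup>2 * ?m w z"
      using lap[OF G G_per z'] mG2[OF z'] mG[OF z'] by (simp add: algebra_simps power2_eq_square)
    finally show ?thesis .
  qed
  have zero: "?m f z = 0" if "\<And>y. f t y z = 0" for f :: "'n field_fun" and z
    using that by (simp add: mode_def cell_avg_def)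
  show "?m w 0 = 0" "?m (dz H w) 0 = 0" "?m w H = 0" "?m (dz H w) H = 0"
    by (rule zero; use bc[OF t] in simp)+
  show "continuous_on {0..H} (?m T)" by (rule continuous_mode[OF T_smooth t])
qed (use H in \<open>auto intro!: mode_dz[OF w_derivatives(1) t] mode_dz[OF w_derivatives(2) t] mode_dz[OF w_derivatives(3) t] mode_dz[OF w_derivatives(4) t]\<close>)

definition pairing :: "real \<Rightarrow> real^'n \<Rightarrow> real \<Rightarrow> real" where
  "pairing t k z = Re (fourier \<Lambda> (\<lambda>y. T t y z) k) * Re (fourier \<Lambda> (\<lambda>y. w t y z) k)
    + Im (fourier \<Lambda> (\<lambda>y. T t y z) k) * Im (fourier \<Lambda> (\<lambda>y. w t y z) k)"

definition flux :: "real \<Rightarrow> real \<Rightarrow> real" where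
  "flux t z = cell_avg \<Lambda> (\<lambda>y. T t y z * w t y z)"

definition mode_flux :: "real \<Rightarrow> real^'n \<Rightarrow> real" where
  "mode_flux t k = integral {0..H} (\<lambda>z. pairing t k z / z)"

definition total_flux :: "real \<Rightarrow> real" where
  "total_flux t = integral {0..H} (\<lambda>z. flux t z / z)"

lemma pairing_sums:
  assumes "0 \<le> t" "z \<in> {0..H}"
  shows "((\<lambda>k. pairing t k z) has_sum flux t z) (dual_lattice \<Lambda>)"
  unfolding pairing_def flux_def
  by (intro parseval_product slice assms periodic_y_slice[OF T_per] periodic_y_slice[OF w_per] \<Lambda>)

lemma fourier_sq:
  assumes "C_slab m H f" "0 \<le> t" "z \<in> {0..H}"
  shows "(cmod (fourier \<Lambda> (\<lambda>y. f t y z) k))\<^sup>2 = (mode \<Lambda> k 0 (\<lambda>y. f t y z))\<^sup>2 + (mode \<Lambda> k (- (pi / 2)) (\<lambda>y. f t y z))\<^sup>2"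
  unfolding cmod_power2 fourier_mode[OF C_slab_continuous_slice[OF assms]] ..

lemma pairing_integrable:
  assumes t: "0 \<le> t" and k: "k \<in> dual_lattice \<Lambda>"
  shows "(\<lambda>z. pairing t k z / z) integrable_on {0..H}"
    and "mode_flux t k = integral {0..H} (\<lambda>z. mode \<Lambda> k 0 (\<lambda>y. T t y z) * mode \<Lambda> k 0 (\<lambda>y. w t y z) / z)
      + integral {0..H} (\<lambda>z. mode \<Lambda> k (- (pi / 2)) (\<lambda>y. T t y z) * mode \<Lambda> k (- (pi / 2)) (\<lambda>y. w t y z) / z)"
proof -
  let ?q = "\<lambda>\<theta> z. mode \<Lambda> k \<theta> (\<lambda>y. T t y z) * mode \<Lambda> k \<theta> (\<lambda>y. w t y z) / z"
  have int: "?q \<theta> integrable_on {0..H}" for \<theta>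
  proof -
    interpret c: clamped_mode H "(norm k)\<^sup>2" "\<lambda>z. mode \<Lambda> k \<theta> (\<lambda>y. w t y z)" "\<lambda>z. mode \<Lambda> k \<theta> (\<lambda>y. dz H w t y z)"
      "\<lambda>z. mode \<Lambda> k \<theta> (\<lambda>y. dz H (dz H w) t y z)" "\<lambda>z. mode \<Lambda> k \<theta> (\<lambda>y. dz H (dz H (dz H w)) t y z)"
      "\<lambda>z. mode \<Lambda> k \<theta> (\<lambda>y. dz H (dz H (dz H (dz H w))) t y z)" "\<lambda>z. mode \<Lambda> k \<theta> (\<lambda>y. T t y z)"
      by (rule mode_clamped[OF k t])
    show ?thesis by (rule integrable_continuous_interval[OF c.cont_quot])
  qed
  have eq: "pairing t k z / z = ?q 0 z + ?q (- (pi / 2)) z" if "z \<in> {0..H}" for z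
    unfolding pairing_def fourier_mode[OF slice(1)[OF t that]] fourier_mode[OF slice(3)[OF t that]]
    by (simp add: add_divide_distrib)
  have "(\<lambda>z. ?q 0 z + ?q (- (pi / 2)) z) integrable_on {0..H}"
    by (intro integrable_add int)
  then show "(\<lambda>z. pairing t k z / z) integrable_on {0..H}"
    by (rule integrable_eq) (simp add: eq)
  have "mode_flux t k = integral {0..H} (\<lambda>z. ?q 0 z + ?q (- (pi / 2)) z)"
    unfolding mode_flux_def by (rule integral_cong) (rule eq)
  also have "\<dots> = integral {0..H} (?q 0) + integral {0..H} (?q (- (pi / 2)))"
    by (intro integral_add int)
  finally show "mode_flux t k = integral {0..H} (?q 0) + integral {0..H} (?q (- (pi / 2)))" .
qed

lemma mode_estimates:
  assumes t: "0 \<le> t" and z: "0 < z" "z < H" and k: "k \<in> dual_lattice \<Lambda>"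
  shows "(cmod (fourier \<Lambda> (\<lambda>y. w t y z) k))\<^sup>2 \<le> z ^ 4 * ln (H / z) * ((norm k)\<^sup>2 * mode_flux t k)"
    and "(cmod (fourier \<Lambda> (\<lambda>y. dz H w t y z) k))\<^sup>2 \<le> 10 * z\<^sup>2 * ln (H / z) * ((norm k)\<^sup>2 * mode_flux t k)"
    and "(cmod (fourier \<Lambda> (\<lambda>y. w t y z) k))\<^sup>2 \<le> z\<^sup>2 * (H * integral {0..H} (\<lambda>s. (cmod (fourier \<Lambda> (\<lambda>y. T t y s) k))\<^sup>2 / 2))"
proof -
  let ?m = "\<lambda>\<theta> f z. mode \<Lambda> k \<theta> (\<lambda>y. f t y z)"
  let ?I = "\<lambda>\<theta>. integral {0..H} (\<lambda>z. ?m \<theta> T z * ?m \<theta> w z / z)"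
  let ?J = "\<lambda>\<theta>. integral {0..H} (\<lambda>z. (?m \<theta> T z)\<^sup>2 / 2)"
  have est: "(?m \<theta> w z)\<^sup>2 \<le> z ^ 4 * ln (H / z) * ((norm k)\<^sup>2 * ?I \<theta>)"
      "(?m \<theta> (dz H w) z)\<^sup>2 \<le> 10 * z\<^sup>2 * ln (H / z) * ((norm k)\<^sup>2 * ?I \<theta>)"
      "(?m \<theta> w z)\<^sup>2 \<le> z\<^sup>2 * (H * ?J \<theta>)" for \<theta>
  proof -
    interpret c: clamped_mode H "(norm k)\<^sup>2" "\<lambda>z. mode \<Lambda> k \<theta> (\<lambda>y. w t y z)" "\<lambda>z. mode \<Lambda> k \<theta> (\<lambda>y. dz H w t y z)"
      "\<lambda>z. mode \<Lambda> k \<theta> (\<lambda>y. dz H (dz H w) t y z)" "\<lambda>z. mode \<Lambda> k \<theta> (\<lambda>y. dz H (dz H (dz H w)) t y z)"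
      "\<lambda>z. mode \<Lambda> k \<theta> (\<lambda>y. dz H (dz H (dz H (dz H w))) t y z)" "\<lambda>z. mode \<Lambda> k \<theta> (\<lambda>y. T t y z)"
      by (rule mode_clamped[OF k t])
    show "(?m \<theta> w z)\<^sup>2 \<le> z ^ 4 * ln (H / z) * ((norm k)\<^sup>2 * ?I \<theta>)"
      "(?m \<theta> (dz H w) z)\<^sup>2 \<le> 10 * z\<^sup>2 * ln (H / z) * ((norm k)\<^sup>2 * ?I \<theta>)"
      "(?m \<theta> w z)\<^sup>2 \<le> z\<^sup>2 * (H * ?J \<theta>)"
      using c.weighted_bound[OF z] c.displacement_sq_le[OF z] by auto
  qed
  have z': "z \<in> {0..H}" using z by simp
  note flux_eq = pairing_integrable(2)[OF t k]
  show "(cmod (fourier \<Lambda> (\<lambda>y. w t y z) k))\<^sup>2 \<le> z ^ 4 * ln (H / z) * ((norm k)\<^sup>2 * mode_flux t k)"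
    unfolding fourier_sq[OF w_derivatives(1) t z'] flux_eq
    using add_mono[OF est(1)[of 0] est(1)[of "- (pi / 2)"]] by (simp add: distrib_left)
  show "(cmod (fourier \<Lambda> (\<lambda>y. dz H w t y z) k))\<^sup>2 \<le> 10 * z\<^sup>2 * ln (H / z) * ((norm k)\<^sup>2 * mode_flux t k)"
    unfolding fourier_sq[OF w_derivatives(2) t z'] flux_eq
    using add_mono[OF est(2)[of 0] est(2)[of "- (pi / 2)"]] by (simp add: distrib_left)
  have int: "(\<lambda>z. (?m \<theta> T z)\<^sup>2 / 2) integrable_on {0..H}" for \<theta>
    by (intro integrable_continuous_interval continuous_intros continuous_mode[OF T_smooth t]) simp
  have "integral {0..H} (\<lambda>s. (cmod (fourier \<Lambda> (\<lambda>y. T t y s) k))\<^sup>2 / 2) = integral {0..H} (\<lambda>z. (?m 0 T z)\<^sup>2 / 2 + (?m (- (pi / 2)) T z)\<^sup>2 / 2)"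
    by (rule integral_cong) (simp add: fourier_sq[OF T_smooth t] add_divide_distrib)
  also have "\<dots> = ?J 0 + ?J (- (pi / 2))"
    by (intro integral_add int)
  finally show "(cmod (fourier \<Lambda> (\<lambda>y. w t y z) k))\<^sup>2 \<le> z\<^sup>2 * (H * integral {0..H} (\<lambda>s. (cmod (fourier \<Lambda> (\<lambda>y. T t y s) k))\<^sup>2 / 2))"
    unfolding fourier_sq[OF w_derivatives(1) t z']
    using add_mono[OF est(3)[of 0] est(3)[of "- (pi / 2)"]] by (simp add: distrib_left)
qed

text \<open>
A bound for the rescaled flux \<open>flux t z / z\<close> that is uniform in time and height.
\<close>

definition flux_bound :: real where
  "flux_bound = (M\<^sup>2 + H\<^sup>2 * M\<^sup>2) / 2"

lemma T_sq_avg_le: "0 \<le> t \<Longrightarrow> z \<in> {0..H} \<Longrightarrow> cell_avg \<Lambda> (\<lambda>y. (T t y z)\<^sup>2) \<le> M\<^sup>2"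
proof -
  assume t: "0 \<le> t" "z \<in> {0..H}"
  have "cell_avg \<Lambda> (\<lambda>y. (T t y z)\<^sup>2) \<le> cell_avg \<Lambda> (\<lambda>y::real^'n. M\<^sup>2)"
  proof (rule cell_avg_mono[OF \<Lambda>])
    fix y
    have "\<bar>T t y z\<bar>\<^sup>2 \<le> M\<^sup>2" by (rule power_mono[OF T_bound[OF t]]) simp
    then show "(T t y z)\<^sup>2 \<le> M\<^sup>2" by simp
  qed (intro continuous_intros slice t)+
  then show ?thesis using \<Lambda> by simp
qed

lemma fourier_T_sq_integrable:
  assumes t: "0 \<le> t"
  shows "(\<lambda>s. (cmod (fourier \<Lambda> (\<lambda>y. T t y s) k))\<^sup>2 / 2) integrable_on {0..H}"
proof (rule integrable_continuous_interval)
  have "continuous_on {0..H} (\<lambda>s. ((mode \<Lambda> k 0 (\<lambda>y. T t y s))\<^sup>2 + (mode \<Lambda> k (- (pi / 2)) (\<lambda>y. T t y s))\<^sup>2) / 2)"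
    by (intro continuous_intros continuous_mode[OF T_smooth t]) simp
  then show "continuous_on {0..H} (\<lambda>s. (cmod (fourier \<Lambda> (\<lambda>y. T t y s) k))\<^sup>2 / 2)"
    by (rule continuous_on_eq) (simp add: fourier_sq[OF T_smooth t])
qed

text \<open>
By Young's inequality it suffices to bound the mean squares of \<open>T\<close> and of \<open>w / z\<close>. The former is at most
\<open>M\<^sup>2\<close> by Bessel's inequality, and so is, by the energy estimate in each mode, the latter up to a factor \<open>H\<^sup>2\<close>.
The bound does not depend on the set of modes, so it serves for the partial sums as for their limit.
\<close>

lemma pairing_sum_abs_le:
  assumes t: "0 \<le> t" and z: "0 < z" "z < H" and F: "finite F" "F \<subseteq> dual_lattice \<Lambda>"
  shows "\<bar>\<Sum>k\<in>F. pairing t k z / z\<bar> \<le> flux_bound"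
proof -
  let ?T = "\<lambda>k. fourier \<Lambda> (\<lambda>y. T t y z) k" and ?w = "\<lambda>k. fourier \<Lambda> (\<lambda>y. w t y z) k"
  have z': "z \<in> {0..H}" using z by simp
  have "\<bar>\<Sum>k\<in>F. pairing t k z / z\<bar> \<le> (\<Sum>k\<in>F. \<bar>pairing t k z / z\<bar>)" by (rule sum_abs)
  also have "\<dots> \<le> (\<Sum>k\<in>F. ((cmod (?T k))\<^sup>2 + (cmod (?w k))\<^sup>2 / z\<^sup>2) / 2)"
  proof (rule sum_mono)
    fix k
    have young: "\<bar>x * y\<bar> \<le> (x\<^sup>2 + y\<^sup>2) / 2" for x y :: real
      using sum_squares_bound[of "\<bar>x\<bar>" "\<bar>y\<bar>"] by (simp add: abs_mult)
    have "\<bar>pairing t k z / z\<bar> \<le> \<bar>Re (?T k) * (Re (?w k) / z)\<bar> + \<bar>Im (?T k) * (Im (?w k) / z)\<bar>"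
    proof -
      have "pairing t k z / z = Re (?T k) * (Re (?w k) / z) + Im (?T k) * (Im (?w k) / z)"
        unfolding pairing_def by (simp add: add_divide_distrib)
      then show ?thesis by (simp only: abs_triangle_ineq)
    qed
    also have "\<dots> \<le> ((cmod (?T k))\<^sup>2 + (cmod (?w k))\<^sup>2 / z\<^sup>2) / 2"
      using young[of "Re (?T k)" "Re (?w k) / z"] young[of "Im (?T k)" "Im (?w k) / z"]
      unfolding cmod_power2 by (simp add: power_divide add_divide_distrib)
    finally show "\<bar>pairing t k z / z\<bar> \<le> ((cmod (?T k))\<^sup>2 + (cmod (?w k))\<^sup>2 / z\<^sup>2) / 2" .
  qed
  also have "\<dots> = ((\<Sum>k\<in>F. (cmod (?T k))\<^sup>2) + (\<Sum>k\<in>F. (cmod (?w k))\<^sup>2) / z\<^sup>2) / 2"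
    by (simp add: sum.distrib flip: sum_divide_distrib)
  also have "\<dots> \<le> flux_bound"
  proof -
    have Tle: "(\<Sum>k\<in>F. (cmod (fourier \<Lambda> (\<lambda>y. T t y s) k))\<^sup>2) \<le> M\<^sup>2" if "s \<in> {0..H}" for s
      using bessel[OF slice(3)[OF t that] \<Lambda> F] T_sq_avg_le[OF t that] by simp
    have "(\<Sum>k\<in>F. (cmod (?w k))\<^sup>2) \<le> (\<Sum>k\<in>F. z\<^sup>2 * (H * integral {0..H} (\<lambda>s. (cmod (fourier \<Lambda> (\<lambda>y. T t y s) k))\<^sup>2 / 2)))"
      using F by (intro sum_mono mode_estimates t z) auto
    also have "\<dots> = z\<^sup>2 * (H * integral {0..H} (\<lambda>s. \<Sum>k\<in>F. (cmod (fourier \<Lambda> (\<lambda>y. T t y s) k))\<^sup>2 / 2))"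
      using F by (simp add: integral_sum fourier_T_sq_integrable[OF t] sum_distrib_left)
    also have "\<dots> \<le> z\<^sup>2 * (H * integral {0..H} (\<lambda>s. M\<^sup>2))"
    proof (intro mult_left_mono integral_le)
      show "(\<lambda>s. \<Sum>k\<in>F. (cmod (fourier \<Lambda> (\<lambda>y. T t y s) k))\<^sup>2 / 2) integrable_on {0..H}"
        using F by (intro integrable_sum fourier_T_sq_integrable t)
      show "(\<Sum>k\<in>F. (cmod (fourier \<Lambda> (\<lambda>y. T t y s) k))\<^sup>2 / 2) \<le> M\<^sup>2" if "s \<in> {0..H}" for s
        using Tle[OF that] zero_le_power2[of M] unfolding sum_divide_distrib[symmetric] by linarith
    qed (use H in auto)
    also have "\<dots> = z\<^sup>2 * (H\<^sup>2 * M\<^sup>2)" using H by (simp add: power2_eq_square)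
    finally have "(\<Sum>k\<in>F. (cmod (?w k))\<^sup>2) / z\<^sup>2 \<le> H\<^sup>2 * M\<^sup>2"
      using z by (simp add: pos_divide_le_eq mult.commute)
    with Tle[OF z'] show ?thesis unfolding flux_bound_def by (intro divide_right_mono add_mono) auto
  qed
  finally show ?thesis .
qed

lemma flux_abs_le:
  assumes t: "0 \<le> t" and z: "0 < z" "z < H"
  shows "\<bar>flux t z / z\<bar> \<le> flux_bound"
proof -
  have z': "z \<in> {0..H}" using z by simp
  note sums = has_sum_divide_const[OF pairing_sums[OF t z'], of z]
  have "flux t z / z \<le> flux_bound"
    by (rule has_sum_le_finite_sums[OF sums]) (use pairing_sum_abs_le[OF t z] in \<open>auto simp: abs_le_iff\<close>)
  moreover have "- (flux t z / z) \<le> flux_bound"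
    by (rule has_sum_le_finite_sums[OF has_sum_uminusI[OF sums]])
       (use pairing_sum_abs_le[OF t z] in \<open>auto simp: abs_le_iff sum_negf\<close>)
  ultimately show ?thesis by linarith
qed

text \<open>
For \<open>k \<noteq> 0\<close> this is read off from the weighted estimate at any one height. For \<open>k = 0\<close> the same estimate
says that the mode of \<open>w\<close> vanishes.
\<close>

lemma mode_flux_nonneg:
  assumes t: "0 \<le> t" and k: "k \<in> dual_lattice \<Lambda>"
  shows "0 \<le> mode_flux t k"
proof (cases "k = 0")
  case True
  have "pairing t k z / z = 0" if "z \<in> {0..H}" for z
  proof (cases "z = 0 \<or> z = H")
    case True
    then have "w t y z = 0" for y using bc[OF t] by auto
    then show ?thesis by (simp add: pairing_def fourier_def)
  next
    case False
    then have "(cmod (fourier \<Lambda> (\<lambda>y. w t y z) k))\<^sup>2 \<le> 0"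
      using mode_estimates(1)[OF t _ _ k, of z] that \<open>k = 0\<close> by simp
    then show ?thesis by (simp add: pairing_def)
  qed
  then have "mode_flux t k = integral {0..H} (\<lambda>z. 0)"
    unfolding mode_flux_def by (intro integral_cong)
  then show ?thesis by simp
next
  case False
  define z where "z = H / 2"
  have z: "0 < z" "z < H" using H by (simp_all add: z_def)
  have "0 \<le> z ^ 4 * ln (H / z) * ((norm k)\<^sup>2 * mode_flux t k)"
    by (rule order_trans[OF _ mode_estimates(1)[OF t z k]]) simp
  moreover have "0 < z ^ 4 * ln (H / z) * (norm k)\<^sup>2" using z False by simp
  ultimately show ?thesis
    unfolding mult.assoc[symmetric] by (simp only: zero_le_mult_iff) auto
qed

text \<open>
Parseval at each height and dominated convergence in the height give \<open>total_flux t\<close> as the sum of all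
\<open>mode_flux t k\<close>; dropping nonnegative terms leaves the inequality.
\<close>

lemma flux_integrable:
  assumes t: "0 \<le> t"
  shows "(\<lambda>z. flux t z / z) integrable_on {0..H}"
    and "finite F \<Longrightarrow> F \<subseteq> dual_lattice \<Lambda> \<Longrightarrow> (\<Sum>k\<in>F. mode_flux t k) \<le> total_flux t"
proof -
  define S where "S n = from_nat_into (dual_lattice \<Lambda> :: (real^'n) set) ` {..n}" for n
  have "(dual_lattice \<Lambda> :: (real^'n) set) \<noteq> {}" using dual_lattice_0 by blast
  note exhaust = filterlim_exhaust_countable[OF countable_dual_lattice this, folded S_def]
  have S: "finite (S n)" "S n \<subseteq> dual_lattice \<Lambda>" for n
    using from_nat_into[OF \<open>dual_lattice \<Lambda> \<noteq> {}\<close>] by (auto simp: S_def)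
  have int: "(\<lambda>z. \<Sum>k\<in>G. pairing t k z / z) integrable_on {0..H}" if "finite G" "G \<subseteq> dual_lattice \<Lambda>" for G
    using that pairing_integrable(1)[OF t] by (intro integrable_sum) auto
  have "0 \<le> flux_bound" by (simp add: flux_bound_def)
  have dom: "norm (\<Sum>k\<in>S n. pairing t k z / z) \<le> flux_bound" if "z \<in> {0..H}" for n z
  proof (cases "z = 0 \<or> z = H")
    case True
    then have "w t y z = 0" for y using bc[OF t] by auto
    then show ?thesis using \<open>0 \<le> flux_bound\<close> by (simp add: pairing_def fourier_def)
  next
    case False
    then show ?thesis using pairing_sum_abs_le[OF t _ _ S, of z n] that by simp
  qed
  have lim: "(\<lambda>n. \<Sum>k\<in>S n. pairing t k z / z) \<longlonglongrightarrow> flux t z / z" if "z \<in> {0..H}" for z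
    using has_sum_divide_const[OF pairing_sums[OF t that], of z] exhaust
    unfolding has_sum_def by (rule filterlim_compose)
  note dct = dominated_convergence[where h="\<lambda>_. flux_bound" and f="\<lambda>n z. \<Sum>k\<in>S n. pairing t k z / z",
      OF int[OF S] integrable_const_ivl dom lim]
  show "(\<lambda>z. flux t z / z) integrable_on {0..H}" by (rule dct(1))
  have sum_eq: "integral {0..H} (\<lambda>z. \<Sum>k\<in>G. pairing t k z / z) = (\<Sum>k\<in>G. mode_flux t k)"
    if "finite G" "G \<subseteq> dual_lattice \<Lambda>" for G
    unfolding mode_flux_def using that pairing_integrable(1)[OF t] by (intro integral_sum) auto
  have lim_sum: "(\<lambda>n. \<Sum>k\<in>S n. mode_flux t k) \<longlonglongrightarrow> total_flux t"
    using dct(2) unfolding total_flux_def by (simp add: sum_eq[OF S])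
  assume F: "finite F" "F \<subseteq> dual_lattice \<Lambda>"
  have "eventually (\<lambda>n. F \<subseteq> S n) sequentially"
    using exhaust[unfolded filterlim_finite_subsets_at_top, rule_format, of F] F
    by (auto elim: eventually_mono)
  then have "eventually (\<lambda>n. (\<Sum>k\<in>F. mode_flux t k) \<le> (\<Sum>k\<in>S n. mode_flux t k)) sequentially"
    by eventually_elim (use S mode_flux_nonneg[OF t] in \<open>auto intro!: sum_mono2 dest: subsetD[OF S(2)]\<close>)
  then show "(\<Sum>k\<in>F. mode_flux t k) \<le> total_flux t"
    by (rule tendsto_lowerbound[OF lim_sum]) simp
qed

lemma total_flux_nonneg: "0 \<le> t \<Longrightarrow> 0 \<le> total_flux t"
  using flux_integrable(2)[of t "{}"] by simp

text \<open>
The factor \<open>(norm k)\<^sup>2\<close> lost in the estimate for one mode is exactly the weight of the negative norm.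
\<close>

lemma inv_grad_sq_le:
  fixes f :: "real^'n \<Rightarrow> real"
  assumes t: "0 \<le> t" and C: "0 \<le> C"
    and le: "\<And>k. k \<in> dual_lattice \<Lambda> \<Longrightarrow> (cmod (fourier \<Lambda> f k))\<^sup>2 \<le> C * ((norm k)\<^sup>2 * mode_flux t k)"
  shows "inv_grad_sq \<Lambda> f \<le> C * total_flux t"
proof (cases "(\<lambda>k. (cmod (fourier \<Lambda> f k))\<^sup>2 / (norm k)\<^sup>2) summable_on (dual_lattice \<Lambda> - {0})")
  case True
  then show ?thesis unfolding inv_grad_sq_def
  proof (rule infsum_le_finite_sums)
    fix F :: "(real^'n) set" assume F: "finite F" "F \<subseteq> dual_lattice \<Lambda> - {0}"
    have "(\<Sum>k\<in>F. (cmod (fourier \<Lambda> f k))\<^sup>2 / (norm k)\<^sup>2) \<le> (\<Sum>k\<in>F. C * mode_flux t k)"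
    proof (rule sum_mono)
      fix k assume "k \<in> F"
      then have "k \<in> dual_lattice \<Lambda>" "0 < (norm k)\<^sup>2" using F by auto
      with le[of k] show "(cmod (fourier \<Lambda> f k))\<^sup>2 / (norm k)\<^sup>2 \<le> C * mode_flux t k"
        by (simp add: pos_divide_le_eq mult_ac)
    qed
    also have "\<dots> = C * (\<Sum>k\<in>F. mode_flux t k)" by (simp add: sum_distrib_left)
    also have "\<dots> \<le> C * total_flux t"
      using F by (intro mult_left_mono[OF _ C] flux_integrable(2)[OF t]) auto
    finally show "(\<Sum>k\<in>F. (cmod (fourier \<Lambda> f k))\<^sup>2 / (norm k)\<^sup>2) \<le> C * total_flux t" .
  qed
next
  case False
  then show ?thesis using C total_flux_nonneg[OF t] by (simp add: inv_grad_sq_def infsum_not_exists)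
qed

lemma inv_grad_sq_bounds:
  assumes t: "0 \<le> t" and z: "0 < z" "z < H"
  shows "inv_grad_sq \<Lambda> (\<lambda>y. w t y z) \<le> z ^ 4 * ln (H / z) * total_flux t"
    and "inv_grad_sq \<Lambda> (\<lambda>y. dz H w t y z) \<le> 10 * z\<^sup>2 * ln (H / z) * total_flux t"
  using z by (auto intro!: inv_grad_sq_le[OF t] mode_estimates[OF t z])

end

section \<open>Long-time averages\<close>

lemma Limsup_compose_le:
  fixes f :: "'a \<Rightarrow> 'b::complete_lattice"
  assumes "filterlim h G F"
  shows "Limsup F (\<lambda>x. f (h x)) \<le> Limsup G f"
  unfolding Limsup_def[of G]
proof (rule INF_greatest)
  fix P assume "P \<in> {P. eventually P G}"
  then have "eventually (\<lambda>x. P (h x)) F" using assms by (simp add: filterlim_iff)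
  then show "Limsup F (\<lambda>x. f (h x)) \<le> Sup (f ` Collect P)"
    unfolding Limsup_def by (intro INF_lower2[of "\<lambda>x. P (h x)"] SUP_mono) auto
qed

lemma time_mean_cong:
  assumes "\<And>t. 0 \<le> t \<Longrightarrow> f t = g t"
  shows "time_mean f = time_mean g"
proof -
  have "(LBINT t:{0..s}. f t) = (LBINT t:{0..s}. g t)" for s
    by (rule set_lebesgue_integral_cong) (use assms in auto)
  then show ?thesis by (simp add: time_mean_def)
qed

lemma set_integral_abs_le:
  fixes g :: "real \<Rightarrow> real"
  assumes "set_integrable lborel {a..b} g" "a \<le> b" "\<And>t. t \<in> {a..b} \<Longrightarrow> \<bar>g t\<bar> \<le> B"
  shows "\<bar>LBINT t:{a..b}. g t\<bar> \<le> B * (b - a)"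
proof -
  have "\<bar>LBINT t:{a..b}. g t\<bar> = \<bar>integral {a..b} g\<bar>"
    by (simp add: set_borel_integral_eq_integral[OF assms(1)])
  also have "\<dots> \<le> B * (b - a)"
  proof -
    have "0 \<le> B" using assms(3)[of a] assms(2) by simp
    then show ?thesis
      using has_integral_bound_real[of B "{}" g "integral {a..b} g" a b] assms(2,3)
        integrable_integral[OF set_borel_integral_eq_integral(1)[OF assms(1)]]
      by simp
  qed
  finally show ?thesis .
qed

text \<open>
For a bounded function the running averages at \<open>s\<close> and at \<open>\<lfloor>s\<rfloor>\<close> differ by at most \<open>2 B / s\<close>. Passing to integer
times makes the upper limit a countable one, which is needed for measurability in the height.
\<close>

lemma time_mean_eq_limsup:
  assumes int: "\<And>a b. 0 \<le> a \<Longrightarrow> set_integrable lborel {a..b} g" and bound: "\<And>t. 0 \<le> t \<Longrightarrow> \<bar>g t\<bar> \<le> B"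
  shows "time_mean g = limsup (\<lambda>n. ereal ((LBINT t:{0..real n}. g t) / real n))"
proof -
  define A where "A s = (LBINT t:{0..s}. g t) / s" for s
  define N where "N s = nat \<lfloor>s\<rfloor>" for s :: real
  have B: "0 \<le> B" using bound[of 0] by simp
  have N: "filterlim N sequentially at_top"
    unfolding N_def by (intro filterlim_compose[OF filterlim_nat_sequentially filterlim_floor_sequentially])
  have close: "A s \<le> A (real (N s)) + 2 * B / s" if s: "1 \<le> s" for s
  proof -
    define n where "n = real (N s)"
    have "n = of_int \<lfloor>s\<rfloor>" using s by (simp add: n_def N_def)
    then have n: "1 \<le> n" "n \<le> s" "s \<le> n + 1"
      using s floor_correct[of s] one_le_floor[of s] by auto
    have split: "(LBINT t:{0..s}. g t) = (LBINT t:{0..n}. g t) + (LBINT t:{n..s}. g t)"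
    proof -
      have "integral {0..s} g = integral {0..n} g + integral {n..s} g"
        using n set_borel_integral_eq_integral(1)[OF int[of 0 s]]
        by (simp add: Henstock_Kurzweil_Integration.integral_combine)
      then show ?thesis using n by (simp add: set_borel_integral_eq_integral int)
    qed
    have rest: "\<bar>LBINT t:{n..s}. g t\<bar> \<le> B * (s - n)" and main: "\<bar>LBINT t:{0..n}. g t\<bar> \<le> B * n"
      using set_integral_abs_le[OF int, of n s B] set_integral_abs_le[OF int, of 0 n B] n bound by auto
    have "s * A s = n * A n + (LBINT t:{n..s}. g t)"
      using split s n by (simp add: A_def)
    then have "s * (A s - A n) = (LBINT t:{n..s}. g t) - (s - n) * A n" by (simp add: algebra_simps)
    moreover have "\<bar>A n\<bar> \<le> B" using main n by (simp add: A_def pos_divide_le_eq abs_divide)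
    then have "\<bar>(s - n) * A n\<bar> \<le> (s - n) * B"
      using n by (simp add: abs_mult mult_left_mono)
    moreover have "(s - n) * B \<le> B" using n B by (simp add: mult_left_le_one_le)
    ultimately have "s * (A s - A n) \<le> 2 * B" using rest by (simp add: mult.commute abs_le_iff)
    then have "A s - A n \<le> 2 * B / s" using s by (simp add: pos_le_divide_eq mult.commute)
    then show ?thesis by (simp add: n_def)
  qed
  show ?thesis
  proof (rule antisym)
    show "limsup (\<lambda>n. ereal ((LBINT t:{0..real n}. g t) / real n)) \<le> time_mean g"
      unfolding time_mean_def using Limsup_compose_le[OF filterlim_real_sequentially, of "\<lambda>s. ereal (A s)"]
      by (simp add: A_def)
    show "time_mean g \<le> limsup (\<lambda>n. ereal ((LBINT t:{0..real n}. g t) / real n))"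
    proof (rule ereal_le_epsilon2)
      fix e :: real assume e: "0 < e"
      have "eventually (\<lambda>s::real. 1 \<le> s \<and> 2 * B / e \<le> s) at_top"
        by (intro eventually_conj eventually_ge_at_top)
      then have "eventually (\<lambda>s. ereal (A s) \<le> ereal (A (real (N s))) + ereal e) at_top"
      proof eventually_elim
        case (elim s)
        then have "2 * B / s \<le> e" using e by (simp add: field_simps)
        with close[of s] elim show ?case by simp
      qed
      then have "Limsup at_top (\<lambda>s. ereal (A s)) \<le> Limsup at_top (\<lambda>s. ereal (A (real (N s))) + ereal e)"
        by (rule Limsup_mono)
      also have "\<dots> = Limsup at_top (\<lambda>s. ereal (A (real (N s)))) + ereal e"
        by (rule Limsup_add_ereal_right) auto
      also have "\<dots> \<le> limsup (\<lambda>n. ereal (A (real n))) + ereal e"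
        by (intro add_right_mono Limsup_compose_le[OF N])
      finally show "time_mean g \<le> limsup (\<lambda>n. ereal ((LBINT t:{0..real n}. g t) / real n)) + ereal e"
        by (simp add: time_mean_def A_def)
    qed
  qed
qed

lemma bounded_limsup_real:
  assumes "\<And>n. \<bar>x n\<bar> \<le> (B::real)"
  shows "ereal (real_of_ereal (limsup (\<lambda>n. ereal (x n)))) = limsup (\<lambda>n. ereal (x n))"
proof -
  have "limsup (\<lambda>n. ereal (x n)) \<le> ereal B"
    by (intro Limsup_bounded always_eventually) (use assms in \<open>auto simp: abs_le_iff\<close>)
  moreover have "ereal (- B) \<le> limsup (\<lambda>n. ereal (x n))"
    by (intro le_Limsup always_eventually) (use assms in \<open>auto simp: abs_le_iff minus_le_iff\<close>)
  ultimately show ?thesis by (intro ereal_real') auto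
qed

text \<open>
The suprema of the tails decrease pointwise to the upper limit, so dominated convergence applies to them.
\<close>

lemma reverse_fatou:
  fixes f :: "nat \<Rightarrow> 'a \<Rightarrow> real"
  assumes meas: "\<And>n. f n \<in> borel_measurable M" and h: "integrable M h"
    and dom: "\<And>n x. \<bar>f n x\<bar> \<le> h x"
  shows "limsup (\<lambda>n. ereal (\<integral>x. f n x \<partial>M)) \<le> ereal (\<integral>x. real_of_ereal (limsup (\<lambda>n. ereal (f n x))) \<partial>M)"
proof -
  define S where "S m x = (SUP n\<in>{m..}. ereal (f n x))" for m x
  define u where "u x = real_of_ereal (limsup (\<lambda>n. ereal (f n x)))" for x
  have S_le: "S m x \<le> ereal (h x)" for m x
    unfolding S_def by (rule SUP_least) (use dom in \<open>auto simp: abs_le_iff\<close>)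
  have f_le: "ereal (f n x) \<le> S m x" if "m \<le> n" for m n x
    unfolding S_def using that by (intro SUP_upper) auto
  have S_ge: "ereal (- h x) \<le> S m x" for m x
  proof -
    have "- h x \<le> f m x" using dom[of m x] by linarith
    then show ?thesis using f_le[of m m x] by (meson ereal_less_eq(3) order_refl order_trans)
  qed
  have S_abs: "ereal (real_of_ereal (S m x)) = S m x \<and> \<bar>real_of_ereal (S m x)\<bar> \<le> h x" for m x
    using S_le[of m x] S_ge[of x m] by (cases "S m x") (auto simp: abs_le_iff)
  have S_meas: "(\<lambda>x. real_of_ereal (S m x)) \<in> borel_measurable M" for m
    unfolding S_def using meas by measurable
  have "(\<lambda>m. S m x) \<longlonglongrightarrow> limsup (\<lambda>n. ereal (f n x))" for x
    unfolding limsup_INF_SUP S_def by (rule LIMSEQ_INF) (auto simp: decseq_def intro!: SUP_subset_mono)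
  then have lim: "(\<lambda>m. real_of_ereal (S m x)) \<longlonglongrightarrow> u x" for x
    using bounded_limsup_real[of "\<lambda>n. f n x" "h x"] dom unfolding u_def
    by (intro lim_real_of_ereal) simp
  have f_int: "integrable M (f n)" for n
    by (rule Bochner_Integration.integrable_bound[OF h meas]) (use dom in \<open>auto intro!: AE_I2 order_trans[OF _ abs_ge_self]\<close>)
  have S_int: "integrable M (\<lambda>x. real_of_ereal (S m x))" for m
    by (rule Bochner_Integration.integrable_bound[OF h S_meas]) (use S_abs in \<open>auto intro!: AE_I2 order_trans[OF _ abs_ge_self]\<close>)
  have u_meas: "u \<in> borel_measurable M"
    by (rule borel_measurable_LIMSEQ_real[OF lim S_meas])
  have "(\<lambda>m. \<integral>x. real_of_ereal (S m x) \<partial>M) \<longlonglongrightarrow> (\<integral>x. u x \<partial>M)"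
    by (rule integral_dominated_convergence[OF u_meas S_meas h]) (use lim S_abs in auto)
  then have limS: "(\<lambda>m. ereal (\<integral>x. real_of_ereal (S m x) \<partial>M)) \<longlonglongrightarrow> ereal (\<integral>x. u x \<partial>M)"
    by simp
  have boundS: "limsup (\<lambda>n. ereal (\<integral>x. f n x \<partial>M)) \<le> ereal (\<integral>x. real_of_ereal (S m x) \<partial>M)" for m
  proof (rule Limsup_bounded)
    have "(\<integral>x. f n x \<partial>M) \<le> (\<integral>x. real_of_ereal (S m x) \<partial>M)" if "m \<le> n" for n
    proof (rule integral_mono[OF f_int S_int])
      show "f n x \<le> real_of_ereal (S m x)" for x
        using f_le[OF that, of x] S_abs[of m x] by (metis ereal_less_eq(3))
    qed
    then show "\<forall>\<^sub>F n in sequentially. ereal (\<integral>x. f n x \<partial>M) \<le> ereal (\<integral>x. real_of_ereal (S m x) \<partial>M)"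
      by (intro eventually_sequentiallyI[of m]) simp
  qed
  show ?thesis
    using LIMSEQ_le_const[OF limS] boundS unfolding u_def by blast
qed

text \<open>
The integral of a nonintegrable \<open>f\<close> is \<open>0\<close> by convention and therefore still below that of the
nonnegative function \<open>K * g\<close>.
\<close>

lemma time_mean_le:
  assumes g: "\<And>s. set_integrable lborel {0..s} g" "\<And>t. 0 \<le> t \<Longrightarrow> 0 \<le> g t"
    and K: "0 \<le> K" and le: "\<And>t. 0 \<le> t \<Longrightarrow> f t \<le> K * g t" and Q: "time_mean g \<le> ereal Q"
  shows "time_mean f \<le> ereal (K * Q)"
proof -
  have "eventually (\<lambda>s. ereal ((LBINT t:{0..s}. f t) / s) \<le> ereal K * ereal ((LBINT t:{0..s}. g t) / s)) at_top"
    using eventually_gt_at_top[of 0]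
  proof eventually_elim
    case (elim s)
    have "(LBINT t:{0..s}. f t) \<le> (LBINT t:{0..s}. K * g t)"
      unfolding set_lebesgue_integral_def
    proof (rule integral_mono')
      show "integrable lborel (\<lambda>t. indicator {0..s} t *\<^sub>R (K * g t))"
        using set_integrable_mult_right[OF g(1)[of s], of K] by (simp add: set_integrable_def)
    qed (use g K le in \<open>auto simp: indicator_def\<close>)
    also have "\<dots> = K * (LBINT t:{0..s}. g t)" by simp
    finally have "(LBINT t:{0..s}. f t) / s \<le> K * (LBINT t:{0..s}. g t) / s"
      using elim by (intro divide_right_mono) auto
    then show ?case by simp
  qed
  then have "time_mean f \<le> Limsup at_top (\<lambda>s. ereal K * ereal ((LBINT t:{0..s}. g t) / s))"
    unfolding time_mean_def by (rule Limsup_mono)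
  also have "\<dots> = ereal K * time_mean g"
    unfolding time_mean_def by (rule Limsup_ereal_mult_left) (use K in auto)
  also have "\<dots> \<le> ereal K * ereal Q"
    using K Q by (intro ereal_mult_left_mono) auto
  finally show ?thesis by simp
qed

lemma time_mean_nonneg:
  assumes "\<And>t. 0 \<le> t \<Longrightarrow> 0 \<le> g t"
  shows "0 \<le> time_mean g"
  unfolding time_mean_def
proof (rule le_Limsup)
  show "\<forall>\<^sub>F s in at_top. 0 \<le> ereal ((LBINT t:{0..s}. g t) / s)"
    using eventually_gt_at_top[of 0]
  proof eventually_elim
    case (elim s)
    have "0 \<le> (LBINT t:{0..s}. g t)"
      unfolding set_lebesgue_integral_def using assms by (auto intro!: integral_nonneg_AE simp: indicator_def)
    then show ?case using elim by simp
  qed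
qed simp

context plate
begin

lemma flux_continuous: "continuous_on ({0..} \<times> {0..H}) (\<lambda>(t, z). flux t z)"
proof -
  have slab: "continuous_on (({0..} \<times> {0..H}) \<times> cbox 0 (\<chi> i. \<Lambda>)) (\<lambda>x. f (fst (fst x)) (snd x) (snd (fst x)))"
    if "C_slab m H f" for m and f :: "'n field_fun"
  proof -
    have "continuous_on (({0..} \<times> {0..H}) \<times> cbox 0 (\<chi> i. \<Lambda>))
        (\<lambda>x. (\<lambda>(t, y, z). f t y z) (fst (fst x), snd x, snd (fst x)))"
      by (rule continuous_on_compose2[OF C_slab_continuous[OF that]]) (auto intro!: continuous_intros)
    then show ?thesis by simp
  qed
  have "continuous_on ({0..} \<times> {0..H}) (\<lambda>p. integral (cbox 0 (\<chi> i. \<Lambda>)) (\<lambda>y. T (fst p) y (snd p) * w (fst p) y (snd p)))"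
    by (rule integral_continuous_on_param) (auto simp: split_beta intro!: continuous_on_mult slab[OF T] slab[OF w])
  then show ?thesis
    by (simp add: flux_def cell_avg_def split_beta continuous_on_mult_left)
qed

lemma flux_rescaled_continuous:
  "continuous_on ({0..} \<times> {0<..<H}) (\<lambda>p. flux (fst p) (snd p) / snd p)"
  by (intro continuous_intros continuous_on_subset[OF flux_continuous[unfolded split_beta]]) auto

lemma flux_measurable:
  "(\<lambda>p. indicator ({0..s} \<times> {0<..<H}) p *\<^sub>R (flux (fst p) (snd p) / snd p)) \<in> borel_measurable borel"
  by (rule borel_measurable_continuous_on_indicator)
     (auto intro!: borel_Times continuous_on_subset[OF flux_rescaled_continuous])

lemma flux_time_integrable:
  assumes "z \<in> {0..H}" "0 \<le> a"
  shows "set_integrable lborel {a..b} (\<lambda>t. flux t z)"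
proof -
  have "continuous_on {a..b} (\<lambda>t. (\<lambda>(t, z). flux t z) (t, z))"
    by (rule continuous_on_compose2[OF flux_continuous]) (use assms in \<open>auto intro!: continuous_intros\<close>)
  then show ?thesis
    unfolding set_integrable_def by (intro borel_integrable_compact) auto
qed

lemma mean_flux: "0 < z \<Longrightarrow> z < H \<Longrightarrow> mean \<Lambda> (\<lambda>t y. T t y z * w t y z) = time_mean (\<lambda>t. flux t z)"
  unfolding mean_def
proof (rule time_mean_cong)
  fix t :: real assume z: "0 < z" "z < H" and t: "0 \<le> t"
  then have "continuous_on UNIV (\<lambda>y. T t y z * w t y z)"
    by (intro continuous_on_mult slice) auto
  from cell_integral_eq[OF this]
  show "(LBINT y:cell \<Lambda>. T t y z * w t y z) / \<Lambda> ^ CARD('n) = flux t z"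
    by (simp add: flux_def cell_avg_def divide_inverse mult.commute)
qed

text \<open>
The rescaled flux, extended by \<open>0\<close> to all heights so that Fubini's theorem applies on the product of two
copies of \<^const>\<open>lborel\<close>.
\<close>

definition flux_density :: "real \<times> real \<Rightarrow> real" where
  "flux_density p = indicator {0<..<H} (snd p) * (flux (fst p) (snd p) / snd p)"

lemma flux_density_abs_le: "0 \<le> t \<Longrightarrow> \<bar>flux_density (t, z)\<bar> \<le> flux_bound * indicator {0<..<H} z"
  using flux_abs_le[of t z] by (auto simp: flux_density_def indicator_def)

lemma flux_density_integrable:
  "integrable (lborel \<Otimes>\<^sub>M lborel) (\<lambda>p. indicator {0..s} (fst p) * flux_density p)"
proof -
  let ?S = "{0..s} \<times> {0<..<H}"
  have eq: "indicator {0..s} (fst p) * flux_density p = indicator ?S p *\<^sub>R (flux (fst p) (snd p) / snd p)" for p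
    by (cases p) (simp add: flux_density_def indicator_def)
  have "emeasure lborel ?S < \<infinity>"
    by (rule emeasure_bounded_finite) (simp add: bounded_Times)
  then have "integrable lborel (\<lambda>p. flux_bound * indicator ?S p)"
    by (intro integrable_mult_right integrable_real_indicator) (auto intro!: borel_Times)
  then have "integrable lborel (\<lambda>p. indicator {0..s} (fst p) * flux_density p)"
  proof (rule Bochner_Integration.integrable_bound)
    show "(\<lambda>p. indicator {0..s} (fst p) * flux_density p) \<in> borel_measurable lborel"
      unfolding eq using flux_measurable by simp
    show "AE p in lborel. norm (indicator {0..s} (fst p) * flux_density p) \<le> norm (flux_bound * indicator ?S p)"
      unfolding eq using flux_abs_le by (auto simp: indicator_def flux_bound_def intro!: AE_I2 order_trans[OF _ abs_ge_self])
  qed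
  then show ?thesis by (simp only: lborel_prod)
qed

lemma flux_density_integrable_curried:
  "integrable (lborel \<Otimes>\<^sub>M lborel) (\<lambda>(t, z). indicator {0..s} t * flux_density (t, z))"
proof -
  have "(\<lambda>(t, z). indicator {0..s} t * flux_density (t, z)) = (\<lambda>p. indicator {0..s} (fst p) * flux_density p)"
    by (rule ext) (simp only: split_beta prod.collapse)
  then show ?thesis by (simp only: flux_density_integrable)
qed

lemma total_flux_eq_lebesgue:
  assumes t: "0 \<le> t"
  shows "total_flux t = (\<integral>z. flux_density (t, z) \<partial>lborel)"
proof -
  have "continuous_on {0<..<H} (\<lambda>z. (\<lambda>p. flux (fst p) (snd p) / snd p) (t, z))"
    by (rule continuous_on_compose2[OF flux_rescaled_continuous]) (use t in \<open>auto intro!: continuous_intros\<close>)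
  then have cont: "continuous_on {0<..<H} (\<lambda>z. flux t z / z)" by simp
  have "set_integrable lborel {0<..<H} (\<lambda>z. flux t z / z)"
    unfolding set_integrable_def
  proof (rule Bochner_Integration.integrable_bound)
    show "integrable lborel (\<lambda>z. flux_bound * indicator {0<..<H} z)"
      by (intro integrable_mult_right integrable_real_indicator) (auto simp: emeasure_lborel_Ioo H less_imp_le)
    show "(\<lambda>z. indicator {0<..<H} z *\<^sub>R (flux t z / z)) \<in> borel_measurable lborel"
      using borel_measurable_continuous_on_indicator[OF _ cont] by simp
    show "AE z in lborel. norm (indicator {0<..<H} z *\<^sub>R (flux t z / z)) \<le> norm (flux_bound * indicator {0<..<H} z)"
      using flux_abs_le[OF t] by (auto simp: indicator_def flux_bound_def intro!: AE_I2 order_trans[OF _ abs_ge_self])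
  qed
  then have "(LBINT z:{0<..<H}. flux t z / z) = integral {0<..<H} (\<lambda>z. flux t z / z)"
    by (rule set_borel_integral_eq_integral)
  also have "\<dots> = total_flux t"
    unfolding total_flux_def by (rule integral_open_interval_real[symmetric])
  finally show ?thesis by (simp add: set_lebesgue_integral_def flux_density_def)
qed

lemma total_flux_time_integral:
  shows "set_integrable lborel {0..s} total_flux"
    and "(LBINT t:{0..s}. total_flux t) = (\<integral>z. (\<integral>t. indicator {0..s} t * flux_density (t, z) \<partial>lborel) \<partial>lborel)"
proof -
  have eq: "indicator {0..s} t *\<^sub>R total_flux t = (\<integral>z. indicator {0..s} (fst (t, z)) * flux_density (t, z) \<partial>lborel)" for t
    by (cases "t \<in> {0..s}") (simp_all add: total_flux_eq_lebesgue)
  show "set_integrable lborel {0..s} total_flux"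
    unfolding set_integrable_def eq
    by (rule lborel_pair.integrable_fst'[OF flux_density_integrable])
  have "(LBINT t:{0..s}. total_flux t) = (\<integral>t. (\<integral>z. indicator {0..s} t * flux_density (t, z) \<partial>lborel) \<partial>lborel)"
    unfolding set_lebesgue_integral_def eq by simp
  also have "\<dots> = (\<integral>z. (\<integral>t. indicator {0..s} t * flux_density (t, z) \<partial>lborel) \<partial>lborel)"
    by (rule lborel_pair.Fubini_integral[OF flux_density_integrable_curried, symmetric])
  finally show "(LBINT t:{0..s}. total_flux t) = (\<integral>z. (\<integral>t. indicator {0..s} t * flux_density (t, z) \<partial>lborel) \<partial>lborel)" .
qed

lemma total_flux_abs_le: 
  assumes t: "0 \<le> t"
  shows "\<bar>total_flux t\<bar> \<le> flux_bound * H"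
proof -
  have "\<bar>total_flux t\<bar> \<le> (\<integral>z. \<bar>flux_density (t, z)\<bar> \<partial>lborel)"
    unfolding total_flux_eq_lebesgue[OF t] by (rule integral_abs_bound)
  also have "\<dots> \<le> (\<integral>z. flux_bound * indicator {0<..<H} z \<partial>lborel)"
  proof (rule integral_mono')
    show "integrable lborel (\<lambda>z. flux_bound * indicator {0<..<H} z)"
      by (intro integrable_mult_right integrable_real_indicator) (auto simp: emeasure_lborel_Ioo H less_imp_le)
  qed (use flux_density_abs_le[OF t] in \<open>auto simp: flux_bound_def\<close>)
  finally have "\<bar>total_flux t\<bar> \<le> (\<integral>z. flux_bound * indicator {0<..<H} z \<partial>lborel)" .
  then show ?thesis using H by simp
qed

definition averaged_density :: "nat \<Rightarrow> real \<Rightarrow> real" where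
  "averaged_density n z = (\<integral>t. indicator {0..real n} t * flux_density (t, z) \<partial>lborel) / real n"

lemma averaged_density_eq:
  "averaged_density n z = indicator {0<..<H} z * ((LBINT t:{0..real n}. flux t z) / real n) / z"
proof -
  have "(\<lambda>t. indicator {0..real n} t * flux_density (t, z)) = (\<lambda>t. (indicator {0<..<H} z / z) * (indicator {0..real n} t *\<^sub>R flux t z))"
    by (auto simp: flux_density_def fun_eq_iff)
  then show ?thesis by (simp add: averaged_density_def set_lebesgue_integral_def)
qed

lemma averaged_density_abs_le: "\<bar>averaged_density n z\<bar> \<le> flux_bound * indicator {0<..<H} z"
proof (cases "z \<in> {0<..<H} \<and> n \<noteq> 0")
  case True
  then have z: "0 < z" "z < H" "z \<in> {0..H}" by auto
  have "\<bar>flux t z\<bar> \<le> flux_bound * z" if "0 \<le> t" for t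
    using flux_abs_le[OF that z(1,2)] z by (simp add: abs_divide pos_divide_le_eq)
  then have "\<bar>LBINT t:{0..real n}. flux t z\<bar> \<le> (flux_bound * z) * (real n - 0)"
    by (intro set_integral_abs_le flux_time_integrable z) auto
  then show ?thesis
    using True z by (simp add: averaged_density_eq abs_divide abs_mult pos_divide_le_eq mult_ac)
next
  case False
  have "0 \<le> flux_bound" by (simp add: flux_bound_def)
  then show ?thesis using False by (auto simp: averaged_density_eq indicator_def)
qed

text \<open>
The time average of the height integral is at most the height integral of the time averages, although
both averages are upper limits: by the uniform bound on the rescaled flux the reverse Fatou lemma applies
to the averages over integer times, after exchanging the integrals over time and height.
\<close>

theorem time_mean_total_flux_le: "time_mean total_flux \<le> ereal (flux_integral H \<Lambda> T w)"
proof -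
  have "time_mean total_flux = limsup (\<lambda>n. ereal ((LBINT t:{0..real n}. total_flux t) / real n))"
  proof (rule time_mean_eq_limsup[OF _ total_flux_abs_le])
    show "set_integrable lborel {a..b} total_flux" if "0 \<le> a" for a b
      by (rule set_integrable_subset[OF total_flux_time_integral(1)[of b]]) (use that in auto)
  qed
  also have "\<dots> = limsup (\<lambda>n. ereal (\<integral>z. averaged_density n z \<partial>lborel))"
    by (simp add: total_flux_time_integral(2) averaged_density_def)
  also have "\<dots> \<le> ereal (\<integral>z. real_of_ereal (limsup (\<lambda>n. ereal (averaged_density n z))) \<partial>lborel)"
  proof (rule reverse_fatou)
    show "averaged_density n \<in> borel_measurable lborel" for n
    proof -
      have "integrable lborel (\<lambda>z. \<integral>t. indicator {0..real n} t * flux_density (t, z) \<partial>lborel)"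
        by (rule lborel_pair.integrable_snd[OF flux_density_integrable_curried])
      from borel_measurable_integrable[OF this]
      have "(\<lambda>z. (\<integral>t. indicator {0..real n} t * flux_density (t, z) \<partial>lborel) / real n) \<in> borel_measurable lborel"
        by (intro borel_measurable_divide) auto
      then show ?thesis unfolding averaged_density_def[abs_def] by simp
    qed
    show "integrable lborel (\<lambda>z. flux_bound * indicator {0<..<H} z)"
      by (intro integrable_mult_right integrable_real_indicator) (auto simp: emeasure_lborel_Ioo H less_imp_le)
  qed (rule averaged_density_abs_le)
  also have "(\<integral>z. real_of_ereal (limsup (\<lambda>n. ereal (averaged_density n z))) \<partial>lborel) = flux_integral H \<Lambda> T w"
    unfolding flux_integral_def set_lebesgue_integral_def
  proof (rule Bochner_Integration.integral_cong[OF refl])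
    fix z :: real
    show "real_of_ereal (limsup (\<lambda>n. ereal (averaged_density n z))) =
        indicator {0<..<H} z *\<^sub>R (real_of_ereal (mean \<Lambda> (\<lambda>t y. T t y z * w t y z)) / z)"
    proof (cases "0 < z \<and> z < H")
      case True
      then have z: "0 < z" "z < H" "z \<in> {0..H}" by auto
      let ?A = "\<lambda>n. (LBINT t:{0..real n}. flux t z) / real n"
      have tm: "time_mean (\<lambda>t. flux t z) = limsup (\<lambda>n. ereal (?A n))"
      proof (rule time_mean_eq_limsup)
        show "\<bar>flux t z\<bar> \<le> flux_bound * z" if "0 \<le> t" for t
          using flux_abs_le[OF that z(1,2)] z by (simp add: abs_divide pos_divide_le_eq)
      qed (rule flux_time_integrable[OF z(3)])
      have "limsup (\<lambda>n. ereal (averaged_density n z)) = limsup (\<lambda>n. ereal (1 / z) * ereal (?A n))"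
        using z by (simp add: averaged_density_eq mult.commute)
      also have "\<dots> = ereal (1 / z) * limsup (\<lambda>n. ereal (?A n))"
        by (rule Limsup_ereal_mult_left) (use z in auto)
      finally show ?thesis
        using z by (simp add: mean_flux tm)
    next
      case False
      then have "averaged_density n z = 0" for n by (auto simp: averaged_density_eq)
      then show ?thesis using False by (simp add: Limsup_const)
    qed
  qed
  finally show ?thesis .
qed

lemma flux_integral_nonneg: "0 \<le> flux_integral H \<Lambda> T w"
  using order_trans[OF time_mean_nonneg[OF total_flux_nonneg] time_mean_total_flux_le] by simp

lemma mean_inv_grad_sq_le:
  assumes "0 \<le> K" "\<And>t. 0 \<le> t \<Longrightarrow> inv_grad_sq \<Lambda> (f t) \<le> K * total_flux t"
  shows "mean_inv_grad_sq \<Lambda> f \<le> ereal (K * flux_integral H \<Lambda> T w)"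
  unfolding mean_inv_grad_sq_def
  by (rule time_mean_le[OF total_flux_time_integral(1) total_flux_nonneg assms time_mean_total_flux_le])

lemma pointwise_mean_bounds:
  assumes z: "0 < z" "z < H"
  shows "mean_inv_grad_sq \<Lambda> (\<lambda>t y. w t y z) \<le> ereal (z ^ 4 * ln (H / z) * flux_integral H \<Lambda> T w)"
    and "mean_inv_grad_sq \<Lambda> (\<lambda>t y. dz H w t y z) \<le> ereal (10 * z\<^sup>2 * ln (H / z) * flux_integral H \<Lambda> T w)"
  using z by (auto intro!: mean_inv_grad_sq_le inv_grad_sq_bounds)

end

section \<open>Integration in the height\<close>

text \<open>
Here \<open>b\<close> is the pointwise bound on the averaged negative norm and \<open>g\<close> the power of \<open>z\<close> to which the
quotient by the weight is reduced.
\<close>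

lemma weighted_integral_le:
  assumes A: "A \<subseteq> {0<..}" and ae: "A \<in> sets borel"
    and le: "\<And>z. z \<in> A \<Longrightarrow> mean_inv_grad_sq \<Lambda> (\<lambda>t y. f t y z) \<le> ereal (b z)" "\<And>z. z \<in> A \<Longrightarrow> 0 \<le> b z"
    and g: "\<And>z. z \<in> A \<Longrightarrow> b z / z powr p \<le> K * g z" "\<And>z. z \<in> A \<Longrightarrow> 0 \<le> g z" "0 \<le> K"
    and meas: "g \<in> borel_measurable borel" and int: "(g has_integral J) A"
  shows "weighted_integral A p \<Lambda> f \<le> ennreal (K * J)"
proof -
  have "weighted_integral A p \<Lambda> f \<le> (\<integral>\<^sup>+ z\<in>A. ennreal (K * g z) \<partial>lborel)"
    unfolding weighted_integral_def
  proof (rule nn_integral_mono)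
    fix z
    show "e2ennreal (mean_inv_grad_sq \<Lambda> (\<lambda>t y. f t y z)) / ennreal (z powr p) * indicator A z \<le> ennreal (K * g z) * indicator A z"
    proof (cases "z \<in> A")
      case True
      then have z: "0 < z powr p" using A by auto
      have "e2ennreal (mean_inv_grad_sq \<Lambda> (\<lambda>t y. f t y z)) \<le> ennreal (b z)"
        using e2ennreal_mono[OF le(1)[OF True]] by (simp add: e2ennreal_ereal)
      then have "e2ennreal (mean_inv_grad_sq \<Lambda> (\<lambda>t y. f t y z)) / ennreal (z powr p) \<le> ennreal (b z) / ennreal (z powr p)"
        by (rule divide_right_mono_ennreal)
      also have "\<dots> = ennreal (b z / z powr p)" using le(2)[OF True] z by (simp add: divide_ennreal)
      also have "\<dots> \<le> ennreal (K * g z)" by (rule ennreal_leI[OF g(1)[OF True]])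
      finally show ?thesis using True by simp
    qed simp
  qed
  also have "\<dots> = (\<integral>\<^sup>+ z. ennreal (indicator A z * (K * g z)) \<partial>lborel)"
    by (rule nn_integral_cong) (simp add: indicator_def)
  also have "\<dots> = ennreal (K * J)"
  proof (rule nn_integral_has_integral_lborel)
    show "(\<lambda>z. indicator A z * (K * g z)) \<in> borel_measurable borel"
      using meas ae by measurable
    have "((\<lambda>z. if z \<in> A then K * g z else 0) has_integral K * J) UNIV"
      using has_integral_mult_right[OF int, of K] by (simp add: has_integral_restrict_UNIV)
    then show "((\<lambda>z. indicator A z * (K * g z)) has_integral K * J) UNIV"
      by (rule has_integral_eq[rotated]) (simp add: indicator_def)
  qed (use g in \<open>auto simp: indicator_def\<close>)
  finally show ?thesis .
qed

context plate
begin

lemma ln_ge_1: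
  assumes "0 < \<delta>" "\<delta> \<le> exp (- 1) * H"
  shows "1 \<le> ln (H / \<delta>)" "\<delta> < H"
proof -
  have "exp 1 * \<delta> \<le> exp 1 * (exp (- 1) * H)" using assms by (intro mult_left_mono) auto
  also have "\<dots> = H" by (simp flip: mult.assoc exp_add)
  finally have "exp 1 \<le> H / \<delta>" using assms by (simp add: pos_le_divide_eq)
  then show "1 \<le> ln (H / \<delta>)" by (simp add: ln_ge_iff assms H)
  have "exp (- 1) * H < 1 * H" using H by (intro mult_strict_right_mono) auto
  with assms show "\<delta> < H" by simp
qed

text \<open>
Since \<open>ln (H / z) = ln (H / \<delta>) + ln (\<delta> / z)\<close> is at most \<open>2 ln (H / \<delta>) \<delta> / z\<close> below height \<open>\<delta>\<close>, both integrands are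
dominated by multiples of \<open>\<delta> * z powr (\<alpha> - 2)\<close>, whose integral is \<open>\<delta> powr \<alpha> / (\<alpha> - 1)\<close>.
\<close>

lemma boundary_layer_estimate:
  assumes \<delta>: "0 < \<delta>" "\<delta> \<le> exp (- 1) * H" and \<alpha>: "1 < \<alpha>"
  shows "weighted_integral {0<..<\<delta>} (5 - \<alpha>) \<Lambda> w + weighted_integral {0<..<\<delta>} (3 - \<alpha>) \<Lambda> (dz H w)
    \<le> ennreal (22 * (\<delta> powr \<alpha> / (\<alpha> - 1)) * (ln (H / \<delta>))\<^sup>2 * flux_integral H \<Lambda> T w)"
proof -
  define L Q where "L = ln (H / \<delta>)" and "Q = flux_integral H \<Lambda> T w"
  have L: "1 \<le> L" "\<delta> < H" using ln_ge_1[OF \<delta>] by (simp_all add: L_def)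
  have Q: "0 \<le> Q" unfolding Q_def by (rule flux_integral_nonneg)
  let ?A = "{0<..<\<delta>}"
  have log: "ln (H / z) * z powr (\<alpha> - 1) \<le> 2 * L * \<delta> * z powr (\<alpha> - 2)" if z: "z \<in> ?A" for z
  proof -
    have "ln (H / z) = L + ln (\<delta> / z)"
      using z \<delta> H by (simp add: L_def ln_div)
    also have "ln (\<delta> / z) \<le> \<delta> / z" using ln_le_minus_one[of "\<delta> / z"] z by simp
    finally have "ln (H / z) \<le> L * 1 + 1 * (\<delta> / z)" by simp
    also have "\<dots> \<le> L * (\<delta> / z) + L * (\<delta> / z)"
      using L z \<delta> by (intro add_mono mult_left_mono mult_right_mono) (auto simp: pos_le_divide_eq)
    finally have "ln (H / z) \<le> 2 * L * \<delta> / z" by simp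
    then have "ln (H / z) * z powr (\<alpha> - 1) \<le> 2 * L * \<delta> / z * z powr (\<alpha> - 1)"
      by (rule mult_right_mono) simp
    also have "\<dots> = 2 * L * \<delta> * z powr (\<alpha> - 2)"
      using z powr_mult_base[of z "\<alpha> - 2"] by (simp add: field_simps)
    finally show ?thesis .
  qed
  have int: "((\<lambda>z. z powr (\<alpha> - 2)) has_integral (\<delta> powr (\<alpha> - 1) / (\<alpha> - 1))) ?A"
    using has_integral_powr_from_0[of "\<alpha> - 2" \<delta>] \<alpha> \<delta> by (simp add: has_integral_Icc_iff_Ioo)
  have pw: "z ^ 4 / z powr (5 - \<alpha>) = z powr (\<alpha> - 1)" "z\<^sup>2 / z powr (3 - \<alpha>) = z powr (\<alpha> - 1)" if "z \<in> ?A" for z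
    using that by (simp_all add: powr_diff[symmetric] flip: powr_numeral)
  have lnpos: "0 \<le> ln (H / z)" if "z \<in> ?A" for z using that L by simp
  have "weighted_integral ?A (5 - \<alpha>) \<Lambda> w \<le> ennreal (2 * L * \<delta> * Q * (\<delta> powr (\<alpha> - 1) / (\<alpha> - 1)))"
  proof (rule weighted_integral_le[OF _ _ _ _ _ _ _ _ int])
    fix z assume z: "z \<in> ?A"
    show "mean_inv_grad_sq \<Lambda> (\<lambda>t y. w t y z) \<le> ereal (z ^ 4 * ln (H / z) * Q)"
      unfolding Q_def by (rule pointwise_mean_bounds) (use z L in auto)
    have "z ^ 4 * ln (H / z) * Q / z powr (5 - \<alpha>) = (z ^ 4 / z powr (5 - \<alpha>)) * ln (H / z) * Q" by simp
    also have "\<dots> = (ln (H / z) * z powr (\<alpha> - 1)) * Q" unfolding pw(1)[OF z] by simp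
    also have "\<dots> \<le> (2 * L * \<delta> * z powr (\<alpha> - 2)) * Q" by (rule mult_right_mono[OF log[OF z] Q])
    finally show "z ^ 4 * ln (H / z) * Q / z powr (5 - \<alpha>) \<le> 2 * L * \<delta> * Q * z powr (\<alpha> - 2)" by (simp add: mult_ac)
    show "0 \<le> z ^ 4 * ln (H / z) * Q" using lnpos[OF z] Q by simp
  qed (use L \<delta> Q in auto)
  moreover have "weighted_integral ?A (3 - \<alpha>) \<Lambda> (dz H w) \<le> ennreal (20 * L * \<delta> * Q * (\<delta> powr (\<alpha> - 1) / (\<alpha> - 1)))"
  proof (rule weighted_integral_le[OF _ _ _ _ _ _ _ _ int])
    fix z assume z: "z \<in> ?A"
    show "mean_inv_grad_sq \<Lambda> (\<lambda>t y. dz H w t y z) \<le> ereal (10 * z\<^sup>2 * ln (H / z) * Q)"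
      unfolding Q_def by (rule pointwise_mean_bounds) (use z L in auto)
    have "10 * z\<^sup>2 * ln (H / z) * Q / z powr (3 - \<alpha>) = 10 * (z\<^sup>2 / z powr (3 - \<alpha>)) * ln (H / z) * Q" by simp
    also have "\<dots> = 10 * ((ln (H / z) * z powr (\<alpha> - 1)) * Q)" unfolding pw(2)[OF z] by simp
    also have "\<dots> \<le> 10 * ((2 * L * \<delta> * z powr (\<alpha> - 2)) * Q)" by (intro mult_left_mono mult_right_mono[OF log[OF z] Q]) simp
    finally show "10 * z\<^sup>2 * ln (H / z) * Q / z powr (3 - \<alpha>) \<le> 20 * L * \<delta> * Q * z powr (\<alpha> - 2)" by (simp add: mult_ac)
    show "0 \<le> 10 * z\<^sup>2 * ln (H / z) * Q" using lnpos[OF z] Q by simp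
  qed (use L \<delta> Q in auto)
  ultimately have "weighted_integral ?A (5 - \<alpha>) \<Lambda> w + weighted_integral ?A (3 - \<alpha>) \<Lambda> (dz H w)
      \<le> ennreal (2 * L * \<delta> * Q * (\<delta> powr (\<alpha> - 1) / (\<alpha> - 1))) + ennreal (20 * L * \<delta> * Q * (\<delta> powr (\<alpha> - 1) / (\<alpha> - 1)))"
    by (rule add_mono)
  also have "\<dots> = ennreal (2 * L * \<delta> * Q * (\<delta> powr (\<alpha> - 1) / (\<alpha> - 1)) + 20 * L * \<delta> * Q * (\<delta> powr (\<alpha> - 1) / (\<alpha> - 1)))"
    using L \<delta> Q \<alpha> by (intro ennreal_plus[symmetric]) auto
  also have "2 * L * \<delta> * Q * p + 20 * L * \<delta> * Q * p = 22 * (\<delta> * p) * L * Q" for p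
    by (simp add: algebra_simps)
  also have "\<delta> * (\<delta> powr (\<alpha> - 1) / (\<alpha> - 1)) = \<delta> * \<delta> powr (\<alpha> - 1) / (\<alpha> - 1)" by simp
  also have "\<delta> * \<delta> powr (\<alpha> - 1) = \<delta> powr \<alpha>" using \<delta> powr_mult_base[of \<delta> "\<alpha> - 1"] by simp
  also have "ennreal (22 * (\<delta> powr \<alpha> / (\<alpha> - 1)) * L * Q) \<le> ennreal (22 * (\<delta> powr \<alpha> / (\<alpha> - 1)) * L\<^sup>2 * Q)"
    using L \<alpha> Q self_le_power[of L 2] by (intro ennreal_leI mult_right_mono mult_left_mono) auto
  finally show ?thesis by (simp add: L_def Q_def)
qed

text \<open>
Above height \<open>\<delta>\<close> the pointwise bounds contribute one factor \<open>ln (H / \<delta>)\<close> and the integral of \<open>1 / z\<close> the other.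
\<close>

lemma bulk_estimate:
  assumes \<delta>: "0 < \<delta>" "\<delta> \<le> exp (- 1) * H"
  shows "weighted_integral {\<delta><..<H} 5 \<Lambda> w + weighted_integral {\<delta><..<H} 3 \<Lambda> (dz H w)
    \<le> ennreal (22 * (ln (H / \<delta>))\<^sup>2 * flux_integral H \<Lambda> T w)"
proof -
  define L Q where "L = ln (H / \<delta>)" and "Q = flux_integral H \<Lambda> T w"
  have L: "1 \<le> L" "\<delta> < H" using ln_ge_1[OF \<delta>] by (simp_all add: L_def)
  have Q: "0 \<le> Q" unfolding Q_def by (rule flux_integral_nonneg)
  let ?A = "{\<delta><..<H}"
  have log: "0 \<le> ln (H / z)" "ln (H / z) \<le> L" if "z \<in> ?A" for z
    using that \<delta> H by (auto simp: L_def ln_div)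
  have "((\<lambda>z. 1 / z) has_integral (ln H - ln \<delta>)) {\<delta>..H}"
    by (rule fundamental_theorem_of_calculus)
       (use \<delta> L in \<open>auto intro!: derivative_eq_intros simp flip: has_real_derivative_iff_has_vector_derivative\<close>)
  then have int: "((\<lambda>z. 1 / z) has_integral L) ?A"
    using \<delta> H by (simp add: has_integral_Icc_iff_Ioo L_def ln_div)
  have pw: "z ^ 4 / z powr 5 = 1 / z" "z\<^sup>2 / z powr 3 = 1 / z" if "z \<in> ?A" for z
    using that \<delta> by (simp_all add: field_simps power2_eq_square eval_nat_numeral)
  have "weighted_integral ?A 5 \<Lambda> w \<le> ennreal (L * Q * L)"
  proof (rule weighted_integral_le[OF _ _ _ _ _ _ _ _ int])
    fix z assume z: "z \<in> ?A"
    show "mean_inv_grad_sq \<Lambda> (\<lambda>t y. w t y z) \<le> ereal (z ^ 4 * ln (H / z) * Q)"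
      unfolding Q_def by (rule pointwise_mean_bounds) (use z \<delta> in auto)
    have "z ^ 4 * ln (H / z) * Q / z powr 5 = (z ^ 4 / z powr 5) * ln (H / z) * Q" by simp
    also have "\<dots> = ln (H / z) * (Q * (1 / z))" unfolding pw(1)[OF z] by simp
    also have "\<dots> \<le> L * (Q * (1 / z))" by (rule mult_right_mono[OF log(2)[OF z]]) (use Q z \<delta> in auto)
    finally show "z ^ 4 * ln (H / z) * Q / z powr 5 \<le> L * Q * (1 / z)" by (simp add: mult_ac)
    show "0 \<le> z ^ 4 * ln (H / z) * Q" using log[OF z] Q by simp
  qed (use L \<delta> Q in auto)
  moreover have "weighted_integral ?A 3 \<Lambda> (dz H w) \<le> ennreal (10 * L * Q * L)"
  proof (rule weighted_integral_le[OF _ _ _ _ _ _ _ _ int])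
    fix z assume z: "z \<in> ?A"
    show "mean_inv_grad_sq \<Lambda> (\<lambda>t y. dz H w t y z) \<le> ereal (10 * z\<^sup>2 * ln (H / z) * Q)"
      unfolding Q_def by (rule pointwise_mean_bounds) (use z \<delta> in auto)
    have "10 * z\<^sup>2 * ln (H / z) * Q / z powr 3 = 10 * (z\<^sup>2 / z powr 3) * ln (H / z) * Q" by simp
    also have "\<dots> = ln (H / z) * (10 * Q * (1 / z))" unfolding pw(2)[OF z] by simp
    also have "\<dots> \<le> L * (10 * Q * (1 / z))" by (rule mult_right_mono[OF log(2)[OF z]]) (use Q z \<delta> in auto)
    finally show "10 * z\<^sup>2 * ln (H / z) * Q / z powr 3 \<le> 10 * L * Q * (1 / z)" by (simp add: mult_ac)
    show "0 \<le> 10 * z\<^sup>2 * ln (H / z) * Q" using log[OF z] Q by simp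
  qed (use L \<delta> Q in auto)
  ultimately have "weighted_integral ?A 5 \<Lambda> w + weighted_integral ?A 3 \<Lambda> (dz H w)
      \<le> ennreal (L * Q * L) + ennreal (10 * L * Q * L)"
    by (rule add_mono)
  also have "\<dots> = ennreal (11 * L\<^sup>2 * Q)"
    using L Q by (subst ennreal_plus[symmetric]) (auto simp: power2_eq_square)
  also have "\<dots> \<le> ennreal (22 * L\<^sup>2 * Q)"
    using Q by (intro ennreal_leI mult_right_mono) auto
  finally show ?thesis by (simp add: L_def Q_def)
qed

end

theorem lemma3:
  "\<exists>c>0. \<exists>C>0. \<forall>H>0. \<forall>\<Lambda>>0. \<forall>(w :: 'n::finite field_fun) (T :: 'n field_fun).
     C_slab 4 H w \<longrightarrow> C_slab 2 H T \<longrightarrow>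
     periodic_y \<Lambda> H w \<longrightarrow> periodic_y \<Lambda> H T \<longrightarrow>
     (\<exists>M. \<forall>t\<ge>0. \<forall>y. \<forall>z\<in>{0..H}. \<bar>T t y z\<bar> \<le> M) \<longrightarrow>
     (\<forall>t\<ge>0. \<forall>y. \<forall>z\<in>{0<..<H}. laplace H (laplace H w) t y z = - laplace_y T t y z) \<longrightarrow>
     (\<forall>t\<ge>0. \<forall>y. \<forall>z\<in>{0, H}. w t y z = 0 \<and> dz H w t y z = 0) \<longrightarrow>
     (\<forall>\<delta> \<alpha>. 0 < \<delta> \<longrightarrow> \<delta> \<le> c * H \<longrightarrow> 1 < \<alpha> \<longrightarrow>
        weighted_integral {0<..<\<delta>} (5 - \<alpha>) \<Lambda> w + weighted_integral {0<..<\<delta>} (3 - \<alpha>) \<Lambda> (dz H w)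
          \<le> ennreal (C * (\<delta> powr \<alpha> / (\<alpha> - 1)) * (ln (H / \<delta>))\<^sup>2 * flux_integral H \<Lambda> T w) \<and>
        weighted_integral {\<delta><..<H} 5 \<Lambda> w + weighted_integral {\<delta><..<H} 3 \<Lambda> (dz H w)
          \<le> ennreal (C * (ln (H / \<delta>))\<^sup>2 * flux_integral H \<Lambda> T w))"
proof (rule exI[of _ "exp (- 1)"], intro conjI, simp, rule exI[of _ 22], intro conjI allI impI)
  fix H \<Lambda> :: real and w T :: "'n field_fun" and \<delta> \<alpha> :: real
  assume "0 < H" "0 < \<Lambda>" "C_slab 4 H w" "C_slab 2 H T" "periodic_y \<Lambda> H w" "periodic_y \<Lambda> H T"
    and bounded: "\<exists>M. \<forall>t\<ge>0. \<forall>y. \<forall>z\<in>{0..H}. \<bar>T t y z\<bar> \<le> M"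
    and pde: "\<forall>t\<ge>0. \<forall>y. \<forall>z\<in>{0<..<H}. laplace H (laplace H w) t y z = - laplace_y T t y z"
    and bc: "\<forall>t\<ge>0. \<forall>y. \<forall>z\<in>{0, H}. w t y z = 0 \<and> dz H w t y z = 0"
    and \<delta>: "0 < \<delta>" "\<delta> \<le> exp (- 1) * H" "1 < \<alpha>"
  obtain M where M: "\<forall>t\<ge>0. \<forall>y. \<forall>z\<in>{0..H}. \<bar>T t y z\<bar> \<le> M" using bounded ..
  interpret plate H \<Lambda> M w T
  proof
    show "\<bar>T t y z\<bar> \<le> M" if "0 \<le> t" "z \<in> {0..H}" for t y z using M that by blast
    show "laplace H (laplace H w) t y z = - laplace_y T t y z" if "0 \<le> t" "z \<in> {0<..<H}" for t y z
      using pde that by blast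
    show "w t y z = 0 \<and> dz H w t y z = 0" if "0 \<le> t" "z \<in> {0, H}" for t y z using bc that by blast
  qed fact+
  show "weighted_integral {0<..<\<delta>} (5 - \<alpha>) \<Lambda> w + weighted_integral {0<..<\<delta>} (3 - \<alpha>) \<Lambda> (dz H w)
          \<le> ennreal (22 * (\<delta> powr \<alpha> / (\<alpha> - 1)) * (ln (H / \<delta>))\<^sup>2 * flux_integral H \<Lambda> T w)"
    by (rule boundary_layer_estimate[OF \<delta>])
  show "weighted_integral {\<delta><..<H} 5 \<Lambda> w + weighted_integral {\<delta><..<H} 3 \<Lambda> (dz H w)
          \<le> ennreal (22 * (ln (H / \<delta>))\<^sup>2 * flux_integral H \<Lambda> T w)"
    by (rule bulk_estimate[OF \<delta>(1,2)])
qed simp_all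

end
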